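(* Let $\mathcal{A}$ be a $\Bbbk$-linear monoidal category, let $\mathcal{M}$ be an $(\mathcal{A},\mathcal{A})$ $\star$-bimodule category, and let $Z\in\mathcal{K}^b(\mathcal{M})$. Let $L_Z,R_Z\colon\mathcal{A}\to\mathcal{K}^b(\mathcal{M})$ be the functors $L_Z(X)=Z\star X$ and $R_Z(X)=X\star Z$. Assume that $L_Z$ and $R_Z$ are fully faithful and have the same essential image. Then there is a monoidal autoequivalence $\Phi\colon\mathcal{A}\to\mathcal{A}$ such that $Z$ can be equipped with the structure of an object of the Drinfeld centralizer $\mathcal{Z}(\mathcal{A},\mathcal{K}^b({}^{\Phi}\mathcal{M}))$; that is, there are isomorphisms $\tau_X\colon Z\star X\to\Phi(X)\star Z$ in $\mathcal{K}^b(\mathcal{M})$, natural in $X\in\mathcal{A}$ and multiplicative, making $(Z,\tau)$ an object of this centralizer.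
   Context: $\Bbbk$ is a fixed commutative ring. The monoidal product of $\mathcal{A}$ is $\star$. An $(\mathcal{A},\mathcal{A})$ $\star$-bimodule category $\mathcal{M}$ is a $\Bbbk$-linear category with $\Bbbk$-bilinear functors $\star\colon\mathcal{A}\otimes\mathcal{M}\to\mathcal{M}$ and $\star\colon\mathcal{M}\otimes\mathcal{A}\to\mathcal{M}$ satisfying the usual unit and associativity constraints up to coherent natural isomorphism (these constraints are suppressed below). $\mathcal{K}^b(\mathcal{M})$ is the homotopy category of bounded cochain complexes over $\mathcal{M}$ (chain maps modulo homotopy); it is a $\star$-bimodule category over $\mathcal{A}$ by acting termwise. Drinfeld centralizer: for a $\star$-bimodule category $\mathcal{N}$ over $\mathcal{A}$, an object of $\mathcal{Z}(\mathcal{A},\mathcal{N})$ is a pair $(Z,\tau)$ with $Z\in\mathcal{N}$ and $\tau$ a natural isomorphism with components $\tau_X\colon Z\star X\to X\star Z$ ($X\in\mathcal{A}$) such that $\tau_{X\star Y}=(\mathrm{id}_X\star\tau_Y)\circ(\tau_X\star\mathrm{id}_Y)$ for all $X,Y\in\mathcal{A}$. For a monoidal autoequivalence $\Phi$ of $\mathcal{A}$, ${}^{\Phi}\mathcal{M}$ denotes $\mathcal{M}$ with the same right action and with left action twisted by $\Phi$, i.e. the left action of $X$ on $M$ is $\Phi(X)\star M$. Thus an object of $\mathcal{Z}(\mathcal{A},\mathcal{K}^b({}^{\Phi}\mathcal{M}))$ consists of $Z$ with natural isomorphisms $\tau_X\colon Z\star X\to\Phi(X)\star Z$ satisfying $\tau_{X\star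 Y}=(\mathrm{id}_{\Phi(X)}\star\tau_Y)\circ(\tau_X\star\mathrm{id}_Y)$ after identifying $\Phi(X\star Y)\cong\Phi(X)\star\Phi(Y)$ by the monoidal structure of $\Phi$. *)

theory Defs
  imports "HOL-Algebra.Module"
begin

section \<open>Linear categories\<close>

text \<open>Hom-sets are library modules; the ring part (multiplication and unit) of such a module
  record is never used.  All data are meaningful on carriers only.\<close>

record ('k, 'o, 'm) lin_cat =
  Ob :: "'o set"
  Dom :: "'m \<Rightarrow> 'o"
  Cod :: "'m \<Rightarrow> 'o"
  Hom :: "'o \<Rightarrow> 'o \<Rightarrow> ('k, 'm) module"
  Ident :: "'o \<Rightarrow> 'm"
  Cmp :: "'m \<Rightarrow> 'm \<Rightarrow> 'm"  (infixr "\<cdot>\<index>" 75)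

abbreviation arr :: "('k, 'o, 'm, 'z) lin_cat_scheme \<Rightarrow> 'o \<Rightarrow> 'o \<Rightarrow> 'm set" where
  "arr C X Y \<equiv> carrier (Hom C X Y)"

locale linear_category =
  fixes K :: "('k, 'r) ring_scheme" and C :: "('k, 'o, 'm, 'z) lin_cat_scheme"
  assumes base_ring: "cring K"
    and hom_module: "\<lbrakk>X \<in> Ob C; Y \<in> Ob C\<rbrakk> \<Longrightarrow> module K (Hom C X Y)"
    and dom_cod: "\<lbrakk>X \<in> Ob C; Y \<in> Ob C; f \<in> arr C X Y\<rbrakk> \<Longrightarrow> Dom C f = X \<and> Cod C f = Y"
    and ident_arr: "X \<in> Ob C \<Longrightarrow> Ident C X \<in> arr C X X"
    and cmp_arr: "\<lbrakk>X \<in> Ob C; Y \<in> Ob C; Z \<in> Ob C; f \<in> arr C X Y; g \<in> arr C Y Z\<rbrakk>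
      \<Longrightarrow> g \<cdot>\<^bsub>C\<^esub> f \<in> arr C X Z"
    and ident_left: "\<lbrakk>X \<in> Ob C; Y \<in> Ob C; f \<in> arr C X Y\<rbrakk> \<Longrightarrow> Ident C Y \<cdot>\<^bsub>C\<^esub> f = f"
    and ident_right: "\<lbrakk>X \<in> Ob C; Y \<in> Ob C; f \<in> arr C X Y\<rbrakk> \<Longrightarrow> f \<cdot>\<^bsub>C\<^esub> Ident C X = f"
    and cmp_assoc: "\<lbrakk>W \<in> Ob C; X \<in> Ob C; Y \<in> Ob C; Z \<in> Ob C;
        f \<in> arr C W X; g \<in> arr C X Y; h \<in> arr C Y Z\<rbrakk>
      \<Longrightarrow> (h \<cdot>\<^bsub>C\<^esub> g) \<cdot>\<^bsub>C\<^esub> f = h \<cdot>\<^bsub>C\<^esub> (g \<cdot>\<^bsub>C\<^esub> f)"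
    and cmp_add_left: "\<lbrakk>X \<in> Ob C; Y \<in> Ob C; Z \<in> Ob C;
        f \<in> arr C X Y; g \<in> arr C Y Z; g' \<in> arr C Y Z\<rbrakk>
      \<Longrightarrow> (g \<oplus>\<^bsub>Hom C Y Z\<^esub> g') \<cdot>\<^bsub>C\<^esub> f = (g \<cdot>\<^bsub>C\<^esub> f) \<oplus>\<^bsub>Hom C X Z\<^esub> (g' \<cdot>\<^bsub>C\<^esub> f)"
    and cmp_add_right: "\<lbrakk>X \<in> Ob C; Y \<in> Ob C; Z \<in> Ob C;
        f \<in> arr C X Y; f' \<in> arr C X Y; g \<in> arr C Y Z\<rbrakk>
      \<Longrightarrow> g \<cdot>\<^bsub>C\<^esub> (f \<oplus>\<^bsub>Hom C X Y\<^esub> f') = (g \<cdot>\<^bsub>C\<^esub> f) \<oplus>\<^bsub>Hom C X Z\<^esub> (g \<cdot>\<^bsub>C\<^esub> f')"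
    and cmp_smult_left: "\<lbrakk>X \<in> Ob C; Y \<in> Ob C; Z \<in> Ob C; a \<in> carrier K;
        f \<in> arr C X Y; g \<in> arr C Y Z\<rbrakk>
      \<Longrightarrow> (a \<odot>\<^bsub>Hom C Y Z\<^esub> g) \<cdot>\<^bsub>C\<^esub> f = a \<odot>\<^bsub>Hom C X Z\<^esub> (g \<cdot>\<^bsub>C\<^esub> f)"
    and cmp_smult_right: "\<lbrakk>X \<in> Ob C; Y \<in> Ob C; Z \<in> Ob C; a \<in> carrier K;
        f \<in> arr C X Y; g \<in> arr C Y Z\<rbrakk>
      \<Longrightarrow> g \<cdot>\<^bsub>C\<^esub> (a \<odot>\<^bsub>Hom C X Y\<^esub> f) = a \<odot>\<^bsub>Hom C X Z\<^esub> (g \<cdot>\<^bsub>C\<^esub> f)"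

definition iso_arr :: "('k, 'o, 'm, 'z) lin_cat_scheme \<Rightarrow> 'o \<Rightarrow> 'o \<Rightarrow> 'm \<Rightarrow> bool" where
  "iso_arr C X Y f \<longleftrightarrow> f \<in> arr C X Y \<and>
     (\<exists>g \<in> arr C Y X. g \<cdot>\<^bsub>C\<^esub> f = Ident C X \<and> f \<cdot>\<^bsub>C\<^esub> g = Ident C Y)"

definition zero_object :: "('k, 'o, 'm, 'z) lin_cat_scheme \<Rightarrow> 'o \<Rightarrow> bool" where
  "zero_object C N \<longleftrightarrow> N \<in> Ob C \<and>
     (\<forall>X \<in> Ob C. (\<exists>!f. f \<in> arr C N X) \<and> (\<exists>!f. f \<in> arr C X N))"


section \<open>Functors and natural isomorphisms\<close>

record ('o, 'm, 'p, 'n) fctr =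
  FO :: "'o \<Rightarrow> 'p"
  FA :: "'m \<Rightarrow> 'n"

locale linear_functor = C: linear_category K C + D: linear_category K D
  for K :: "('k, 'r) ring_scheme"
    and C :: "('k, 'o, 'm, 'z) lin_cat_scheme" and D :: "('k, 'p, 'n, 'y) lin_cat_scheme" +
  fixes F :: "('o, 'm, 'p, 'n, 'x) fctr_scheme"
  assumes fun_ob: "X \<in> Ob C \<Longrightarrow> FO F X \<in> Ob D"
    and fun_arr: "\<lbrakk>X \<in> Ob C; Y \<in> Ob C; f \<in> arr C X Y\<rbrakk>
      \<Longrightarrow> FA F f \<in> arr D (FO F X) (FO F Y)"
    and fun_ident: "X \<in> Ob C \<Longrightarrow> FA F (Ident C X) = Ident D (FO F X)"
    and fun_cmp: "\<lbrakk>X \<in> Ob C; Y \<in> Ob C; Z \<in> Ob C; f \<in> arr C X Y; g \<in> arr C Y Z\<rbrakk>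
      \<Longrightarrow> FA F (g \<cdot>\<^bsub>C\<^esub> f) = FA F g \<cdot>\<^bsub>D\<^esub> FA F f"
    and fun_add: "\<lbrakk>X \<in> Ob C; Y \<in> Ob C; f \<in> arr C X Y; g \<in> arr C X Y\<rbrakk>
      \<Longrightarrow> FA F (f \<oplus>\<^bsub>Hom C X Y\<^esub> g) = FA F f \<oplus>\<^bsub>Hom D (FO F X) (FO F Y)\<^esub> FA F g"
    and fun_smult: "\<lbrakk>X \<in> Ob C; Y \<in> Ob C; a \<in> carrier K; f \<in> arr C X Y\<rbrakk>
      \<Longrightarrow> FA F (a \<odot>\<^bsub>Hom C X Y\<^esub> f) = a \<odot>\<^bsub>Hom D (FO F X) (FO F Y)\<^esub> FA F f"

definition fun_id :: "('o, 'm, 'o, 'm) fctr" where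
  "fun_id = \<lparr>FO = (\<lambda>X. X), FA = (\<lambda>f. f)\<rparr>"

definition fun_comp ::
    "('p, 'n, 'q, 'l, 'x) fctr_scheme \<Rightarrow> ('o, 'm, 'p, 'n, 'y) fctr_scheme \<Rightarrow> ('o, 'm, 'q, 'l) fctr" where
  "fun_comp G F = \<lparr>FO = FO G \<circ> FO F, FA = FA G \<circ> FA F\<rparr>"

definition nat_iso ::
    "('k, 'o, 'm, 'z) lin_cat_scheme \<Rightarrow> ('l, 'p, 'n, 'y) lin_cat_scheme
      \<Rightarrow> ('o, 'm, 'p, 'n, 'x) fctr_scheme \<Rightarrow> ('o, 'm, 'p, 'n, 'w) fctr_scheme
      \<Rightarrow> ('o \<Rightarrow> 'n) \<Rightarrow> bool" where
  "nat_iso C D F G t \<longleftrightarrow>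
     (\<forall>X \<in> Ob C. iso_arr D (FO F X) (FO G X) (t X)) \<and>
     (\<forall>X \<in> Ob C. \<forall>Y \<in> Ob C. \<forall>f \<in> arr C X Y. t Y \<cdot>\<^bsub>D\<^esub> FA F f = FA G f \<cdot>\<^bsub>D\<^esub> t X)"

definition fully_faithful ::
    "('k, 'o, 'm, 'z) lin_cat_scheme \<Rightarrow> ('l, 'p, 'n, 'y) lin_cat_scheme
      \<Rightarrow> ('o, 'm, 'p, 'n, 'x) fctr_scheme \<Rightarrow> bool" where
  "fully_faithful C D F \<longleftrightarrow>
     (\<forall>X \<in> Ob C. \<forall>Y \<in> Ob C. bij_betw (FA F) (arr C X Y) (arr D (FO F X) (FO F Y)))"

definition ess_image ::
    "('k, 'o, 'm, 'z) lin_cat_scheme \<Rightarrow> ('l, 'p, 'n, 'y) lin_cat_scheme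
      \<Rightarrow> ('o, 'm, 'p, 'n, 'x) fctr_scheme \<Rightarrow> 'p set" where
  "ess_image C D F = {Y \<in> Ob D. \<exists>X \<in> Ob C. \<exists>f. iso_arr D (FO F X) Y f}"

definition equivalence ::
    "('k, 'r) ring_scheme \<Rightarrow> ('k, 'o, 'm, 'z) lin_cat_scheme \<Rightarrow> ('k, 'p, 'n, 'y) lin_cat_scheme
      \<Rightarrow> ('o, 'm, 'p, 'n, 'x) fctr_scheme \<Rightarrow> bool" where
  "equivalence K C D F \<longleftrightarrow> linear_functor K C D F \<and>
     (\<exists>(G :: ('p, 'n, 'o, 'm) fctr) s t. linear_functor K D C G \<and>
        nat_iso C C (fun_comp G F) fun_id s \<and> nat_iso D D (fun_comp F G) fun_id t)"

locale bilinear_bifunctor =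
  C: linear_category K C + D: linear_category K D + E: linear_category K E
  for K :: "('k, 'r) ring_scheme"
    and C :: "('k, 'o, 'm, 'z) lin_cat_scheme" and D :: "('k, 'p, 'n, 'y) lin_cat_scheme"
    and E :: "('k, 'q, 'l, 'x) lin_cat_scheme" +
  fixes TO :: "'o \<Rightarrow> 'p \<Rightarrow> 'q" and TA :: "'m \<Rightarrow> 'n \<Rightarrow> 'l"
  assumes bi_ob: "\<lbrakk>X \<in> Ob C; Y \<in> Ob D\<rbrakk> \<Longrightarrow> TO X Y \<in> Ob E"
    and bi_arr: "\<lbrakk>X \<in> Ob C; X' \<in> Ob C; Y \<in> Ob D; Y' \<in> Ob D; f \<in> arr C X X'; g \<in> arr D Y Y'\<rbrakk>
      \<Longrightarrow> TA f g \<in> arr E (TO X Y) (TO X' Y')"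
    and bi_ident: "\<lbrakk>X \<in> Ob C; Y \<in> Ob D\<rbrakk> \<Longrightarrow> TA (Ident C X) (Ident D Y) = Ident E (TO X Y)"
    and bi_cmp: "\<lbrakk>X \<in> Ob C; X' \<in> Ob C; X'' \<in> Ob C; Y \<in> Ob D; Y' \<in> Ob D; Y'' \<in> Ob D;
        f \<in> arr C X X'; f' \<in> arr C X' X''; g \<in> arr D Y Y'; g' \<in> arr D Y' Y''\<rbrakk>
      \<Longrightarrow> TA (f' \<cdot>\<^bsub>C\<^esub> f) (g' \<cdot>\<^bsub>D\<^esub> g) = TA f' g' \<cdot>\<^bsub>E\<^esub> TA f g"
    and bi_add_left: "\<lbrakk>X \<in> Ob C; X' \<in> Ob C; Y \<in> Ob D; Y' \<in> Ob D;
        f \<in> arr C X X'; f' \<in> arr C X X'; g \<in> arr D Y Y'\<rbrakk>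
      \<Longrightarrow> TA (f \<oplus>\<^bsub>Hom C X X'\<^esub> f') g = TA f g \<oplus>\<^bsub>Hom E (TO X Y) (TO X' Y')\<^esub> TA f' g"
    and bi_add_right: "\<lbrakk>X \<in> Ob C; X' \<in> Ob C; Y \<in> Ob D; Y' \<in> Ob D;
        f \<in> arr C X X'; g \<in> arr D Y Y'; g' \<in> arr D Y Y'\<rbrakk>
      \<Longrightarrow> TA f (g \<oplus>\<^bsub>Hom D Y Y'\<^esub> g') = TA f g \<oplus>\<^bsub>Hom E (TO X Y) (TO X' Y')\<^esub> TA f g'"
    and bi_smult_left: "\<lbrakk>X \<in> Ob C; X' \<in> Ob C; Y \<in> Ob D; Y' \<in> Ob D; a \<in> carrier K;
        f \<in> arr C X X'; g \<in> arr D Y Y'\<rbrakk>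
      \<Longrightarrow> TA (a \<odot>\<^bsub>Hom C X X'\<^esub> f) g = a \<odot>\<^bsub>Hom E (TO X Y) (TO X' Y')\<^esub> TA f g"
    and bi_smult_right: "\<lbrakk>X \<in> Ob C; X' \<in> Ob C; Y \<in> Ob D; Y' \<in> Ob D; a \<in> carrier K;
        f \<in> arr C X X'; g \<in> arr D Y Y'\<rbrakk>
      \<Longrightarrow> TA f (a \<odot>\<^bsub>Hom D Y Y'\<^esub> g) = a \<odot>\<^bsub>Hom E (TO X Y) (TO X' Y')\<^esub> TA f g"


section \<open>Monoidal categories and monoidal functors\<close>

record ('k, 'o, 'm) mon_cat = "('k, 'o, 'm) lin_cat" +
  TensO :: "'o \<Rightarrow> 'o \<Rightarrow> 'o"  (infixr "\<star>\<index>" 80)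
  TensA :: "'m \<Rightarrow> 'm \<Rightarrow> 'm"  (infixr "\<ast>\<index>" 80)
  Unit :: "'o"
  Assoc :: "'o \<Rightarrow> 'o \<Rightarrow> 'o \<Rightarrow> 'm"
  LUnit :: "'o \<Rightarrow> 'm"
  RUnit :: "'o \<Rightarrow> 'm"

locale monoidal_category = bilinear_bifunctor K A A A "TensO A" "TensA A"
  for K :: "('k, 'r) ring_scheme" and A :: "('k, 'o, 'm, 'z) mon_cat_scheme" +
  assumes unit_ob: "Unit A \<in> Ob A"
    and assoc_iso: "\<lbrakk>X \<in> Ob A; Y \<in> Ob A; Z \<in> Ob A\<rbrakk>
      \<Longrightarrow> iso_arr A ((X \<star>\<^bsub>A\<^esub> Y) \<star>\<^bsub>A\<^esub> Z) (X \<star>\<^bsub>A\<^esub> (Y \<star>\<^bsub>A\<^esub> Z)) (Assoc A X Y Z)"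
    and assoc_nat: "\<lbrakk>X \<in> Ob A; X' \<in> Ob A; Y \<in> Ob A; Y' \<in> Ob A; Z \<in> Ob A; Z' \<in> Ob A;
        f \<in> arr A X X'; g \<in> arr A Y Y'; h \<in> arr A Z Z'\<rbrakk>
      \<Longrightarrow> Assoc A X' Y' Z' \<cdot>\<^bsub>A\<^esub> ((f \<ast>\<^bsub>A\<^esub> g) \<ast>\<^bsub>A\<^esub> h) = (f \<ast>\<^bsub>A\<^esub> (g \<ast>\<^bsub>A\<^esub> h)) \<cdot>\<^bsub>A\<^esub> Assoc A X Y Z"
    and lunit_iso: "X \<in> Ob A \<Longrightarrow> iso_arr A (Unit A \<star>\<^bsub>A\<^esub> X) X (LUnit A X)"
    and lunit_nat: "\<lbrakk>X \<in> Ob A; Y \<in> Ob A; f \<in> arr A X Y\<rbrakk>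
      \<Longrightarrow> LUnit A Y \<cdot>\<^bsub>A\<^esub> (Ident A (Unit A) \<ast>\<^bsub>A\<^esub> f) = f \<cdot>\<^bsub>A\<^esub> LUnit A X"
    and runit_iso: "X \<in> Ob A \<Longrightarrow> iso_arr A (X \<star>\<^bsub>A\<^esub> Unit A) X (RUnit A X)"
    and runit_nat: "\<lbrakk>X \<in> Ob A; Y \<in> Ob A; f \<in> arr A X Y\<rbrakk>
      \<Longrightarrow> RUnit A Y \<cdot>\<^bsub>A\<^esub> (f \<ast>\<^bsub>A\<^esub> Ident A (Unit A)) = f \<cdot>\<^bsub>A\<^esub> RUnit A X"
    and pentagon: "\<lbrakk>W \<in> Ob A; X \<in> Ob A; Y \<in> Ob A; Z \<in> Ob A\<rbrakk>
      \<Longrightarrow> Assoc A W X (Y \<star>\<^bsub>A\<^esub> Z) \<cdot>\<^bsub>A\<^esub> Assoc A (W \<star>\<^bsub>A\<^esub> X) Y Z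
        = (Ident A W \<ast>\<^bsub>A\<^esub> Assoc A X Y Z) \<cdot>\<^bsub>A\<^esub> Assoc A W (X \<star>\<^bsub>A\<^esub> Y) Z
            \<cdot>\<^bsub>A\<^esub> (Assoc A W X Y \<ast>\<^bsub>A\<^esub> Ident A Z)"
    and triangle: "\<lbrakk>X \<in> Ob A; Y \<in> Ob A\<rbrakk>
      \<Longrightarrow> (Ident A X \<ast>\<^bsub>A\<^esub> LUnit A Y) \<cdot>\<^bsub>A\<^esub> Assoc A X (Unit A) Y = RUnit A X \<ast>\<^bsub>A\<^esub> Ident A Y"

text \<open>The structure isomorphisms are \<open>FMult X Y : F (X \<star> Y) \<rightarrow> F X \<star> F Y\<close> and \<open>FUnit : F 1 \<rightarrow> 1\<close>;
  both are required to be invertible, so the choice of direction is immaterial.\<close>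

record ('o, 'm, 'p, 'n) mon_fctr = "('o, 'm, 'p, 'n) fctr" +
  FMult :: "'o \<Rightarrow> 'o \<Rightarrow> 'n"
  FUnit :: "'n"

locale monoidal_functor = A: monoidal_category K A + B: monoidal_category K B + linear_functor K A B F
  for K :: "('k, 'r) ring_scheme"
    and A :: "('k, 'o, 'm, 'z) mon_cat_scheme" and B :: "('k, 'p, 'n, 'y) mon_cat_scheme"
    and F :: "('o, 'm, 'p, 'n, 'x) mon_fctr_scheme" +
  assumes fmult_iso: "\<lbrakk>X \<in> Ob A; Y \<in> Ob A\<rbrakk>
      \<Longrightarrow> iso_arr B (FO F (X \<star>\<^bsub>A\<^esub> Y)) (FO F X \<star>\<^bsub>B\<^esub> FO F Y) (FMult F X Y)"
    and fmult_nat: "\<lbrakk>X \<in> Ob A; X' \<in> Ob A; Y \<in> Ob A; Y' \<in> Ob A; f \<in> arr A X X'; g \<in> arr A Y Y'\<rbrakk>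
      \<Longrightarrow> FMult F X' Y' \<cdot>\<^bsub>B\<^esub> FA F (f \<ast>\<^bsub>A\<^esub> g) = (FA F f \<ast>\<^bsub>B\<^esub> FA F g) \<cdot>\<^bsub>B\<^esub> FMult F X Y"
    and funit_iso: "iso_arr B (FO F (Unit A)) (Unit B) (FUnit F)"
    and fmult_assoc: "\<lbrakk>X \<in> Ob A; Y \<in> Ob A; Z \<in> Ob A\<rbrakk>
      \<Longrightarrow> Assoc B (FO F X) (FO F Y) (FO F Z) \<cdot>\<^bsub>B\<^esub> (FMult F X Y \<ast>\<^bsub>B\<^esub> Ident B (FO F Z))
            \<cdot>\<^bsub>B\<^esub> FMult F (X \<star>\<^bsub>A\<^esub> Y) Z
        = (Ident B (FO F X) \<ast>\<^bsub>B\<^esub> FMult F Y Z) \<cdot>\<^bsub>B\<^esub> FMult F X (Y \<star>\<^bsub>A\<^esub> Z)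
            \<cdot>\<^bsub>B\<^esub> FA F (Assoc A X Y Z)"
    and fmult_lunit: "X \<in> Ob A
      \<Longrightarrow> LUnit B (FO F X) \<cdot>\<^bsub>B\<^esub> (FUnit F \<ast>\<^bsub>B\<^esub> Ident B (FO F X)) \<cdot>\<^bsub>B\<^esub> FMult F (Unit A) X
        = FA F (LUnit A X)"
    and fmult_runit: "X \<in> Ob A
      \<Longrightarrow> RUnit B (FO F X) \<cdot>\<^bsub>B\<^esub> (Ident B (FO F X) \<ast>\<^bsub>B\<^esub> FUnit F) \<cdot>\<^bsub>B\<^esub> FMult F X (Unit A)
        = FA F (RUnit A X)"

definition monoidal_autoequivalence ::
    "('k, 'r) ring_scheme \<Rightarrow> ('k, 'o, 'm, 'z) mon_cat_scheme \<Rightarrow> ('o, 'm, 'o, 'm, 'x) mon_fctr_scheme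
      \<Rightarrow> bool" where
  "monoidal_autoequivalence K A F \<longleftrightarrow> monoidal_functor K A A F \<and> equivalence K A A F"


section \<open>Bimodule categories\<close>

text \<open>The left action is written \<open>\<triangleright>\<close> on objects and \<open>\<unrhd>\<close> on arrows, the right action \<open>\<triangleleft>\<close> and \<open>\<unlhd>\<close>.\<close>

record ('k, 'a, 'f, 'o, 'm) bimod_cat = "('k, 'o, 'm) lin_cat" +
  LActO :: "'a \<Rightarrow> 'o \<Rightarrow> 'o"  (infixr "\<triangleright>\<index>" 80)
  LActA :: "'f \<Rightarrow> 'm \<Rightarrow> 'm"  (infixr "\<unrhd>\<index>" 80)
  RActO :: "'o \<Rightarrow> 'a \<Rightarrow> 'o"  (infixl "\<triangleleft>\<index>" 80)
  RActA :: "'m \<Rightarrow> 'f \<Rightarrow> 'm"  (infixl "\<unlhd>\<index>" 80)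
  LAssoc :: "'a \<Rightarrow> 'a \<Rightarrow> 'o \<Rightarrow> 'm"
  RAssoc :: "'o \<Rightarrow> 'a \<Rightarrow> 'a \<Rightarrow> 'm"
  MAssoc :: "'a \<Rightarrow> 'o \<Rightarrow> 'a \<Rightarrow> 'm"
  LActUnit :: "'o \<Rightarrow> 'm"
  RActUnit :: "'o \<Rightarrow> 'm"

locale bimodule_category =
  A: monoidal_category K A + M: linear_category K M +
  left: bilinear_bifunctor K A M M "LActO M" "LActA M" +
  right: bilinear_bifunctor K M A M "RActO M" "RActA M"
  for K :: "('k, 'r) ring_scheme" and A :: "('k, 'a, 'f, 'z) mon_cat_scheme"
    and M :: "('k, 'a, 'f, 'o, 'm, 'y) bimod_cat_scheme" +
  assumes lassoc_iso: "\<lbrakk>X \<in> Ob A; Y \<in> Ob A; N \<in> Ob M\<rbrakk>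
      \<Longrightarrow> iso_arr M ((X \<star>\<^bsub>A\<^esub> Y) \<triangleright>\<^bsub>M\<^esub> N) (X \<triangleright>\<^bsub>M\<^esub> (Y \<triangleright>\<^bsub>M\<^esub> N)) (LAssoc M X Y N)"
    and lassoc_nat: "\<lbrakk>X \<in> Ob A; X' \<in> Ob A; Y \<in> Ob A; Y' \<in> Ob A; N \<in> Ob M; N' \<in> Ob M;
        f \<in> arr A X X'; g \<in> arr A Y Y'; h \<in> arr M N N'\<rbrakk>
      \<Longrightarrow> LAssoc M X' Y' N' \<cdot>\<^bsub>M\<^esub> ((f \<ast>\<^bsub>A\<^esub> g) \<unrhd>\<^bsub>M\<^esub> h) = (f \<unrhd>\<^bsub>M\<^esub> (g \<unrhd>\<^bsub>M\<^esub> h)) \<cdot>\<^bsub>M\<^esub> LAssoc M X Y N"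
    and rassoc_iso: "\<lbrakk>N \<in> Ob M; X \<in> Ob A; Y \<in> Ob A\<rbrakk>
      \<Longrightarrow> iso_arr M ((N \<triangleleft>\<^bsub>M\<^esub> X) \<triangleleft>\<^bsub>M\<^esub> Y) (N \<triangleleft>\<^bsub>M\<^esub> (X \<star>\<^bsub>A\<^esub> Y)) (RAssoc M N X Y)"
    and rassoc_nat: "\<lbrakk>N \<in> Ob M; N' \<in> Ob M; X \<in> Ob A; X' \<in> Ob A; Y \<in> Ob A; Y' \<in> Ob A;
        h \<in> arr M N N'; f \<in> arr A X X'; g \<in> arr A Y Y'\<rbrakk>
      \<Longrightarrow> RAssoc M N' X' Y' \<cdot>\<^bsub>M\<^esub> ((h \<unlhd>\<^bsub>M\<^esub> f) \<unlhd>\<^bsub>M\<^esub> g) = (h \<unlhd>\<^bsub>M\<^esub> (f \<ast>\<^bsub>A\<^esub> g)) \<cdot>\<^bsub>M\<^esub> RAssoc M N X Y"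
    and massoc_iso: "\<lbrakk>X \<in> Ob A; N \<in> Ob M; Y \<in> Ob A\<rbrakk>
      \<Longrightarrow> iso_arr M ((X \<triangleright>\<^bsub>M\<^esub> N) \<triangleleft>\<^bsub>M\<^esub> Y) (X \<triangleright>\<^bsub>M\<^esub> (N \<triangleleft>\<^bsub>M\<^esub> Y)) (MAssoc M X N Y)"
    and massoc_nat: "\<lbrakk>X \<in> Ob A; X' \<in> Ob A; N \<in> Ob M; N' \<in> Ob M; Y \<in> Ob A; Y' \<in> Ob A;
        f \<in> arr A X X'; h \<in> arr M N N'; g \<in> arr A Y Y'\<rbrakk>
      \<Longrightarrow> MAssoc M X' N' Y' \<cdot>\<^bsub>M\<^esub> ((f \<unrhd>\<^bsub>M\<^esub> h) \<unlhd>\<^bsub>M\<^esub> g) = (f \<unrhd>\<^bsub>M\<^esub> (h \<unlhd>\<^bsub>M\<^esub> g)) \<cdot>\<^bsub>M\<^esub> MAssoc M X N Y"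
    and lactunit_iso: "N \<in> Ob M \<Longrightarrow> iso_arr M (Unit A \<triangleright>\<^bsub>M\<^esub> N) N (LActUnit M N)"
    and lactunit_nat: "\<lbrakk>N \<in> Ob M; N' \<in> Ob M; h \<in> arr M N N'\<rbrakk>
      \<Longrightarrow> LActUnit M N' \<cdot>\<^bsub>M\<^esub> (Ident A (Unit A) \<unrhd>\<^bsub>M\<^esub> h) = h \<cdot>\<^bsub>M\<^esub> LActUnit M N"
    and ractunit_iso: "N \<in> Ob M \<Longrightarrow> iso_arr M (N \<triangleleft>\<^bsub>M\<^esub> Unit A) N (RActUnit M N)"
    and ractunit_nat: "\<lbrakk>N \<in> Ob M; N' \<in> Ob M; h \<in> arr M N N'\<rbrakk>
      \<Longrightarrow> RActUnit M N' \<cdot>\<^bsub>M\<^esub> (h \<unlhd>\<^bsub>M\<^esub> Ident A (Unit A)) = h \<cdot>\<^bsub>M\<^esub> RActUnit M N"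
    and left_pentagon: "\<lbrakk>X \<in> Ob A; Y \<in> Ob A; W \<in> Ob A; N \<in> Ob M\<rbrakk>
      \<Longrightarrow> LAssoc M X Y (W \<triangleright>\<^bsub>M\<^esub> N) \<cdot>\<^bsub>M\<^esub> LAssoc M (X \<star>\<^bsub>A\<^esub> Y) W N
        = (Ident A X \<unrhd>\<^bsub>M\<^esub> LAssoc M Y W N) \<cdot>\<^bsub>M\<^esub> LAssoc M X (Y \<star>\<^bsub>A\<^esub> W) N
            \<cdot>\<^bsub>M\<^esub> (Assoc A X Y W \<unrhd>\<^bsub>M\<^esub> Ident M N)"
    and right_pentagon: "\<lbrakk>N \<in> Ob M; X \<in> Ob A; Y \<in> Ob A; W \<in> Ob A\<rbrakk>
      \<Longrightarrow> RAssoc M N X (Y \<star>\<^bsub>A\<^esub> W) \<cdot>\<^bsub>M\<^esub> RAssoc M (N \<triangleleft>\<^bsub>M\<^esub> X) Y W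
        = (Ident M N \<unlhd>\<^bsub>M\<^esub> Assoc A X Y W) \<cdot>\<^bsub>M\<^esub> RAssoc M N (X \<star>\<^bsub>A\<^esub> Y) W
            \<cdot>\<^bsub>M\<^esub> (RAssoc M N X Y \<unlhd>\<^bsub>M\<^esub> Ident A W)"
    and left_middle_pentagon: "\<lbrakk>X \<in> Ob A; Y \<in> Ob A; N \<in> Ob M; W \<in> Ob A\<rbrakk>
      \<Longrightarrow> LAssoc M X Y (N \<triangleleft>\<^bsub>M\<^esub> W) \<cdot>\<^bsub>M\<^esub> MAssoc M (X \<star>\<^bsub>A\<^esub> Y) N W
        = (Ident A X \<unrhd>\<^bsub>M\<^esub> MAssoc M Y N W) \<cdot>\<^bsub>M\<^esub> MAssoc M X (Y \<triangleright>\<^bsub>M\<^esub> N) W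
            \<cdot>\<^bsub>M\<^esub> (LAssoc M X Y N \<unlhd>\<^bsub>M\<^esub> Ident A W)"
    and right_middle_pentagon: "\<lbrakk>X \<in> Ob A; N \<in> Ob M; Y \<in> Ob A; W \<in> Ob A\<rbrakk>
      \<Longrightarrow> MAssoc M X N (Y \<star>\<^bsub>A\<^esub> W) \<cdot>\<^bsub>M\<^esub> RAssoc M (X \<triangleright>\<^bsub>M\<^esub> N) Y W
        = (Ident A X \<unrhd>\<^bsub>M\<^esub> RAssoc M N Y W) \<cdot>\<^bsub>M\<^esub> MAssoc M X (N \<triangleleft>\<^bsub>M\<^esub> Y) W
            \<cdot>\<^bsub>M\<^esub> (MAssoc M X N Y \<unlhd>\<^bsub>M\<^esub> Ident A W)"
    and left_triangle: "\<lbrakk>X \<in> Ob A; N \<in> Ob M\<rbrakk>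
      \<Longrightarrow> (Ident A X \<unrhd>\<^bsub>M\<^esub> LActUnit M N) \<cdot>\<^bsub>M\<^esub> LAssoc M X (Unit A) N = RUnit A X \<unrhd>\<^bsub>M\<^esub> Ident M N"
    and right_triangle: "\<lbrakk>N \<in> Ob M; X \<in> Ob A\<rbrakk>
      \<Longrightarrow> (Ident M N \<unlhd>\<^bsub>M\<^esub> LUnit A X) \<cdot>\<^bsub>M\<^esub> RAssoc M N (Unit A) X = RActUnit M N \<unlhd>\<^bsub>M\<^esub> Ident A X"

text \<open>\<open>twist F M\<close> is \<open>M\<close> with the left action pulled back along the monoidal functor \<open>F\<close>.\<close>

definition twist ::
    "('a, 'f, 'a, 'f, 'x) mon_fctr_scheme \<Rightarrow> ('k, 'a, 'f, 'o, 'm, 'y) bimod_cat_scheme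
      \<Rightarrow> ('k, 'a, 'f, 'o, 'm, 'y) bimod_cat_scheme" where
  "twist F M = M\<lparr>
     LActO := (\<lambda>X N. FO F X \<triangleright>\<^bsub>M\<^esub> N),
     LActA := (\<lambda>f h. FA F f \<unrhd>\<^bsub>M\<^esub> h),
     LAssoc := (\<lambda>X Y N. LAssoc M (FO F X) (FO F Y) N \<cdot>\<^bsub>M\<^esub> (FMult F X Y \<unrhd>\<^bsub>M\<^esub> Ident M N)),
     MAssoc := (\<lambda>X N Y. MAssoc M (FO F X) N Y),
     LActUnit := (\<lambda>N. LActUnit M N \<cdot>\<^bsub>M\<^esub> (FUnit F \<unrhd>\<^bsub>M\<^esub> Ident M N))\<rparr>"

definition L_fun :: "('k, 'a, 'f, 'o, 'm, 'y) bimod_cat_scheme \<Rightarrow> 'o \<Rightarrow> ('a, 'f, 'o, 'm) fctr" where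
  "L_fun N Z = \<lparr>FO = (\<lambda>X. Z \<triangleleft>\<^bsub>N\<^esub> X), FA = (\<lambda>f. Ident N Z \<unlhd>\<^bsub>N\<^esub> f)\<rparr>"

definition R_fun :: "('k, 'a, 'f, 'o, 'm, 'y) bimod_cat_scheme \<Rightarrow> 'o \<Rightarrow> ('a, 'f, 'o, 'm) fctr" where
  "R_fun N Z = \<lparr>FO = (\<lambda>X. X \<triangleright>\<^bsub>N\<^esub> Z), FA = (\<lambda>f. f \<unrhd>\<^bsub>N\<^esub> Ident N Z)\<rparr>"

text \<open>Objects of the Drinfeld centralizer.  The last clause is
  \<open>\<tau> (X \<star> Y) = (id\<^sub>X \<star> \<tau> Y) \<circ> (\<tau> X \<star> id\<^sub>Y)\<close> with the associativity constraints written out: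
  both sides are arrows \<open>(Z \<star> X) \<star> Y \<rightarrow> X \<star> (Y \<star> Z)\<close>.\<close>

definition centralizer_objects ::
    "('k, 'a, 'f, 'z) mon_cat_scheme \<Rightarrow> ('k, 'a, 'f, 'o, 'm, 'y) bimod_cat_scheme
      \<Rightarrow> ('o \<times> ('a \<Rightarrow> 'm)) set" where
  "centralizer_objects A N = {(Z, \<tau>). Z \<in> Ob N \<and> nat_iso A N (L_fun N Z) (R_fun N Z) \<tau> \<and>
     (\<forall>X \<in> Ob A. \<forall>Y \<in> Ob A.
        LAssoc N X Y Z \<cdot>\<^bsub>N\<^esub> \<tau> (X \<star>\<^bsub>A\<^esub> Y) \<cdot>\<^bsub>N\<^esub> RAssoc N Z X Y
      = (Ident A X \<unrhd>\<^bsub>N\<^esub> \<tau> Y) \<cdot>\<^bsub>N\<^esub> MAssoc N X Z Y \<cdot>\<^bsub>N\<^esub> (\<tau> X \<unlhd>\<^bsub>N\<^esub> Ident A Y))}"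


section \<open>The bounded homotopy category\<close>

record ('o, 'm) cpx =
  Term :: "int \<Rightarrow> 'o"
  Diff :: "int \<Rightarrow> 'm"

definition bounded_complexes :: "('k, 'o, 'm, 'z) lin_cat_scheme \<Rightarrow> ('o, 'm) cpx set" where
  "bounded_complexes C = {X.
     (\<forall>i. Term X i \<in> Ob C) \<and>
     (\<forall>i. Diff X i \<in> arr C (Term X i) (Term X (i + 1))) \<and>
     (\<forall>i. Diff X (i + 1) \<cdot>\<^bsub>C\<^esub> Diff X i = \<zero>\<^bsub>Hom C (Term X i) (Term X (i + 2))\<^esub>) \<and>
     (\<exists>n. \<forall>i. \<bar>i\<bar> > n \<longrightarrow> zero_object C (Term X i))}"

definition chain_maps ::
    "('k, 'o, 'm, 'z) lin_cat_scheme \<Rightarrow> ('o, 'm) cpx \<Rightarrow> ('o, 'm) cpx \<Rightarrow> (int \<Rightarrow> 'm) set" where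
  "chain_maps C X Y = {f. \<forall>i. f i \<in> arr C (Term X i) (Term Y i) \<and>
     f (i + 1) \<cdot>\<^bsub>C\<^esub> Diff X i = Diff Y i \<cdot>\<^bsub>C\<^esub> f i}"

definition homotopic ::
    "('k, 'o, 'm, 'z) lin_cat_scheme \<Rightarrow> ('o, 'm) cpx \<Rightarrow> ('o, 'm) cpx
      \<Rightarrow> (int \<Rightarrow> 'm) \<Rightarrow> (int \<Rightarrow> 'm) \<Rightarrow> bool" where
  "homotopic C X Y f g \<longleftrightarrow> (\<exists>h. \<forall>i. h i \<in> arr C (Term X i) (Term Y (i - 1)) \<and>
     f i = g i \<oplus>\<^bsub>Hom C (Term X i) (Term Y i)\<^esub>
             ((Diff Y (i - 1) \<cdot>\<^bsub>C\<^esub> h i) \<oplus>\<^bsub>Hom C (Term X i) (Term Y i)\<^esub> (h (i + 1) \<cdot>\<^bsub>C\<^esub> Diff X i)))"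

definition homotopy_class ::
    "('k, 'o, 'm, 'z) lin_cat_scheme \<Rightarrow> ('o, 'm) cpx \<Rightarrow> ('o, 'm) cpx \<Rightarrow> (int \<Rightarrow> 'm) \<Rightarrow> (int \<Rightarrow> 'm) set" where
  "homotopy_class C X Y f = {g \<in> chain_maps C X Y. homotopic C X Y f g}"

text \<open>An arrow of the homotopy category is a homotopy class tagged with its source and target.
  Operations on classes are induced from chain maps by taking the union over all representatives
  of the classes of the results; by compatibility with homotopy this union is a single class.\<close>

type_synonym ('o, 'm) hmap = "('o, 'm) cpx \<times> ('o, 'm) cpx \<times> (int \<Rightarrow> 'm) set"

definition hmap :: "('k, 'o, 'm, 'z) lin_cat_scheme \<Rightarrow> ('o, 'm) cpx \<Rightarrow> ('o, 'm) cpx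
      \<Rightarrow> (int \<Rightarrow> 'm) \<Rightarrow> ('o, 'm) hmap" where
  "hmap C X Y f = (X, Y, homotopy_class C X Y f)"

definition hmap_lift :: "('k, 'o, 'm, 'z) lin_cat_scheme \<Rightarrow> ('o, 'm) cpx \<Rightarrow> ('o, 'm) cpx
      \<Rightarrow> ((int \<Rightarrow> 'm) \<Rightarrow> int \<Rightarrow> 'm) \<Rightarrow> ('o, 'm) hmap \<Rightarrow> ('o, 'm) hmap" where
  "hmap_lift C X Y op = (\<lambda>(_, _, F). (X, Y, \<Union>f \<in> F. homotopy_class C X Y (op f)))"

definition hmap_lift2 :: "('k, 'o, 'm, 'z) lin_cat_scheme \<Rightarrow> ('o, 'm) cpx \<Rightarrow> ('o, 'm) cpx
      \<Rightarrow> ((int \<Rightarrow> 'm) \<Rightarrow> (int \<Rightarrow> 'm) \<Rightarrow> int \<Rightarrow> 'm) \<Rightarrow> ('o, 'm) hmap \<Rightarrow> ('o, 'm) hmap \<Rightarrow> ('o, 'm) hmap" where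
  "hmap_lift2 C X Y op = (\<lambda>(_, _, F) (_, _, G).
     (X, Y, \<Union>f \<in> F. \<Union>g \<in> G. homotopy_class C X Y (op f g)))"

definition hmap_module :: "('k, 'o, 'm, 'z) lin_cat_scheme \<Rightarrow> ('o, 'm) cpx \<Rightarrow> ('o, 'm) cpx
      \<Rightarrow> ('k, ('o, 'm) hmap) module" where
  "hmap_module C X Y = \<lparr>
     carrier = hmap C X Y ` chain_maps C X Y,
     mult = undefined,
     one = undefined,
     zero = hmap C X Y (\<lambda>i. \<zero>\<^bsub>Hom C (Term X i) (Term Y i)\<^esub>),
     add = hmap_lift2 C X Y (\<lambda>f g i. f i \<oplus>\<^bsub>Hom C (Term X i) (Term Y i)\<^esub> g i),
     smult = (\<lambda>a. hmap_lift C X Y (\<lambda>f i. a \<odot>\<^bsub>Hom C (Term X i) (Term Y i)\<^esub> f i))\<rparr>"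

definition cpx_lact :: "('k, 'a, 'f, 'z) mon_cat_scheme \<Rightarrow> ('k, 'a, 'f, 'o, 'm, 'y) bimod_cat_scheme
      \<Rightarrow> 'a \<Rightarrow> ('o, 'm) cpx \<Rightarrow> ('o, 'm) cpx" where
  "cpx_lact A M P X = \<lparr>Term = (\<lambda>i. P \<triangleright>\<^bsub>M\<^esub> Term X i), Diff = (\<lambda>i. Ident A P \<unrhd>\<^bsub>M\<^esub> Diff X i)\<rparr>"

definition cpx_ract :: "('k, 'a, 'f, 'z) mon_cat_scheme \<Rightarrow> ('k, 'a, 'f, 'o, 'm, 'y) bimod_cat_scheme
      \<Rightarrow> ('o, 'm) cpx \<Rightarrow> 'a \<Rightarrow> ('o, 'm) cpx" where
  "cpx_ract A M X P = \<lparr>Term = (\<lambda>i. Term X i \<triangleleft>\<^bsub>M\<^esub> P), Diff = (\<lambda>i. Diff X i \<unlhd>\<^bsub>M\<^esub> Ident A P)\<rparr>"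

definition Kb :: "('k, 'a, 'f, 'z) mon_cat_scheme \<Rightarrow> ('k, 'a, 'f, 'o, 'm, 'y) bimod_cat_scheme
      \<Rightarrow> ('k, 'a, 'f, ('o, 'm) cpx, ('o, 'm) hmap) bimod_cat" where
  "Kb A M = (let l = cpx_lact A M; r = cpx_ract A M in \<lparr>
     Ob = bounded_complexes M,
     Dom = (\<lambda>(X, _, _). X),
     Cod = (\<lambda>(_, Y, _). Y),
     Hom = hmap_module M,
     Ident = (\<lambda>X. hmap M X X (\<lambda>i. Ident M (Term X i))),
     Cmp = (\<lambda>(Y', Z, G) (X, Y, F).
       hmap_lift2 M X Z (\<lambda>g f i. g i \<cdot>\<^bsub>M\<^esub> f i) (Y', Z, G) (X, Y, F)),
     LActO = l,
     LActA = (\<lambda>u (X, Y, F).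
       hmap_lift M (l (Dom A u) X) (l (Cod A u) Y) (\<lambda>f i. u \<unrhd>\<^bsub>M\<^esub> f i) (X, Y, F)),
     RActO = r,
     RActA = (\<lambda>(X, Y, F) u.
       hmap_lift M (r X (Dom A u)) (r Y (Cod A u)) (\<lambda>f i. f i \<unlhd>\<^bsub>M\<^esub> u) (X, Y, F)),
     LAssoc = (\<lambda>P Q X. hmap M (l (P \<star>\<^bsub>A\<^esub> Q) X) (l P (l Q X)) (\<lambda>i. LAssoc M P Q (Term X i))),
     RAssoc = (\<lambda>X P Q. hmap M (r (r X P) Q) (r X (P \<star>\<^bsub>A\<^esub> Q)) (\<lambda>i. RAssoc M (Term X i) P Q)),
     MAssoc = (\<lambda>P X Q. hmap M (r (l P X) Q) (l P (r X Q)) (\<lambda>i. MAssoc M P (Term X i) Q)),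
     LActUnit = (\<lambda>X. hmap M (l (Unit A) X) X (\<lambda>i. LActUnit M (Term X i))),
     RActUnit = (\<lambda>X. hmap M (r X (Unit A)) X (\<lambda>i. RActUnit M (Term X i)))\<rparr>)"

end

theory Submission
  imports Defs
begin

text \<open>Since the essential images agree, every \<open>Z \<triangleleft> X\<close> is isomorphic to some \<open>\<Phi> X \<triangleright> Z\<close> by a chosen
  isomorphism \<open>\<tau> X\<close>.  As \<open>R\<^sub>Z\<close> is fully faithful, there is exactly one way to make \<open>\<Phi>\<close> a functor with
  \<open>\<tau>\<close> natural and exactly one \<open>\<Phi> (X \<star> Y) \<rightarrow> \<Phi> X \<star> \<Phi> Y\<close> with \<open>\<tau>\<close> multiplicative; the coherence laws
  hold because they hold after acting on \<open>Z\<close>.  Exchanging the roles of \<open>L\<^sub>Z\<close> and \<open>R\<^sub>Z\<close> gives a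
  quasi-inverse.  This works in any bimodule category, in particular in the bounded homotopy
  category, whose twist by \<open>\<Phi>\<close> is the homotopy category of the twist.\<close>

section \<open>Arrows and isomorphisms\<close>

text \<open>The coherence laws for \<open>\<Phi>\<close> are equations in \<open>A\<close>, whereas
  everything known about \<open>\<tau>\<close> lives in \<open>M\<close>. The difficulty is to
  arrange the equation, once it acts on \<open>Z\<close>, so that each multiplication constraint
  stands next to a component of \<open>\<tau>\<close> and can be traded for components at smaller
  objects. Flanking both sides with invertible arrows achieves this; invertibility then removes the
  flanks, and faithfulness removes the action. Multiplicativity of \<open>\<tau>\<close> does not
  mention the unit constraint, which is instead read off from \<open>\<tau>\<close> at the unit
  object. Its laws rest on compatibilities of the unit actions with tensor products and with the
  other action, which have to be derived from pentagons and triangles. For complexes the coherence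
  axioms hold degreewise on representatives, so no homotopy has to be constructed for them. The
  comparison of the two twists is not stated as an equality of records, since a functor is
  controlled only on objects and arrows of \<open>A\<close>; it is made inside the clauses that
  define the centralizer.\<close>

text \<open>Reading source and target off an arrow, instead of carrying them as arguments of \<open>arr\<close>, lets the
  simplifier decide whether arrows are composable.\<close>

definition arrow :: "('k, 'o, 'm, 'z) lin_cat_scheme \<Rightarrow> 'm \<Rightarrow> bool" where
  "arrow C f \<longleftrightarrow> Dom C f \<in> Ob C \<and> Cod C f \<in> Ob C \<and> f \<in> arr C (Dom C f) (Cod C f)"

definition invertible :: "('k, 'o, 'm, 'z) lin_cat_scheme \<Rightarrow> 'm \<Rightarrow> bool" where
  "invertible C f \<longleftrightarrow> arrow C f \<and> iso_arr C (Dom C f) (Cod C f) f"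

text \<open>Inverses are unique, so nothing depends on the choice. Having a term for the inverse
  lets cancellation run as rewriting instead of through existential statements.\<close>

definition inverse_arrow :: "('k, 'o, 'm, 'z) lin_cat_scheme \<Rightarrow> 'm \<Rightarrow> 'm" where
  "inverse_arrow C f = (SOME g. g \<in> arr C (Cod C f) (Dom C f) \<and>
     g \<cdot>\<^bsub>C\<^esub> f = Ident C (Dom C f) \<and> f \<cdot>\<^bsub>C\<^esub> g = Ident C (Cod C f))"

context linear_category
begin

lemma arrowI:
  assumes "X \<in> Ob C" "Y \<in> Ob C" "f \<in> arr C X Y"
  shows "arrow C f" "Dom C f = X" "Cod C f = Y"
  using assms dom_cod[of X Y f] by (auto simp: arrow_def)

lemma arr_iff: "X \<in> Ob C \<Longrightarrow> Y \<in> Ob C \<Longrightarrow> f \<in> arr C X Y \<longleftrightarrow> arrow C f \<and> Dom C f = X \<and> Cod C f = Y"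
  using arrowI by (auto simp: arrow_def)

lemma arrow_Ob [simp]: "arrow C f \<Longrightarrow> Dom C f \<in> Ob C" "arrow C f \<Longrightarrow> Cod C f \<in> Ob C"
  by (auto simp: arrow_def)

lemma arrow_arr: "arrow C f \<Longrightarrow> f \<in> arr C (Dom C f) (Cod C f)"
  unfolding arrow_def by blast

lemma Ident_simps [simp]:
  assumes "X \<in> Ob C"
  shows "arrow C (Ident C X)" "Dom C (Ident C X) = X" "Cod C (Ident C X) = X"
  using arrowI[OF assms assms ident_arr[OF assms]] by auto

lemma cmp_simps [simp]:
  assumes "arrow C f" "arrow C g" "Cod C f = Dom C g"
  shows "arrow C (g \<cdot>\<^bsub>C\<^esub> f)" "Dom C (g \<cdot>\<^bsub>C\<^esub> f) = Dom C f" "Cod C (g \<cdot>\<^bsub>C\<^esub> f) = Cod C g"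
proof -
  have "g \<cdot>\<^bsub>C\<^esub> f \<in> arr C (Dom C f) (Cod C g)"
    using assms by (intro cmp_arr[of _ "Cod C f"]) (auto simp: arr_iff)
  then show "arrow C (g \<cdot>\<^bsub>C\<^esub> f)" "Dom C (g \<cdot>\<^bsub>C\<^esub> f) = Dom C f" "Cod C (g \<cdot>\<^bsub>C\<^esub> f) = Cod C g"
    using arrowI[of "Dom C f" "Cod C g" "g \<cdot>\<^bsub>C\<^esub> f"] assms by auto
qed

lemma cmp_Ident [simp]:
  "arrow C f \<Longrightarrow> Y = Cod C f \<Longrightarrow> Ident C Y \<cdot>\<^bsub>C\<^esub> f = f"
  "arrow C f \<Longrightarrow> X = Dom C f \<Longrightarrow> f \<cdot>\<^bsub>C\<^esub> Ident C X = f"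
  using ident_left[OF arrow_Ob arrow_arr] ident_right[OF arrow_Ob arrow_arr] by auto

lemma assoc [simp]:
  assumes "arrow C f" "arrow C g" "arrow C h" "Cod C f = Dom C g" "Cod C g = Dom C h"
  shows "(h \<cdot>\<^bsub>C\<^esub> g) \<cdot>\<^bsub>C\<^esub> f = h \<cdot>\<^bsub>C\<^esub> g \<cdot>\<^bsub>C\<^esub> f"
  using assms by (intro cmp_assoc[of "Dom C f" "Cod C f" "Cod C g" "Cod C h"]) (auto simp: arr_iff)

text \<open>Composites are normalized by bracketing to the right, so an equation for
  \<open>a \<cdot> b\<close> no longer matches once something is composed on the right. This is the
  form in which such an equation still applies inside a longer chain; it carries most diagram chases
  below.\<close>

lemma prefix_cong:
  assumes "a \<cdot>\<^bsub>C\<^esub> b = c" "arrow C a" "arrow C b" "arrow C k"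
    "Cod C k = Dom C b" "Cod C b = Dom C a"
  shows "a \<cdot>\<^bsub>C\<^esub> b \<cdot>\<^bsub>C\<^esub> k = c \<cdot>\<^bsub>C\<^esub> k"
  using assms assoc[of k b a] by simp

lemma isoD: "invertible C f \<Longrightarrow> arrow C f"
  by (simp add: invertible_def)

lemma isoI:
  assumes "arrow C f" "arrow C g" "Dom C g = Cod C f" "Cod C g = Dom C f"
    "g \<cdot>\<^bsub>C\<^esub> f = Ident C (Dom C f)" "f \<cdot>\<^bsub>C\<^esub> g = Ident C (Cod C f)"
  shows "invertible C f"
  using assms by (auto simp: invertible_def iso_arr_def arr_iff)

lemma iso_arrD:
  assumes "X \<in> Ob C" "Y \<in> Ob C" "iso_arr C X Y f"
  shows "invertible C f" "arrow C f" "Dom C f = X" "Cod C f = Y"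
  using assms arrowI[of X Y f] by (auto simp: iso_arr_def invertible_def)

lemma iso_arr_iff:
  "X \<in> Ob C \<Longrightarrow> Y \<in> Ob C \<Longrightarrow> iso_arr C X Y f \<longleftrightarrow> invertible C f \<and> Dom C f = X \<and> Cod C f = Y"
  using iso_arrD by (auto simp: invertible_def)

lemma inverse_arrow:
  assumes "invertible C f"
  shows "arrow C (inverse_arrow C f)" "Dom C (inverse_arrow C f) = Cod C f"
    "Cod C (inverse_arrow C f) = Dom C f" "inverse_arrow C f \<cdot>\<^bsub>C\<^esub> f = Ident C (Dom C f)"
    "f \<cdot>\<^bsub>C\<^esub> inverse_arrow C f = Ident C (Cod C f)"
proof -
  have "\<exists>g. g \<in> arr C (Cod C f) (Dom C f) \<and> g \<cdot>\<^bsub>C\<^esub> f = Ident C (Dom C f) \<and> f \<cdot>\<^bsub>C\<^esub> g = Ident C (Cod C f)"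
    using assms by (auto simp: invertible_def iso_arr_def)
  then have *: "inverse_arrow C f \<in> arr C (Cod C f) (Dom C f) \<and>
      inverse_arrow C f \<cdot>\<^bsub>C\<^esub> f = Ident C (Dom C f) \<and> f \<cdot>\<^bsub>C\<^esub> inverse_arrow C f = Ident C (Cod C f)"
    unfolding inverse_arrow_def by (rule someI_ex)
  with isoD[OF assms] arrowI[of "Cod C f" "Dom C f" "inverse_arrow C f"]
  show "arrow C (inverse_arrow C f)" "Dom C (inverse_arrow C f) = Cod C f"
    "Cod C (inverse_arrow C f) = Dom C f" "inverse_arrow C f \<cdot>\<^bsub>C\<^esub> f = Ident C (Dom C f)"
    "f \<cdot>\<^bsub>C\<^esub> inverse_arrow C f = Ident C (Cod C f)"
    by auto
qed

lemmas [simp] = isoD inverse_arrow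

lemma inverse_cancel [simp]:
  assumes "invertible C f" "arrow C k"
  shows "Cod C k = Dom C f \<Longrightarrow> inverse_arrow C f \<cdot>\<^bsub>C\<^esub> f \<cdot>\<^bsub>C\<^esub> k = k"
    "Cod C k = Cod C f \<Longrightarrow> f \<cdot>\<^bsub>C\<^esub> inverse_arrow C f \<cdot>\<^bsub>C\<^esub> k = k"
  using assms by (simp_all add: prefix_cong[OF inverse_arrow(4)] prefix_cong[OF inverse_arrow(5)])

lemma iso_inverse [simp]: "invertible C f \<Longrightarrow> invertible C (inverse_arrow C f)"
  by (rule isoI[of _ f]) auto

lemma iso_Ident [simp]: "X \<in> Ob C \<Longrightarrow> invertible C (Ident C X)"
  by (rule isoI[of _ "Ident C X"]) auto

lemma iso_cmp [simp]:
  assumes "invertible C f" "invertible C g" "Cod C f = Dom C g"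
  shows "invertible C (g \<cdot>\<^bsub>C\<^esub> f)"
  using assms by (intro isoI[of _ "inverse_arrow C f \<cdot>\<^bsub>C\<^esub> inverse_arrow C g"]) auto

lemma iso_left_cancel:
  assumes "s \<cdot>\<^bsub>C\<^esub> f = s \<cdot>\<^bsub>C\<^esub> g" "invertible C s" "arrow C f" "arrow C g"
    "Cod C f = Dom C s" "Cod C g = Dom C s"
  shows "f = g"
  using arg_cong[OF assms(1), of "\<lambda>t. inverse_arrow C s \<cdot>\<^bsub>C\<^esub> t"] assms(2-) by simp

lemma iso_right_cancel:
  assumes "f \<cdot>\<^bsub>C\<^esub> s = g \<cdot>\<^bsub>C\<^esub> s" "invertible C s" "arrow C f" "arrow C g"
    "Dom C f = Cod C s" "Dom C g = Cod C s"
  shows "f = g"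
  using arg_cong[OF assms(1), of "\<lambda>t. t \<cdot>\<^bsub>C\<^esub> inverse_arrow C s"] assms(2-) by simp

end

section \<open>Linear functors\<close>

context linear_functor
begin

lemma FO_Ob [simp]: "X \<in> Ob C \<Longrightarrow> FO F X \<in> Ob D"
  by (rule fun_ob)

lemma FA_simps [simp]:
  assumes "arrow C f"
  shows "arrow D (FA F f)" "Dom D (FA F f) = FO F (Dom C f)" "Cod D (FA F f) = FO F (Cod C f)"
  using D.arrowI[OF _ _ fun_arr[of "Dom C f" "Cod C f" f]] assms by (auto simp: C.arr_iff)

lemma FA_Ident [simp]: "X \<in> Ob C \<Longrightarrow> FA F (Ident C X) = Ident D (FO F X)"
  by (rule fun_ident)

lemma FA_cmp [simp]:
  assumes "arrow C f" "arrow C g" "Cod C f = Dom C g"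
  shows "FA F (g \<cdot>\<^bsub>C\<^esub> f) = FA F g \<cdot>\<^bsub>D\<^esub> FA F f"
  using assms by (intro fun_cmp[of "Dom C f" "Cod C f" "Cod C g"]) (auto simp: C.arr_iff)

lemma FA_iso [simp]: 
  assumes "invertible C f"
  shows "invertible D (FA F f)"
proof (rule D.isoI[of _ "FA F (inverse_arrow C f)"])
  show "FA F (inverse_arrow C f) \<cdot>\<^bsub>D\<^esub> FA F f = Ident D (Dom D (FA F f))"
    using assms FA_cmp[of f "inverse_arrow C f", symmetric] by simp
  show "FA F f \<cdot>\<^bsub>D\<^esub> FA F (inverse_arrow C f) = Ident D (Cod D (FA F f))"
    using assms FA_cmp[of "inverse_arrow C f" f, symmetric] by simp
qed (use assms in auto)

lemma faithful:
  assumes "fully_faithful C D F" "FA F f = FA F g" "arrow C f" "arrow C g"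
    "Dom C f = Dom C g" "Cod C f = Cod C g"
  shows "f = g"
proof -
  have "inj_on (FA F) (arr C (Dom C f) (Cod C f))"
    using assms by (auto simp: fully_faithful_def bij_betw_def)
  then show ?thesis
    using assms by (auto simp: inj_on_def C.arr_iff)
qed

lemma full:
  assumes "fully_faithful C D F" "arrow D h" "X \<in> Ob C" "Y \<in> Ob C"
    "Dom D h = FO F X" "Cod D h = FO F Y"
  obtains f where "arrow C f" "Dom C f = X" "Cod C f = Y" "FA F f = h"
proof -
  have "FA F ` arr C X Y = arr D (FO F X) (FO F Y)"
    using assms by (auto simp: fully_faithful_def bij_betw_def)
  moreover have "h \<in> arr D (FO F X) (FO F Y)"
    using assms by (simp add: D.arr_iff)
  ultimately have "\<exists>f. f \<in> arr C X Y \<and> FA F f = h"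
    by (metis imageE)
  then show thesis
    using assms that by (auto simp: C.arr_iff)
qed

text \<open>Fullness lifts the inverse of \<open>FA F f\<close> to an arrow \<open>g\<close>, and
  faithfulness turns the two composites of \<open>f\<close> and \<open>g\<close> into
  identities.\<close>

lemma reflects_iso:
  assumes ff: "fully_faithful C D F" and f: "arrow C f" "invertible D (FA F f)"
  shows "invertible C f"
proof -
  obtain g where g: "arrow C g" "Dom C g = Cod C f" "Cod C g = Dom C f"
    "FA F g = inverse_arrow D (FA F f)"
    by (rule full[OF ff, of "inverse_arrow D (FA F f)" "Cod C f" "Dom C f"]) (use f in auto)
  have "g \<cdot>\<^bsub>C\<^esub> f = Ident C (Dom C f)" "f \<cdot>\<^bsub>C\<^esub> g = Ident C (Cod C f)"
    using f g by (auto intro!: faithful[OF ff])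
  then show ?thesis
    using f g by (auto intro: C.isoI)
qed

text \<open>The objects are arguments because full faithfulness concerns one hom-set at a time:
  distinct objects may have the same image under \<open>FO F\<close>, so \<open>h\<close> alone does
  not fix source and target of its preimage.\<close>

definition preimage :: "'o \<Rightarrow> 'o \<Rightarrow> 'n \<Rightarrow> 'm" where
  "preimage X Y h = (SOME f. arrow C f \<and> Dom C f = X \<and> Cod C f = Y \<and> FA F f = h)"

lemma preimage:
  assumes "fully_faithful C D F" "arrow D h" "X \<in> Ob C" "Y \<in> Ob C"
    "Dom D h = FO F X" "Cod D h = FO F Y"
  shows "arrow C (preimage X Y h)" "Dom C (preimage X Y h) = X" "Cod C (preimage X Y h) = Y"
    "FA F (preimage X Y h) = h"
proof -
  have "\<exists>f. arrow C f \<and> Dom C f = X \<and> Cod C f = Y \<and> FA F f = h"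
    using full[OF assms] by metis
  then have "arrow C (preimage X Y h) \<and> Dom C (preimage X Y h) = X \<and> Cod C (preimage X Y h) = Y \<and>
      FA F (preimage X Y h) = h"
    unfolding preimage_def by (rule someI_ex)
  then show "arrow C (preimage X Y h)" "Dom C (preimage X Y h) = X" "Cod C (preimage X Y h) = Y"
    "FA F (preimage X Y h) = h" by auto
qed

end

lemma linear_functor_fun_comp:
  assumes "linear_functor K C D F" "linear_functor K D E G"
  shows "linear_functor K C E (fun_comp G F)"
proof -
  interpret F: linear_functor K C D F by fact
  interpret G: linear_functor K D E G by fact
  show ?thesis
    by unfold_locales
      (auto simp: fun_comp_def F.fun_arr G.fun_arr F.fun_cmp
        G.fun_cmp[OF F.fun_ob F.fun_ob F.fun_ob F.fun_arr F.fun_arr]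
        F.fun_add G.fun_add F.fun_smult G.fun_smult)
qed

lemma linear_functor_fun_id:
  assumes "linear_category K C"
  shows "linear_functor K C C fun_id"
proof -
  interpret linear_category K C by fact
  show ?thesis
    by unfold_locales (auto simp: fun_id_def)
qed

section \<open>Natural isomorphisms and lifting along fully faithful functors\<close>

lemma nat_iso_trans:
  assumes "linear_functor K C D F" "linear_functor K C D G" "linear_functor K C D H"
    "nat_iso C D F G s" "nat_iso C D G H t"
  shows "nat_iso C D F H (\<lambda>X. t X \<cdot>\<^bsub>D\<^esub> s X)"
proof -
  interpret F: linear_functor K C D F by fact
  interpret G: linear_functor K C D G by fact
  interpret H: linear_functor K C D H by fact
  have s: "invertible D (s X)" "Dom D (s X) = FO F X" "Cod D (s X) = FO G X" if "X \<in> Ob C" for X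
    using assms(4) that by (auto simp: nat_iso_def F.D.iso_arr_iff)
  have t: "invertible D (t X)" "Dom D (t X) = FO G X" "Cod D (t X) = FO H X" if "X \<in> Ob C" for X
    using assms(5) that by (auto simp: nat_iso_def F.D.iso_arr_iff)
  have sn: "s Y \<cdot>\<^bsub>D\<^esub> FA F f = FA G f \<cdot>\<^bsub>D\<^esub> s X"
    and tn: "t Y \<cdot>\<^bsub>D\<^esub> FA G f = FA H f \<cdot>\<^bsub>D\<^esub> t X" if "X \<in> Ob C" "Y \<in> Ob C" "f \<in> arr C X Y" for f X Y
    using assms(4,5) that by (auto simp: nat_iso_def)
  have "(t Y \<cdot>\<^bsub>D\<^esub> s Y) \<cdot>\<^bsub>D\<^esub> FA F f = FA H f \<cdot>\<^bsub>D\<^esub> t X \<cdot>\<^bsub>D\<^esub> s X"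
    if "X \<in> Ob C" "Y \<in> Ob C" "f \<in> arr C X Y" for f X Y
  proof -
    have "arrow C f" "Dom C f = X" "Cod C f = Y"
      using that F.C.arrowI by auto
    then show ?thesis
      using that s t by (simp add: sn[OF that] F.D.prefix_cong[OF tn[OF that]])
  qed
  then show ?thesis
    using s t by (auto simp: nat_iso_def F.D.iso_arr_iff)
qed

text \<open>Naturality of the inverses becomes naturality of \<open>s\<close> after composing with
  the invertible components \<open>s Y\<close> on the left and \<open>s X\<close> on the
  right.\<close>

lemma nat_iso_sym:
  assumes "linear_functor K C D F" "linear_functor K C D G" "nat_iso C D F G s"
  shows "nat_iso C D G F (\<lambda>X. inverse_arrow D (s X))"
proof -
  interpret F: linear_functor K C D F by fact
  interpret G: linear_functor K C D G by fact
  have s: "invertible D (s X)" "Dom D (s X) = FO F X" "Cod D (s X) = FO G X" if "X \<in> Ob C" for X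
    using assms(3) that by (auto simp: nat_iso_def F.D.iso_arr_iff)
  have "inverse_arrow D (s Y) \<cdot>\<^bsub>D\<^esub> FA G f = FA F f \<cdot>\<^bsub>D\<^esub> inverse_arrow D (s X)"
    if "X \<in> Ob C" "Y \<in> Ob C" "f \<in> arr C X Y" for f X Y
  proof -
    have f: "arrow C f" "Dom C f = X" "Cod C f = Y"
      using that F.C.arrowI by auto
    have sn: "s Y \<cdot>\<^bsub>D\<^esub> FA F f = FA G f \<cdot>\<^bsub>D\<^esub> s X"
      using assms(3) that by (auto simp: nat_iso_def)
    show ?thesis
      by (rule F.D.iso_left_cancel[of "s Y"], rule F.D.iso_right_cancel[of _ "s X"])
        (use f that s sn in \<open>auto simp: F.D.prefix_cong[OF sn]\<close>)
  qed
  then show ?thesis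
    using s by (auto simp: nat_iso_def F.D.iso_arr_iff)
qed

lemma nat_iso_precomp:
  assumes "linear_functor K B C H" "nat_iso C D F G s"
  shows "nat_iso B D (fun_comp F H) (fun_comp G H) (\<lambda>X. s (FO H X))"
  using assms linear_functor.fun_ob[OF assms(1)] linear_functor.fun_arr[OF assms(1)]
  by (auto simp: nat_iso_def fun_comp_def)

text \<open>The components are the preimages of those of \<open>t\<close>. They are invertible since
  \<open>G\<close> reflects isomorphisms, and natural since \<open>G\<close> is faithful. This is
  what removes \<open>F\<close> or \<open>G\<close> from in front of a composite when a
  quasi-inverse is verified.\<close>

lemma nat_iso_reflect:
  assumes "linear_functor K B C H" "linear_functor K B C H'" "linear_functor K C D G"
    "fully_faithful C D G" "nat_iso B D (fun_comp G H) (fun_comp G H') t"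
  shows "\<exists>s. nat_iso B C H H' s"
proof -
  interpret H: linear_functor K B C H by fact
  interpret H': linear_functor K B C H' by fact
  interpret G: linear_functor K C D G by fact
  have t: "invertible D (t X)" "Dom D (t X) = FO G (FO H X)" "Cod D (t X) = FO G (FO H' X)" if "X \<in> Ob B" for X
    using assms(5) that by (auto simp: nat_iso_def G.D.iso_arr_iff fun_comp_def)
  define s where "s X = G.preimage (FO H X) (FO H' X) (t X)" for X
  have s: "arrow C (s X)" "Dom C (s X) = FO H X" "Cod C (s X) = FO H' X" "FA G (s X) = t X"
    if "X \<in> Ob B" for X
    using G.preimage[OF assms(4), of "t X" "FO H X" "FO H' X"] t that by (auto simp: s_def)
  have "invertible C (s X)" if "X \<in> Ob B" for X
    using that t s by (auto intro: G.reflects_iso[OF assms(4)])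
  moreover have "s Y \<cdot>\<^bsub>C\<^esub> FA H f = FA H' f \<cdot>\<^bsub>C\<^esub> s X" if f: "X \<in> Ob B" "Y \<in> Ob B" "f \<in> arr B X Y" for f X Y
  proof -
    have "arrow B f" "Dom B f = X" "Cod B f = Y"
      using f H.C.arrowI by auto
    moreover have "t Y \<cdot>\<^bsub>D\<^esub> FA G (FA H f) = FA G (FA H' f) \<cdot>\<^bsub>D\<^esub> t X"
      using assms(5) f by (auto simp: nat_iso_def fun_comp_def)
    ultimately show ?thesis
      using f s by (intro G.faithful[OF assms(4)]) auto
  qed
  ultimately have "nat_iso B C H H' s"
    using s by (auto simp: nat_iso_def H.D.iso_arr_iff)
  then show ?thesis
    by blast
qed

text \<open>Conjugating \<open>FA F f\<close> by the chosen isomorphisms gives an arrow between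
  images of \<open>G\<close>, hence a preimage; all functor and linearity laws are then checked
  after applying \<open>G\<close>. Sources and targets of \<open>F\<close> and \<open>G\<close> are
  kept general and only one inclusion of images is assumed, so that the same statement produces both
  the functor and its quasi-inverse.\<close>

lemma lift_along_fully_faithful:
  assumes "linear_functor K C E F" "linear_functor K D E G"
    and ff: "fully_faithful D E G"
    and sub: "\<And>X. X \<in> Ob C \<Longrightarrow> FO F X \<in> ess_image D E G"
  obtains H :: "('o, 'm, 'p, 'n) fctr" and t where
    "linear_functor K C D H" "nat_iso C E F (fun_comp G H) t"
proof -
  interpret F: linear_functor K C E F by fact
  interpret G: linear_functor K D E G by fact
  have "\<exists>Y s. Y \<in> Ob D \<and> invertible E s \<and> Dom E s = FO F X \<and> Cod E s = FO G Y" if X: "X \<in> Ob C" for X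
  proof -
    obtain Y f where "Y \<in> Ob D" "iso_arr E (FO G Y) (FO F X) f"
      using sub[OF X] by (auto simp: ess_image_def)
    \<comment> \<open>\<open>ess_image\<close> supplies an isomorphism out of \<open>FO G Y\<close>,
      while \<open>t\<close> has to start at \<open>FO F X\<close>; hence the inverse.\<close>
    then show ?thesis
      using X by (intro exI[of _ Y] exI[of _ "inverse_arrow E f"]) (auto simp: F.D.iso_arr_iff)
  qed
  then obtain h t where ht: "\<And>X. X \<in> Ob C \<Longrightarrow> h X \<in> Ob D \<and> invertible E (t X) \<and> Dom E (t X) = FO F X
      \<and> Cod E (t X) = FO G (h X)"
    by metis
  define H :: "('o, 'm, 'p, 'n) fctr" where "H = \<lparr>FO = h, FA = \<lambda>f. G.preimage (h (Dom C f)) (h (Cod C f))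
      (t (Cod C f) \<cdot>\<^bsub>E\<^esub> FA F f \<cdot>\<^bsub>E\<^esub> inverse_arrow E (t (Dom C f)))\<rparr>"
  have t [simp]: "h X \<in> Ob D" "invertible E (t X)" "Dom E (t X) = FO F X" "Cod E (t X) = FO G (h X)"
    if "X \<in> Ob C" for X
    using ht that by auto
  have H [simp]: "FO H X = h X" for X
    by (simp add: H_def)
  have HA: "arrow D (FA H f)" "Dom D (FA H f) = h X" "Cod D (FA H f) = h Y"
    "FA G (FA H f) = t Y \<cdot>\<^bsub>E\<^esub> FA F f \<cdot>\<^bsub>E\<^esub> inverse_arrow E (t X)"
    if "X \<in> Ob C" "Y \<in> Ob C" "f \<in> arr C X Y" for X Y f
  proof -
    have f: "arrow C f" "Dom C f = X" "Cod C f = Y"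
      using that F.C.arrowI by auto
    show "arrow D (FA H f)" "Dom D (FA H f) = h X" "Cod D (FA H f) = h Y"
      "FA G (FA H f) = t Y \<cdot>\<^bsub>E\<^esub> FA F f \<cdot>\<^bsub>E\<^esub> inverse_arrow E (t X)"
      using G.preimage[OF ff, of "t Y \<cdot>\<^bsub>E\<^esub> FA F f \<cdot>\<^bsub>E\<^esub> inverse_arrow E (t X)" "h X" "h Y"] f that
      by (auto simp: H_def)
  qed
  have eqI: "u = v" if "FA G u = FA G v" "u \<in> arr D X Y" "v \<in> arr D X Y" "X \<in> Ob D" "Y \<in> Ob D" for u v X Y
    using that by (intro G.faithful[OF ff]) (auto simp: G.C.arr_iff)
  have Harr: "FA H f \<in> arr D (h X) (h Y)" if "X \<in> Ob C" "Y \<in> Ob C" "f \<in> arr C X Y" for X Y f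
    using HA[OF that] that by (simp add: G.C.arr_iff)
  interpret H: linear_functor K C D H
  proof
    fix X Y Z f g f' a
    assume X: "X \<in> Ob C"
    then have "Ident C X \<in> arr C X X"
      by (simp add: F.C.arr_iff)
    note I = HA[OF X X this]
    show "FO H X \<in> Ob D"
      using X by simp
    show "FA H (Ident C X) = Ident D (FO H X)"
      using I X by (intro G.faithful[OF ff]) auto
    assume Y: "Y \<in> Ob C" and f: "f \<in> arr C X Y"
    have f' [simp]: "arrow C f" "Dom C f = X" "Cod C f = Y"
      using F.C.arrowI[OF X Y f] by auto
    note Hf = HA[OF X Y f]
    show "FA H f \<in> arr D (FO H X) (FO H Y)"
      using Hf X Y by (simp add: G.C.arr_iff)
    { assume Z: "Z \<in> Ob C" and g: "g \<in> arr C Y Z"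
      have [simp]: "arrow C g" "Dom C g = Y" "Cod C g = Z"
        using F.C.arrowI[OF Y Z g] by auto
      note Hg = HA[OF Y Z g] and Hgf = HA[OF X Z F.C.cmp_arr[OF X Y Z f g]]
      show "FA H (g \<cdot>\<^bsub>C\<^esub> f) = FA H g \<cdot>\<^bsub>D\<^esub> FA H f"
        using X Y Z Hf Hg Hgf by (intro G.faithful[OF ff]) auto
    }
    { assume f': "f' \<in> arr C X Y"
      have [simp]: "arrow C f'" "Dom C f' = X" "Cod C f' = Y"
        using F.C.arrowI[OF X Y f'] by auto
      have s: "f \<oplus>\<^bsub>Hom C X Y\<^esub> f' \<in> arr C X Y"
        using F.C.hom_module[OF X Y] f f' by (simp add: module_def abelian_group_def abelian_monoid.a_closed)
      have s': "FA H f \<oplus>\<^bsub>Hom D (h X) (h Y)\<^esub> FA H f' \<in> arr D (h X) (h Y)"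
        using G.C.hom_module[of "h X" "h Y"] Harr[OF X Y f] Harr[OF X Y f'] X Y
        by (simp add: module_def abelian_group_def abelian_monoid.a_closed)
      \<comment> \<open>Under \<open>G\<close> the claim says that conjugation by \<open>t\<close>
        is additive, which follows from bilinearity of composition. The middle objects are given
        explicitly because the rules for sums name the hom-module in which the sum is taken.\<close>
      have "FA G (FA H (f \<oplus>\<^bsub>Hom C X Y\<^esub> f')) = FA G (FA H f \<oplus>\<^bsub>Hom D (h X) (h Y)\<^esub> FA H f')"
        using X Y f f' HA[OF X Y s] HA[OF X Y f] HA[OF X Y f'] Harr[OF X Y f] Harr[OF X Y f']
        by (simp add: G.fun_add F.fun_add F.fun_arr F.D.arr_iff
          F.D.cmp_add_left[of "FO G (h X)" "FO F X" "FO F Y"]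
          F.D.cmp_add_right[of "FO G (h X)" "FO F Y" "FO G (h Y)"])
      then show "FA H (f \<oplus>\<^bsub>Hom C X Y\<^esub> f') = FA H f \<oplus>\<^bsub>Hom D (FO H X) (FO H Y)\<^esub> FA H f'"
        using eqI[OF _ Harr[OF X Y s] s'] X Y by simp
    }
    { assume a: "a \<in> carrier K"
      have s: "a \<odot>\<^bsub>Hom C X Y\<^esub> f \<in> arr C X Y"
        using F.C.hom_module[OF X Y] f a by (simp add: module.smult_closed)
      have s': "a \<odot>\<^bsub>Hom D (h X) (h Y)\<^esub> FA H f \<in> arr D (h X) (h Y)"
        using G.C.hom_module[of "h X" "h Y"] Harr[OF X Y f] X Y a
        by (simp add: module.smult_closed)
      have "FA G (FA H (a \<odot>\<^bsub>Hom C X Y\<^esub> f)) = FA G (a \<odot>\<^bsub>Hom D (h X) (h Y)\<^esub> FA H f)"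
        using X Y f a HA[OF X Y s] HA[OF X Y f] Harr[OF X Y f]
        by (simp add: G.fun_smult F.fun_smult F.fun_arr F.D.arr_iff
          F.D.cmp_smult_left[of "FO G (h X)" "FO F X" "FO F Y"]
          F.D.cmp_smult_right[of "FO G (h X)" "FO F Y" "FO G (h Y)"])
      then show "FA H (a \<odot>\<^bsub>Hom C X Y\<^esub> f) = a \<odot>\<^bsub>Hom D (FO H X) (FO H Y)\<^esub> FA H f"
        using eqI[OF _ Harr[OF X Y s] s'] X Y by simp
    }
  qed
  have "nat_iso C E F (fun_comp G H) t"
    using HA by (auto simp: nat_iso_def fun_comp_def F.D.iso_arr_iff F.C.arr_iff)
  with H.linear_functor_axioms show thesis
    by (rule that)
qed

text \<open>The given isomorphisms compose to
  \<open>F \<cong> G \<Phi> \<cong> F \<Psi> \<Phi>\<close>, and \<open>F\<close>, being fully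
  faithful, reflects this to \<open>id \<cong> \<Psi> \<Phi>\<close>. Exchanging \<open>F\<close>
  with \<open>G\<close> and \<open>\<Phi>\<close> with \<open>\<Psi>\<close> gives the other
  isomorphism.\<close>

lemma equivalence_of_lifts:
  fixes \<Phi> :: "('o, 'm, 'p, 'n, 'x) fctr_scheme" and \<Psi> :: "('p, 'n, 'o, 'm) fctr"
  assumes F: "linear_functor K C E F" "fully_faithful C E F"
    and G: "linear_functor K D E G" "fully_faithful D E G"
    and Phi: "linear_functor K C D \<Phi>" "nat_iso C E F (fun_comp G \<Phi>) s"
    and Psi: "linear_functor K D C \<Psi>" "nat_iso D E G (fun_comp F \<Psi>) t"
  shows "equivalence K C D \<Phi>"
proof -
  interpret F: linear_functor K C E F by fact
  interpret G: linear_functor K D E G by fact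
  note C = linear_functor_fun_id[OF F.C.linear_category_axioms]
    and D = linear_functor_fun_id[OF G.C.linear_category_axioms]
  have "\<exists>u. nat_iso C E F (fun_comp (fun_comp F \<Psi>) \<Phi>) u"
    using nat_iso_trans[OF F(1) linear_functor_fun_comp[OF Phi(1) G(1)]
        linear_functor_fun_comp[OF Phi(1) linear_functor_fun_comp[OF Psi(1) F(1)]]
        Phi(2) nat_iso_precomp[OF Phi(1) Psi(2)]] by blast
  then obtain u where u: "nat_iso C E F (fun_comp (fun_comp F \<Psi>) \<Phi>) u" ..
  \<comment> \<open>Rebracketing the composite and inserting \<open>fun_id\<close> bring
    \<open>u\<close> into the shape in which \<open>F\<close> can be stripped from both
    functors.\<close>
  have "nat_iso C E (fun_comp F fun_id) (fun_comp F (fun_comp \<Psi> \<Phi>)) u"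
    using u by (simp add: nat_iso_def fun_comp_def fun_id_def)
  from nat_iso_reflect[OF C linear_functor_fun_comp[OF Phi(1) Psi(1)] F this]
  obtain u' where u': "nat_iso C C fun_id (fun_comp \<Psi> \<Phi>) u'" ..
  have "\<exists>v. nat_iso D E G (fun_comp (fun_comp G \<Phi>) \<Psi>) v"
    using nat_iso_trans[OF G(1) linear_functor_fun_comp[OF Psi(1) F(1)]
        linear_functor_fun_comp[OF Psi(1) linear_functor_fun_comp[OF Phi(1) G(1)]]
        Psi(2) nat_iso_precomp[OF Psi(1) Phi(2)]] by blast
  then obtain v where v: "nat_iso D E G (fun_comp (fun_comp G \<Phi>) \<Psi>) v" ..
  have "nat_iso D E (fun_comp G fun_id) (fun_comp G (fun_comp \<Phi> \<Psi>)) v"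
    using v by (simp add: nat_iso_def fun_comp_def fun_id_def)
  from nat_iso_reflect[OF D linear_functor_fun_comp[OF Psi(1) Phi(1)] G this]
  obtain v' where v': "nat_iso D D fun_id (fun_comp \<Phi> \<Psi>) v'" ..
  show ?thesis
    unfolding equivalence_def
    using Phi(1) Psi(1) nat_iso_sym[OF C linear_functor_fun_comp[OF Phi(1) Psi(1)] u']
      nat_iso_sym[OF D linear_functor_fun_comp[OF Psi(1) Phi(1)] v']
    by blast
qed

section \<open>Bifunctors and bimodule categories\<close>

context bilinear_bifunctor
begin

lemma TO_Ob [simp]: "X \<in> Ob C \<Longrightarrow> Y \<in> Ob D \<Longrightarrow> TO X Y \<in> Ob E"
  by (rule bi_ob)

lemma TA_simps [simp]:
  assumes "arrow C f" "arrow D g"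
  shows "arrow E (TA f g)" "Dom E (TA f g) = TO (Dom C f) (Dom D g)"
    "Cod E (TA f g) = TO (Cod C f) (Cod D g)"
  using E.arrowI[OF _ _ bi_arr[OF _ _ _ _ C.arrow_arr D.arrow_arr, of f g]] assms by auto

lemma TA_Ident [simp]: "X \<in> Ob C \<Longrightarrow> Y \<in> Ob D \<Longrightarrow> TA (Ident C X) (Ident D Y) = Ident E (TO X Y)"
  by (rule bi_ident)

lemma TA_cmp:
  assumes "arrow C f" "arrow C f'" "arrow D g" "arrow D g'" "Cod C f = Dom C f'" "Cod D g = Dom D g'"
  shows "TA (f' \<cdot>\<^bsub>C\<^esub> f) (g' \<cdot>\<^bsub>D\<^esub> g) = TA f' g' \<cdot>\<^bsub>E\<^esub> TA f g"
  using assms by (intro bi_cmp[of "Dom C f" "Cod C f" "Cod C f'" "Dom D g" "Cod D g" "Cod D g'"])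
    (auto simp: C.arr_iff D.arr_iff)

lemma whisker_left:
  assumes "X \<in> Ob C" "arrow D g" "arrow D g'" "Cod D g = Dom D g'"
  shows "TA (Ident C X) (g' \<cdot>\<^bsub>D\<^esub> g) = TA (Ident C X) g' \<cdot>\<^bsub>E\<^esub> TA (Ident C X) g"
  using TA_cmp[of "Ident C X" "Ident C X" g g'] assms by simp

lemma whisker_right:
  assumes "Y \<in> Ob D" "arrow C f" "arrow C f'" "Cod C f = Dom C f'"
  shows "TA (f' \<cdot>\<^bsub>C\<^esub> f) (Ident D Y) = TA f' (Ident D Y) \<cdot>\<^bsub>E\<^esub> TA f (Ident D Y)"
  using TA_cmp[of f f' "Ident D Y" "Ident D Y"] assms by simp

text \<open>Both sides equal \<open>TA f g\<close>. This is what slides a structure arrow acting on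
  the left past a component of \<open>\<tau>\<close> acting in the other slot.\<close>

lemma interchange:
  assumes "arrow C f" "arrow D g" "X = Dom C f" "X' = Cod C f" "Y = Dom D g" "Y' = Cod D g"
  shows "TA f (Ident D Y') \<cdot>\<^bsub>E\<^esub> TA (Ident C X) g = TA (Ident C X') g \<cdot>\<^bsub>E\<^esub> TA f (Ident D Y)"
proof -
  have "TA f g = TA f (Ident D Y') \<cdot>\<^bsub>E\<^esub> TA (Ident C X) g"
    using assms by (simp flip: TA_cmp)
  moreover have "TA f g = TA (Ident C X') g \<cdot>\<^bsub>E\<^esub> TA f (Ident D Y)"
    using assms by (simp flip: TA_cmp)
  ultimately show ?thesis
    by simp
qed

lemma TA_iso [simp]:
  assumes "invertible C f" "invertible D g"
  shows "invertible E (TA f g)"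
proof (rule E.isoI[of _ "TA (inverse_arrow C f) (inverse_arrow D g)"])
  show "TA (inverse_arrow C f) (inverse_arrow D g) \<cdot>\<^bsub>E\<^esub> TA f g = Ident E (Dom E (TA f g))"
    using assms TA_cmp[of f "inverse_arrow C f" g "inverse_arrow D g", symmetric] by simp
  show "TA f g \<cdot>\<^bsub>E\<^esub> TA (inverse_arrow C f) (inverse_arrow D g) = Ident E (Cod E (TA f g))"
    using assms TA_cmp[of "inverse_arrow C f" f "inverse_arrow D g" g, symmetric] by simp
qed (use assms in auto)

text \<open>With one argument fixed, a bilinear bifunctor is linear in the other. Applied to the
  right action this makes \<open>L_fun\<close> a linear functor; applied to an action on complexes
  it shows that zero objects and zero composites are preserved.\<close>

lemma linear_functor_left:
  assumes "X \<in> Ob C"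
  shows "linear_functor K D E \<lparr>FO = TO X, FA = TA (Ident C X)\<rparr>"
  using assms C.ident_arr[OF assms]
  by unfold_locales (auto simp: bi_arr D.arr_iff whisker_left bi_add_right bi_smult_right)

lemma linear_functor_right:
  assumes "Y \<in> Ob D"
  shows "linear_functor K C E \<lparr>FO = (\<lambda>X. TO X Y), FA = (\<lambda>f. TA f (Ident D Y))\<rparr>"
  using assms D.ident_arr[OF assms]
  by unfold_locales (auto simp: bi_arr C.arr_iff whisker_right bi_add_left bi_smult_left)

end

context monoidal_category
begin

lemma unit_Ob [simp]: "Unit A \<in> Ob A"
  by (rule unit_ob)

lemma assoc_simps [simp]:
  assumes "X \<in> Ob A" "Y \<in> Ob A" "Z \<in> Ob A"
  shows "invertible A (Assoc A X Y Z)" "Dom A (Assoc A X Y Z) = (X \<star>\<^bsub>A\<^esub> Y) \<star>\<^bsub>A\<^esub> Z"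
    "Cod A (Assoc A X Y Z) = X \<star>\<^bsub>A\<^esub> Y \<star>\<^bsub>A\<^esub> Z"
  using C.iso_arrD[OF _ _ assoc_iso[OF assms]] assms by auto

lemma unit_simps [simp]:
  assumes "X \<in> Ob A"
  shows "invertible A (LUnit A X)" "Dom A (LUnit A X) = Unit A \<star>\<^bsub>A\<^esub> X" "Cod A (LUnit A X) = X"
    "invertible A (RUnit A X)" "Dom A (RUnit A X) = X \<star>\<^bsub>A\<^esub> Unit A" "Cod A (RUnit A X) = X"
  using C.iso_arrD[OF _ _ lunit_iso[OF assms]] C.iso_arrD[OF _ _ runit_iso[OF assms]] assms by auto

end

context bimodule_category
begin

lemma action_assoc_simps [simp]:
  assumes "X \<in> Ob A" "Y \<in> Ob A" "N \<in> Ob M"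
  shows "invertible M (LAssoc M X Y N)" "Dom M (LAssoc M X Y N) = (X \<star>\<^bsub>A\<^esub> Y) \<triangleright>\<^bsub>M\<^esub> N"
    "Cod M (LAssoc M X Y N) = X \<triangleright>\<^bsub>M\<^esub> Y \<triangleright>\<^bsub>M\<^esub> N"
    "invertible M (RAssoc M N X Y)" "Dom M (RAssoc M N X Y) = N \<triangleleft>\<^bsub>M\<^esub> X \<triangleleft>\<^bsub>M\<^esub> Y"
    "Cod M (RAssoc M N X Y) = N \<triangleleft>\<^bsub>M\<^esub> (X \<star>\<^bsub>A\<^esub> Y)"
    "invertible M (MAssoc M X N Y)" "Dom M (MAssoc M X N Y) = (X \<triangleright>\<^bsub>M\<^esub> N) \<triangleleft>\<^bsub>M\<^esub> Y"
    "Cod M (MAssoc M X N Y) = X \<triangleright>\<^bsub>M\<^esub> (N \<triangleleft>\<^bsub>M\<^esub> Y)"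
  using M.iso_arrD[OF _ _ lassoc_iso[OF assms]] M.iso_arrD[OF _ _ rassoc_iso[OF assms(3,1,2)]]
    M.iso_arrD[OF _ _ massoc_iso[OF assms(1,3,2)]] assms by auto

lemma action_unit_simps [simp]:
  assumes "N \<in> Ob M"
  shows "invertible M (LActUnit M N)" "Dom M (LActUnit M N) = Unit A \<triangleright>\<^bsub>M\<^esub> N" "Cod M (LActUnit M N) = N"
    "invertible M (RActUnit M N)" "Dom M (RActUnit M N) = N \<triangleleft>\<^bsub>M\<^esub> Unit A" "Cod M (RActUnit M N) = N"
  using M.iso_arrD[OF _ _ lactunit_iso[OF assms]] M.iso_arrD[OF _ _ ractunit_iso[OF assms]] assms by auto

text \<open>Sources and targets enter as equations in the premises, so the rule applies to terms
  whose objects are already simplified and do not literally read \<open>Dom\<close> or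
  \<open>Cod\<close>.\<close>

lemma lassoc_natural:
  assumes "arrow A f" "arrow A g" "arrow M h"
    "Cod A f = X'" "Cod A g = Y'" "Cod M h = N'" "Dom A f = X" "Dom A g = Y" "Dom M h = N"
  shows "LAssoc M X' Y' N' \<cdot>\<^bsub>M\<^esub> ((f \<ast>\<^bsub>A\<^esub> g) \<unrhd>\<^bsub>M\<^esub> h) = (f \<unrhd>\<^bsub>M\<^esub> g \<unrhd>\<^bsub>M\<^esub> h) \<cdot>\<^bsub>M\<^esub> LAssoc M X Y N"
  using assms lassoc_nat[of X X' Y Y' N N' f g h] by (auto simp: A.C.arr_iff M.arr_iff)

lemma rassoc_natural:
  assumes "arrow M h" "arrow A f" "arrow A g"
    "Cod A f = X'" "Cod A g = Y'" "Cod M h = N'" "Dom A f = X" "Dom A g = Y" "Dom M h = N"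
  shows "RAssoc M N' X' Y' \<cdot>\<^bsub>M\<^esub> (h \<unlhd>\<^bsub>M\<^esub> f \<unlhd>\<^bsub>M\<^esub> g) = (h \<unlhd>\<^bsub>M\<^esub> (f \<ast>\<^bsub>A\<^esub> g)) \<cdot>\<^bsub>M\<^esub> RAssoc M N X Y"
  using assms rassoc_nat[of N N' X X' Y Y' h f g] by (auto simp: A.C.arr_iff M.arr_iff)

lemma massoc_natural:
  assumes "arrow A f" "arrow M h" "arrow A g"
    "Cod A f = X'" "Cod A g = Y'" "Cod M h = N'" "Dom A f = X" "Dom A g = Y" "Dom M h = N"
  shows "MAssoc M X' N' Y' \<cdot>\<^bsub>M\<^esub> ((f \<unrhd>\<^bsub>M\<^esub> h) \<unlhd>\<^bsub>M\<^esub> g) = (f \<unrhd>\<^bsub>M\<^esub> (h \<unlhd>\<^bsub>M\<^esub> g)) \<cdot>\<^bsub>M\<^esub> MAssoc M X N Y"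
  using assms massoc_nat[of X X' N N' Y Y' f h g] by (auto simp: A.C.arr_iff M.arr_iff)

lemma lactunit_natural:
  "arrow M h \<Longrightarrow> Cod M h = N' \<Longrightarrow> Dom M h = N \<Longrightarrow>
    LActUnit M N' \<cdot>\<^bsub>M\<^esub> (Ident A (Unit A) \<unrhd>\<^bsub>M\<^esub> h) = h \<cdot>\<^bsub>M\<^esub> LActUnit M N"
  using lactunit_nat[of N N' h] by (auto simp: M.arr_iff)

lemma ractunit_natural:
  "arrow M h \<Longrightarrow> Cod M h = N' \<Longrightarrow> Dom M h = N \<Longrightarrow>
    RActUnit M N' \<cdot>\<^bsub>M\<^esub> (h \<unlhd>\<^bsub>M\<^esub> Ident A (Unit A)) = h \<cdot>\<^bsub>M\<^esub> RActUnit M N"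
  using ractunit_nat[of N N' h] by (auto simp: M.arr_iff)

text \<open>\<open>LActUnit\<close> is a natural isomorphism from the action of the unit to the
  identity, so \<open>f\<close> can be recovered from \<open>Ident A (Unit A) \<unrhd> f\<close> by
  conjugation.\<close>

lemma unit_lact_faithful:
  assumes "Ident A (Unit A) \<unrhd>\<^bsub>M\<^esub> f = Ident A (Unit A) \<unrhd>\<^bsub>M\<^esub> g"
    "arrow M f" "arrow M g" "Dom M f = Dom M g" "Cod M f = Cod M g"
  shows "f = g"
proof (rule M.iso_right_cancel[of _ "LActUnit M (Dom M f)"])
  show "f \<cdot>\<^bsub>M\<^esub> LActUnit M (Dom M f) = g \<cdot>\<^bsub>M\<^esub> LActUnit M (Dom M f)"
    using assms by (simp flip: lactunit_natural[of f "Cod M g" "Dom M g"]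
      lactunit_natural[of g "Cod M g" "Dom M g"])
qed (use assms in auto)

lemma unit_ract_faithful:
  assumes "f \<unlhd>\<^bsub>M\<^esub> Ident A (Unit A) = g \<unlhd>\<^bsub>M\<^esub> Ident A (Unit A)"
    "arrow M f" "arrow M g" "Dom M f = Dom M g" "Cod M f = Cod M g"
  shows "f = g"
proof (rule M.iso_right_cancel[of _ "RActUnit M (Dom M f)"])
  show "f \<cdot>\<^bsub>M\<^esub> RActUnit M (Dom M f) = g \<cdot>\<^bsub>M\<^esub> RActUnit M (Dom M f)"
    using assms by (simp flip: ractunit_natural[of f "Cod M g" "Dom M g"]
      ractunit_natural[of g "Cod M g" "Dom M g"])
qed (use assms in auto)

text \<open>The four unit coherences below do not occur among the axioms; as in Kelly's argument for
  monoidal categories, each follows from a pentagon with two unit entries, because acting by the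
  unit object is faithful.\<close>

lemma lactunit_lact:
  assumes X: "X \<in> Ob A" and N: "N \<in> Ob M"
  shows "LActUnit M (X \<triangleright>\<^bsub>M\<^esub> N) \<cdot>\<^bsub>M\<^esub> LAssoc M (Unit A) X N = LUnit A X \<unrhd>\<^bsub>M\<^esub> Ident M N"
proof (rule unit_lact_faithful)
  let ?I = "Ident A (Unit A)"
  let ?a = "Assoc A (Unit A) (Unit A) X \<unrhd>\<^bsub>M\<^esub> Ident M N"
  \<comment> \<open>Precomposing the acted-on left side with the invertible \<open>?s\<close>
    completes it to the long side of the pentagon; the short side then meets the left
    triangle.\<close>
  let ?s = "LAssoc M (Unit A) (Unit A \<star>\<^bsub>A\<^esub> X) N \<cdot>\<^bsub>M\<^esub> ?a"
  note [simp] = X N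
  note pent = left_pentagon[OF A.unit_Ob A.unit_Ob X N]
  note tri = left_triangle[OF A.unit_Ob left.TO_Ob[OF X N]]
  have n1: "LAssoc M (Unit A) X N \<cdot>\<^bsub>M\<^esub> ((RUnit A (Unit A) \<ast>\<^bsub>A\<^esub> Ident A X) \<unrhd>\<^bsub>M\<^esub> Ident M N)
      = (RUnit A (Unit A) \<unrhd>\<^bsub>M\<^esub> Ident M (X \<triangleright>\<^bsub>M\<^esub> N)) \<cdot>\<^bsub>M\<^esub> LAssoc M (Unit A \<star>\<^bsub>A\<^esub> Unit A) X N"
    by (subst lassoc_natural) auto
  have n2: "LAssoc M (Unit A) X N \<cdot>\<^bsub>M\<^esub> ((?I \<ast>\<^bsub>A\<^esub> LUnit A X) \<unrhd>\<^bsub>M\<^esub> Ident M N)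
      = (?I \<unrhd>\<^bsub>M\<^esub> LUnit A X \<unrhd>\<^bsub>M\<^esub> Ident M N) \<cdot>\<^bsub>M\<^esub> LAssoc M (Unit A) (Unit A \<star>\<^bsub>A\<^esub> X) N"
    by (subst lassoc_natural) auto
  have "(?I \<unrhd>\<^bsub>M\<^esub> (LActUnit M (X \<triangleright>\<^bsub>M\<^esub> N) \<cdot>\<^bsub>M\<^esub> LAssoc M (Unit A) X N)) \<cdot>\<^bsub>M\<^esub> ?s
      = (?I \<unrhd>\<^bsub>M\<^esub> LActUnit M (X \<triangleright>\<^bsub>M\<^esub> N)) \<cdot>\<^bsub>M\<^esub> (?I \<unrhd>\<^bsub>M\<^esub> LAssoc M (Unit A) X N) \<cdot>\<^bsub>M\<^esub> ?s"
    by (simp add: left.whisker_left)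
  also have "\<dots> = (?I \<unrhd>\<^bsub>M\<^esub> LActUnit M (X \<triangleright>\<^bsub>M\<^esub> N)) \<cdot>\<^bsub>M\<^esub> LAssoc M (Unit A) (Unit A) (X \<triangleright>\<^bsub>M\<^esub> N)
      \<cdot>\<^bsub>M\<^esub> LAssoc M (Unit A \<star>\<^bsub>A\<^esub> Unit A) X N"
    by (simp add: pent)
  also have "\<dots> = (RUnit A (Unit A) \<unrhd>\<^bsub>M\<^esub> Ident M (X \<triangleright>\<^bsub>M\<^esub> N)) \<cdot>\<^bsub>M\<^esub> LAssoc M (Unit A \<star>\<^bsub>A\<^esub> Unit A) X N"
    by (simp add: M.prefix_cong[OF tri] del: left.TA_Ident)
  also have "\<dots> = LAssoc M (Unit A) X N \<cdot>\<^bsub>M\<^esub> (((?I \<ast>\<^bsub>A\<^esub> LUnit A X) \<cdot>\<^bsub>A\<^esub> Assoc A (Unit A) (Unit A) X) \<unrhd>\<^bsub>M\<^esub> Ident M N)"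
    by (simp add: n1 A.triangle)
  also have "\<dots> = LAssoc M (Unit A) X N \<cdot>\<^bsub>M\<^esub> ((?I \<ast>\<^bsub>A\<^esub> LUnit A X) \<unrhd>\<^bsub>M\<^esub> Ident M N) \<cdot>\<^bsub>M\<^esub> ?a"
    by (simp add: left.whisker_right)
  also have "\<dots> = (?I \<unrhd>\<^bsub>M\<^esub> LUnit A X \<unrhd>\<^bsub>M\<^esub> Ident M N) \<cdot>\<^bsub>M\<^esub> ?s"
    by (simp add: M.prefix_cong[OF n2])
  finally show "?I \<unrhd>\<^bsub>M\<^esub> (LActUnit M (X \<triangleright>\<^bsub>M\<^esub> N) \<cdot>\<^bsub>M\<^esub> LAssoc M (Unit A) X N) = ?I \<unrhd>\<^bsub>M\<^esub> LUnit A X \<unrhd>\<^bsub>M\<^esub> Ident M N"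
    by (rule M.iso_right_cancel) auto
qed (use assms in auto)

lemma ractunit_ract:
  assumes N: "N \<in> Ob M" and X: "X \<in> Ob A"
  shows "(Ident M N \<unlhd>\<^bsub>M\<^esub> RUnit A X) \<cdot>\<^bsub>M\<^esub> RAssoc M N X (Unit A) = RActUnit M (N \<triangleleft>\<^bsub>M\<^esub> X)"
proof (rule unit_ract_faithful)
  let ?I = "Ident A (Unit A)"
  let ?r = "RAssoc M N X (Unit A)"
  note [simp] = X N
  note pent = right_pentagon[OF N X A.unit_Ob A.unit_Ob]
  note tri = right_triangle[OF right.TO_Ob[OF N X] A.unit_Ob]
  have n1: "?r \<cdot>\<^bsub>M\<^esub> (Ident M N \<unlhd>\<^bsub>M\<^esub> RUnit A X \<unlhd>\<^bsub>M\<^esub> ?I)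
      = (Ident M N \<unlhd>\<^bsub>M\<^esub> (RUnit A X \<ast>\<^bsub>A\<^esub> ?I)) \<cdot>\<^bsub>M\<^esub> RAssoc M N (X \<star>\<^bsub>A\<^esub> Unit A) (Unit A)"
    by (subst rassoc_natural) auto
  have n2: "?r \<cdot>\<^bsub>M\<^esub> (Ident M (N \<triangleleft>\<^bsub>M\<^esub> X) \<unlhd>\<^bsub>M\<^esub> LUnit A (Unit A))
      = (Ident M N \<unlhd>\<^bsub>M\<^esub> (Ident A X \<ast>\<^bsub>A\<^esub> LUnit A (Unit A))) \<cdot>\<^bsub>M\<^esub> RAssoc M N X (Unit A \<star>\<^bsub>A\<^esub> Unit A)"
    using rassoc_natural[of "Ident M N" "Ident A X" "LUnit A (Unit A)", OF _ _ _ refl refl refl refl refl refl] by simp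
  \<comment> \<open>Here the extra factor \<open>?r\<close> goes in front: its naturality moves
    \<open>RUnit A X\<close> inside the action on \<open>N\<close>, where the triangle of
    \<open>A\<close> turns it into \<open>LUnit\<close> and the right pentagon becomes
    applicable.\<close>
  have "?r \<cdot>\<^bsub>M\<^esub> (((Ident M N \<unlhd>\<^bsub>M\<^esub> RUnit A X) \<cdot>\<^bsub>M\<^esub> ?r) \<unlhd>\<^bsub>M\<^esub> ?I)
      = ?r \<cdot>\<^bsub>M\<^esub> (Ident M N \<unlhd>\<^bsub>M\<^esub> RUnit A X \<unlhd>\<^bsub>M\<^esub> ?I) \<cdot>\<^bsub>M\<^esub> (?r \<unlhd>\<^bsub>M\<^esub> ?I)"
    by (simp add: right.whisker_right)
  also have "\<dots> = (Ident M N \<unlhd>\<^bsub>M\<^esub> ((Ident A X \<ast>\<^bsub>A\<^esub> LUnit A (Unit A)) \<cdot>\<^bsub>A\<^esub> Assoc A X (Unit A) (Unit A)))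
      \<cdot>\<^bsub>M\<^esub> RAssoc M N (X \<star>\<^bsub>A\<^esub> Unit A) (Unit A) \<cdot>\<^bsub>M\<^esub> (?r \<unlhd>\<^bsub>M\<^esub> ?I)"
    by (simp add: M.prefix_cong[OF n1] A.triangle)
  also have "\<dots> = (Ident M N \<unlhd>\<^bsub>M\<^esub> (Ident A X \<ast>\<^bsub>A\<^esub> LUnit A (Unit A)))
      \<cdot>\<^bsub>M\<^esub> RAssoc M N X (Unit A \<star>\<^bsub>A\<^esub> Unit A) \<cdot>\<^bsub>M\<^esub> RAssoc M (N \<triangleleft>\<^bsub>M\<^esub> X) (Unit A) (Unit A)"
    by (simp add: right.whisker_left pent)
  also have "\<dots> = ?r \<cdot>\<^bsub>M\<^esub> (Ident M (N \<triangleleft>\<^bsub>M\<^esub> X) \<unlhd>\<^bsub>M\<^esub> LUnit A (Unit A)) \<cdot>\<^bsub>M\<^esub> RAssoc M (N \<triangleleft>\<^bsub>M\<^esub> X) (Unit A) (Unit A)"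
    by (simp add: M.prefix_cong[OF n2] del: right.TA_Ident)
  also have "\<dots> = ?r \<cdot>\<^bsub>M\<^esub> (RActUnit M (N \<triangleleft>\<^bsub>M\<^esub> X) \<unlhd>\<^bsub>M\<^esub> ?I)"
    by (simp add: tri)
  finally show "((Ident M N \<unlhd>\<^bsub>M\<^esub> RUnit A X) \<cdot>\<^bsub>M\<^esub> ?r) \<unlhd>\<^bsub>M\<^esub> ?I = RActUnit M (N \<triangleleft>\<^bsub>M\<^esub> X) \<unlhd>\<^bsub>M\<^esub> ?I"
    by (rule M.iso_left_cancel) auto
qed (use assms in auto)

lemma lactunit_ract:
  assumes N: "N \<in> Ob M" and W: "W \<in> Ob A"
  shows "LActUnit M (N \<triangleleft>\<^bsub>M\<^esub> W) \<cdot>\<^bsub>M\<^esub> MAssoc M (Unit A) N W = LActUnit M N \<unlhd>\<^bsub>M\<^esub> Ident A W"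
proof (rule unit_lact_faithful)
  let ?I = "Ident A (Unit A)"
  let ?l = "LAssoc M (Unit A) (Unit A) N \<unlhd>\<^bsub>M\<^esub> Ident A W"
  let ?s = "MAssoc M (Unit A) (Unit A \<triangleright>\<^bsub>M\<^esub> N) W \<cdot>\<^bsub>M\<^esub> ?l"
  note [simp] = W N
  \<comment> \<open>The units fill the two left slots, so the left triangle is available at both
    ends of the diagram: at \<open>N\<close> and at \<open>N \<triangleleft> W\<close>.\<close>
  note pent = left_middle_pentagon[OF A.unit_Ob A.unit_Ob N W]
  note tri = left_triangle[OF A.unit_Ob N]
  note tri' = left_triangle[OF A.unit_Ob right.TO_Ob[OF N W]]
  have n1: "MAssoc M (Unit A) N W \<cdot>\<^bsub>M\<^esub> ((RUnit A (Unit A) \<unrhd>\<^bsub>M\<^esub> Ident M N) \<unlhd>\<^bsub>M\<^esub> Ident A W)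
      = (RUnit A (Unit A) \<unrhd>\<^bsub>M\<^esub> Ident M (N \<triangleleft>\<^bsub>M\<^esub> W)) \<cdot>\<^bsub>M\<^esub> MAssoc M (Unit A \<star>\<^bsub>A\<^esub> Unit A) N W"
    by (subst massoc_natural) auto
  have n2: "MAssoc M (Unit A) N W \<cdot>\<^bsub>M\<^esub> ((?I \<unrhd>\<^bsub>M\<^esub> LActUnit M N) \<unlhd>\<^bsub>M\<^esub> Ident A W)
      = (?I \<unrhd>\<^bsub>M\<^esub> (LActUnit M N \<unlhd>\<^bsub>M\<^esub> Ident A W)) \<cdot>\<^bsub>M\<^esub> MAssoc M (Unit A) (Unit A \<triangleright>\<^bsub>M\<^esub> N) W"
    by (subst massoc_natural) auto
  have "(?I \<unrhd>\<^bsub>M\<^esub> (LActUnit M (N \<triangleleft>\<^bsub>M\<^esub> W) \<cdot>\<^bsub>M\<^esub> MAssoc M (Unit A) N W)) \<cdot>\<^bsub>M\<^esub> ?s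
      = (?I \<unrhd>\<^bsub>M\<^esub> LActUnit M (N \<triangleleft>\<^bsub>M\<^esub> W)) \<cdot>\<^bsub>M\<^esub> (?I \<unrhd>\<^bsub>M\<^esub> MAssoc M (Unit A) N W) \<cdot>\<^bsub>M\<^esub> ?s"
    by (simp add: left.whisker_left)
  also have "\<dots> = (?I \<unrhd>\<^bsub>M\<^esub> LActUnit M (N \<triangleleft>\<^bsub>M\<^esub> W)) \<cdot>\<^bsub>M\<^esub> LAssoc M (Unit A) (Unit A) (N \<triangleleft>\<^bsub>M\<^esub> W)
      \<cdot>\<^bsub>M\<^esub> MAssoc M (Unit A \<star>\<^bsub>A\<^esub> Unit A) N W"
    by (simp add: pent)
  also have "\<dots> = (RUnit A (Unit A) \<unrhd>\<^bsub>M\<^esub> Ident M (N \<triangleleft>\<^bsub>M\<^esub> W)) \<cdot>\<^bsub>M\<^esub> MAssoc M (Unit A \<star>\<^bsub>A\<^esub> Unit A) N W"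
    by (simp add: M.prefix_cong[OF tri'] del: left.TA_Ident)
  also have "\<dots> = MAssoc M (Unit A) N W \<cdot>\<^bsub>M\<^esub> (((?I \<unrhd>\<^bsub>M\<^esub> LActUnit M N) \<cdot>\<^bsub>M\<^esub> LAssoc M (Unit A) (Unit A) N) \<unlhd>\<^bsub>M\<^esub> Ident A W)"
    by (simp add: n1 tri)
  also have "\<dots> = MAssoc M (Unit A) N W \<cdot>\<^bsub>M\<^esub> ((?I \<unrhd>\<^bsub>M\<^esub> LActUnit M N) \<unlhd>\<^bsub>M\<^esub> Ident A W) \<cdot>\<^bsub>M\<^esub> ?l"
    by (simp add: right.whisker_right)
  also have "\<dots> = (?I \<unrhd>\<^bsub>M\<^esub> (LActUnit M N \<unlhd>\<^bsub>M\<^esub> Ident A W)) \<cdot>\<^bsub>M\<^esub> ?s"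
    by (simp add: M.prefix_cong[OF n2])
  finally show "?I \<unrhd>\<^bsub>M\<^esub> (LActUnit M (N \<triangleleft>\<^bsub>M\<^esub> W) \<cdot>\<^bsub>M\<^esub> MAssoc M (Unit A) N W) = ?I \<unrhd>\<^bsub>M\<^esub> (LActUnit M N \<unlhd>\<^bsub>M\<^esub> Ident A W)"
    by (rule M.iso_right_cancel) auto
qed (use assms in auto)

lemma ractunit_lact:
  assumes X: "X \<in> Ob A" and N: "N \<in> Ob M"
  shows "(Ident A X \<unrhd>\<^bsub>M\<^esub> RActUnit M N) \<cdot>\<^bsub>M\<^esub> MAssoc M X N (Unit A) = RActUnit M (X \<triangleright>\<^bsub>M\<^esub> N)"
proof (rule unit_ract_faithful)
  let ?I = "Ident A (Unit A)"
  let ?m = "MAssoc M X N (Unit A)"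
  note [simp] = X N
  \<comment> \<open>The units now fill the two right slots, and the right triangle is used at
    \<open>N\<close> and at \<open>X \<triangleright> N\<close>.\<close>
  note pent = right_middle_pentagon[OF X N A.unit_Ob A.unit_Ob]
  note tri = right_triangle[OF N A.unit_Ob]
  note tri' = right_triangle[OF left.TO_Ob[OF X N] A.unit_Ob]
  have n1: "?m \<cdot>\<^bsub>M\<^esub> (Ident M (X \<triangleright>\<^bsub>M\<^esub> N) \<unlhd>\<^bsub>M\<^esub> LUnit A (Unit A))
      = (Ident A X \<unrhd>\<^bsub>M\<^esub> (Ident M N \<unlhd>\<^bsub>M\<^esub> LUnit A (Unit A))) \<cdot>\<^bsub>M\<^esub> MAssoc M X N (Unit A \<star>\<^bsub>A\<^esub> Unit A)"
    using massoc_natural[of "Ident A X" "Ident M N" "LUnit A (Unit A)", OF _ _ _ refl refl refl refl refl refl] by simp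
  have n2: "?m \<cdot>\<^bsub>M\<^esub> ((Ident A X \<unrhd>\<^bsub>M\<^esub> RActUnit M N) \<unlhd>\<^bsub>M\<^esub> ?I)
      = (Ident A X \<unrhd>\<^bsub>M\<^esub> (RActUnit M N \<unlhd>\<^bsub>M\<^esub> ?I)) \<cdot>\<^bsub>M\<^esub> MAssoc M X (N \<triangleleft>\<^bsub>M\<^esub> Unit A) (Unit A)"
    by (subst massoc_natural) auto
  have "?m \<cdot>\<^bsub>M\<^esub> (((Ident A X \<unrhd>\<^bsub>M\<^esub> RActUnit M N) \<cdot>\<^bsub>M\<^esub> ?m) \<unlhd>\<^bsub>M\<^esub> ?I)
      = ?m \<cdot>\<^bsub>M\<^esub> ((Ident A X \<unrhd>\<^bsub>M\<^esub> RActUnit M N) \<unlhd>\<^bsub>M\<^esub> ?I) \<cdot>\<^bsub>M\<^esub> (?m \<unlhd>\<^bsub>M\<^esub> ?I)"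
    by (simp add: right.whisker_right)
  also have "\<dots> = (Ident A X \<unrhd>\<^bsub>M\<^esub> ((Ident M N \<unlhd>\<^bsub>M\<^esub> LUnit A (Unit A)) \<cdot>\<^bsub>M\<^esub> RAssoc M N (Unit A) (Unit A)))
      \<cdot>\<^bsub>M\<^esub> MAssoc M X (N \<triangleleft>\<^bsub>M\<^esub> Unit A) (Unit A) \<cdot>\<^bsub>M\<^esub> (?m \<unlhd>\<^bsub>M\<^esub> ?I)"
    by (simp add: M.prefix_cong[OF n2] tri)
  also have "\<dots> = (Ident A X \<unrhd>\<^bsub>M\<^esub> (Ident M N \<unlhd>\<^bsub>M\<^esub> LUnit A (Unit A))) \<cdot>\<^bsub>M\<^esub> MAssoc M X N (Unit A \<star>\<^bsub>A\<^esub> Unit A)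
      \<cdot>\<^bsub>M\<^esub> RAssoc M (X \<triangleright>\<^bsub>M\<^esub> N) (Unit A) (Unit A)"
    by (simp add: left.whisker_left pent)
  also have "\<dots> = ?m \<cdot>\<^bsub>M\<^esub> (Ident M (X \<triangleright>\<^bsub>M\<^esub> N) \<unlhd>\<^bsub>M\<^esub> LUnit A (Unit A)) \<cdot>\<^bsub>M\<^esub> RAssoc M (X \<triangleright>\<^bsub>M\<^esub> N) (Unit A) (Unit A)"
    by (simp add: M.prefix_cong[OF n1] del: right.TA_Ident)
  also have "\<dots> = ?m \<cdot>\<^bsub>M\<^esub> (RActUnit M (X \<triangleright>\<^bsub>M\<^esub> N) \<unlhd>\<^bsub>M\<^esub> ?I)"
    by (simp add: tri')
  finally show "((Ident A X \<unrhd>\<^bsub>M\<^esub> RActUnit M N) \<cdot>\<^bsub>M\<^esub> ?m) \<unlhd>\<^bsub>M\<^esub> ?I = RActUnit M (X \<triangleright>\<^bsub>M\<^esub> N) \<unlhd>\<^bsub>M\<^esub> ?I"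
    by (rule M.iso_left_cancel) auto
qed (use assms in auto)

end

section \<open>Transporting the monoidal structure\<close>

text \<open>The situation after lifting: \<open>\<Phi>\<close> is a bare linear functor and
  \<open>\<tau>\<close> merely natural. The monoidal structure of \<open>\<Phi>\<close> and the
  multiplicativity of \<open>\<tau>\<close> are to be produced. \<open>M\<close> is an arbitrary
  bimodule category, later replaced by \<open>Kb A M\<close>.\<close>

locale conjugation = bimodule_category K A M + Phi: linear_functor K A A \<Phi>
  for K :: "('k, 'r) ring_scheme" and A :: "('k, 'a, 'f, 'z) mon_cat_scheme"
    and M :: "('k, 'a, 'f, 'o, 'm, 'y) bimod_cat_scheme" and \<Phi> :: "('a, 'f, 'a, 'f) fctr" +
  fixes Z :: 'o and \<tau> :: "'a \<Rightarrow> 'm"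
  assumes Z_Ob [simp]: "Z \<in> Ob M"
    and R_fully_faithful: "fully_faithful A M (R_fun M Z)"
    and tau_nat_iso: "nat_iso A M (L_fun M Z) (fun_comp (R_fun M Z) \<Phi>) \<tau>"
begin

sublocale R: linear_functor K A M "R_fun M Z"
  unfolding R_fun_def by (rule left.linear_functor_right) simp

abbreviation Phi_ob :: "'a \<Rightarrow> 'a" ("\<phi>") where "\<phi> \<equiv> FO \<Phi>"

lemma tau_simps [simp]:
  assumes "X \<in> Ob A"
  shows "invertible M (\<tau> X)" "Dom M (\<tau> X) = Z \<triangleleft>\<^bsub>M\<^esub> X" "Cod M (\<tau> X) = \<phi> X \<triangleright>\<^bsub>M\<^esub> Z"
  using tau_nat_iso assms by (auto simp: nat_iso_def L_fun_def R_fun_def fun_comp_def M.iso_arr_iff)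

lemma tau_natural:
  assumes "arrow A f" "Cod A f = Y" "Dom A f = X"
  shows "\<tau> Y \<cdot>\<^bsub>M\<^esub> (Ident M Z \<unlhd>\<^bsub>M\<^esub> f) = (FA \<Phi> f \<unrhd>\<^bsub>M\<^esub> Ident M Z) \<cdot>\<^bsub>M\<^esub> \<tau> X"
  using tau_nat_iso assms by (auto simp: nat_iso_def L_fun_def R_fun_def fun_comp_def A.C.arr_iff)

lemma act_Z_faithful:
  assumes "f \<unrhd>\<^bsub>M\<^esub> Ident M Z = g \<unrhd>\<^bsub>M\<^esub> Ident M Z" "arrow A f" "arrow A g" "Dom A f = Dom A g" "Cod A f = Cod A g"
  shows "f = g"
  using R.faithful[OF R_fully_faithful, of f g] assms by (simp add: R_fun_def)

text \<open>The inverse of \<open>R_fun M Z\<close> on hom-sets, renamed so that its rules speak of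
  acting on \<open>Z\<close> and match the terms that occur in diagrams.\<close>

definition act_Z_inv :: "'a \<Rightarrow> 'a \<Rightarrow> 'm \<Rightarrow> 'f" where
  "act_Z_inv X Y h = R.preimage X Y h"

lemma act_Z_inv [simp]:
  assumes "arrow M h" "X \<in> Ob A" "Y \<in> Ob A" "Dom M h = X \<triangleright>\<^bsub>M\<^esub> Z" "Cod M h = Y \<triangleright>\<^bsub>M\<^esub> Z"
  shows "arrow A (act_Z_inv X Y h)" "Dom A (act_Z_inv X Y h) = X" "Cod A (act_Z_inv X Y h) = Y"
    "act_Z_inv X Y h \<unrhd>\<^bsub>M\<^esub> Ident M Z = h"
  using R.preimage[OF R_fully_faithful assms(1-3)] assms by (auto simp: act_Z_inv_def R_fun_def)

lemma act_Z_inv_invertible [simp]: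
  assumes "invertible M h" "X \<in> Ob A" "Y \<in> Ob A" "Dom M h = X \<triangleright>\<^bsub>M\<^esub> Z" "Cod M h = Y \<triangleright>\<^bsub>M\<^esub> Z"
  shows "invertible A (act_Z_inv X Y h)"
  using assms by (intro R.reflects_iso[OF R_fully_faithful]) (auto simp: R_fun_def)

text \<open>Solves multiplicativity for the constraint. The composite leads from
  \<open>\<phi> (X \<star> Y) \<triangleright> Z\<close> back along \<open>\<tau>\<close> to
  \<open>Z \<triangleleft> (X \<star> Y)\<close>, moves \<open>Z\<close> past \<open>X\<close> and
  then past \<open>Y\<close>, and rebrackets to
  \<open>(\<phi> X \<star> \<phi> Y) \<triangleright> Z\<close>. All its factors are invertible,
  hence so is the preimage.\<close>

definition mult :: "'a \<Rightarrow> 'a \<Rightarrow> 'f" where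
  "mult X Y = act_Z_inv (\<phi> (X \<star>\<^bsub>A\<^esub> Y)) (\<phi> X \<star>\<^bsub>A\<^esub> \<phi> Y)
     (inverse_arrow M (LAssoc M (\<phi> X) (\<phi> Y) Z) \<cdot>\<^bsub>M\<^esub> (Ident A (\<phi> X) \<unrhd>\<^bsub>M\<^esub> \<tau> Y) \<cdot>\<^bsub>M\<^esub> MAssoc M (\<phi> X) Z Y
       \<cdot>\<^bsub>M\<^esub> (\<tau> X \<unlhd>\<^bsub>M\<^esub> Ident A Y) \<cdot>\<^bsub>M\<^esub> inverse_arrow M (RAssoc M Z X Y) \<cdot>\<^bsub>M\<^esub> inverse_arrow M (\<tau> (X \<star>\<^bsub>A\<^esub> Y)))"

text \<open>Both \<open>Z \<triangleleft> Unit A\<close> and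
  \<open>Unit A \<triangleright> Z\<close> are identified with \<open>Z\<close> by the unit actions.
  The constraint is the one for which \<open>\<tau> (Unit A)\<close> becomes the identity of
  \<open>Z\<close> under these identifications.\<close>

definition unit :: "'f" where
  "unit = act_Z_inv (\<phi> (Unit A)) (Unit A)
     (inverse_arrow M (LActUnit M Z) \<cdot>\<^bsub>M\<^esub> RActUnit M Z \<cdot>\<^bsub>M\<^esub> inverse_arrow M (\<tau> (Unit A)))"

lemma mult_simps [simp]:
  assumes "X \<in> Ob A" "Y \<in> Ob A"
  shows "invertible A (mult X Y)" "Dom A (mult X Y) = \<phi> (X \<star>\<^bsub>A\<^esub> Y)" "Cod A (mult X Y) = \<phi> X \<star>\<^bsub>A\<^esub> \<phi> Y"
  using assms by (auto simp: mult_def)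

lemma unit_simps [simp]:
  "invertible A unit" "Dom A unit = \<phi> (Unit A)" "Cod A unit = Unit A"
  by (auto simp: unit_def)

text \<open>The first two factors form the left associativity of the action twisted by
  \<open>\<Phi>\<close> with constraint \<open>mult\<close>, so this is exactly the multiplicativity
  clause of the centralizer. It is also the only property of \<open>mult\<close>, besides its
  source, target and invertibility, that the coherence proofs use.\<close>

lemma tau_mult:
  assumes [simp]: "X \<in> Ob A" "Y \<in> Ob A"
  shows "LAssoc M (\<phi> X) (\<phi> Y) Z \<cdot>\<^bsub>M\<^esub> (mult X Y \<unrhd>\<^bsub>M\<^esub> Ident M Z) \<cdot>\<^bsub>M\<^esub> \<tau> (X \<star>\<^bsub>A\<^esub> Y) \<cdot>\<^bsub>M\<^esub> RAssoc M Z X Y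
    = (Ident A (\<phi> X) \<unrhd>\<^bsub>M\<^esub> \<tau> Y) \<cdot>\<^bsub>M\<^esub> MAssoc M (\<phi> X) Z Y \<cdot>\<^bsub>M\<^esub> (\<tau> X \<unlhd>\<^bsub>M\<^esub> Ident A Y)"
  by (simp add: mult_def)

lemma tau_unit:
  "LActUnit M Z \<cdot>\<^bsub>M\<^esub> (unit \<unrhd>\<^bsub>M\<^esub> Ident M Z) \<cdot>\<^bsub>M\<^esub> \<tau> (Unit A) = RActUnit M Z"
  by (simp add: unit_def)

text \<open>Acted on \<open>Z\<close> and flanked by \<open>?l'\<close> and \<open>?s\<close>, both
  sides contain \<open>mult\<close> only in the pattern of \<open>tau_mult\<close>. Replacing it
  leaves \<open>\<tau>\<close> and associativity arrows, all of which are natural.\<close>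

lemma mult_natural:
  assumes "arrow A f" "arrow A g" "Dom A f = X" "Cod A f = X'" "Dom A g = Y" "Cod A g = Y'"
  shows "mult X' Y' \<cdot>\<^bsub>A\<^esub> FA \<Phi> (f \<ast>\<^bsub>A\<^esub> g) = (FA \<Phi> f \<ast>\<^bsub>A\<^esub> FA \<Phi> g) \<cdot>\<^bsub>A\<^esub> mult X Y"
proof (rule act_Z_faithful)
  let ?Z = "Ident M Z" and ?f = "FA \<Phi> f" and ?g = "FA \<Phi> g"
  let ?l = "LAssoc M (\<phi> X) (\<phi> Y) Z" and ?l' = "LAssoc M (\<phi> X') (\<phi> Y') Z"
  let ?m = "MAssoc M (\<phi> X) Z Y" and ?m' = "MAssoc M (\<phi> X') Z Y'"
  let ?r = "RAssoc M Z X Y" and ?r' = "RAssoc M Z X' Y'"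
  let ?s = "\<tau> (X \<star>\<^bsub>A\<^esub> Y) \<cdot>\<^bsub>M\<^esub> ?r"
  note [simp] = assms
  have [simp]: "X \<in> Ob A" "X' \<in> Ob A" "Y \<in> Ob A" "Y' \<in> Ob A"
    using A.C.arrow_Ob assms by metis+
  have n: "\<tau> (X' \<star>\<^bsub>A\<^esub> Y') \<cdot>\<^bsub>M\<^esub> (?Z \<unlhd>\<^bsub>M\<^esub> (f \<ast>\<^bsub>A\<^esub> g)) = (FA \<Phi> (f \<ast>\<^bsub>A\<^esub> g) \<unrhd>\<^bsub>M\<^esub> ?Z) \<cdot>\<^bsub>M\<^esub> \<tau> (X \<star>\<^bsub>A\<^esub> Y)"
    by (rule tau_natural) auto
  have nr: "?r' \<cdot>\<^bsub>M\<^esub> (?Z \<unlhd>\<^bsub>M\<^esub> f \<unlhd>\<^bsub>M\<^esub> g) = (?Z \<unlhd>\<^bsub>M\<^esub> (f \<ast>\<^bsub>A\<^esub> g)) \<cdot>\<^bsub>M\<^esub> ?r"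
    by (rule rassoc_natural) auto
  have nm: "?m' \<cdot>\<^bsub>M\<^esub> ((?f \<unrhd>\<^bsub>M\<^esub> ?Z) \<unlhd>\<^bsub>M\<^esub> g) = (?f \<unrhd>\<^bsub>M\<^esub> (?Z \<unlhd>\<^bsub>M\<^esub> g)) \<cdot>\<^bsub>M\<^esub> ?m"
    by (rule massoc_natural) auto
  have nl: "?l' \<cdot>\<^bsub>M\<^esub> ((?f \<ast>\<^bsub>A\<^esub> ?g) \<unrhd>\<^bsub>M\<^esub> ?Z) = (?f \<unrhd>\<^bsub>M\<^esub> ?g \<unrhd>\<^bsub>M\<^esub> ?Z) \<cdot>\<^bsub>M\<^esub> ?l"
    by (rule lassoc_natural) auto
  \<comment> \<open>In \<open>e1\<close> and \<open>e2\<close> two successive arrows are fused into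
    one action of a pair of composites, so that naturality of \<open>\<tau>\<close> can be applied
    within a single slot.\<close>
  have e1: "(\<tau> X' \<unlhd>\<^bsub>M\<^esub> Ident A Y') \<cdot>\<^bsub>M\<^esub> (?Z \<unlhd>\<^bsub>M\<^esub> f \<unlhd>\<^bsub>M\<^esub> g) = ((?f \<unrhd>\<^bsub>M\<^esub> ?Z) \<unlhd>\<^bsub>M\<^esub> g) \<cdot>\<^bsub>M\<^esub> (\<tau> X \<unlhd>\<^bsub>M\<^esub> Ident A Y)"
    by (simp flip: right.TA_cmp add: tau_natural[of f X' X])
  have e2: "(Ident A (\<phi> X') \<unrhd>\<^bsub>M\<^esub> \<tau> Y') \<cdot>\<^bsub>M\<^esub> (?f \<unrhd>\<^bsub>M\<^esub> (?Z \<unlhd>\<^bsub>M\<^esub> g)) = (?f \<unrhd>\<^bsub>M\<^esub> ?g \<unrhd>\<^bsub>M\<^esub> ?Z) \<cdot>\<^bsub>M\<^esub> (Ident A (\<phi> X) \<unrhd>\<^bsub>M\<^esub> \<tau> Y)"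
    by (simp flip: left.TA_cmp add: tau_natural[of g Y' Y])
  have "?l' \<cdot>\<^bsub>M\<^esub> ((mult X' Y' \<cdot>\<^bsub>A\<^esub> FA \<Phi> (f \<ast>\<^bsub>A\<^esub> g)) \<unrhd>\<^bsub>M\<^esub> ?Z) \<cdot>\<^bsub>M\<^esub> ?s
      = ?l' \<cdot>\<^bsub>M\<^esub> (mult X' Y' \<unrhd>\<^bsub>M\<^esub> ?Z) \<cdot>\<^bsub>M\<^esub> (FA \<Phi> (f \<ast>\<^bsub>A\<^esub> g) \<unrhd>\<^bsub>M\<^esub> ?Z) \<cdot>\<^bsub>M\<^esub> \<tau> (X \<star>\<^bsub>A\<^esub> Y) \<cdot>\<^bsub>M\<^esub> ?r"
    by (simp add: left.whisker_right)
  also have "\<dots> = ?l' \<cdot>\<^bsub>M\<^esub> (mult X' Y' \<unrhd>\<^bsub>M\<^esub> ?Z) \<cdot>\<^bsub>M\<^esub> \<tau> (X' \<star>\<^bsub>A\<^esub> Y') \<cdot>\<^bsub>M\<^esub> (?Z \<unlhd>\<^bsub>M\<^esub> (f \<ast>\<^bsub>A\<^esub> g)) \<cdot>\<^bsub>M\<^esub> ?r"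
    by (simp add: M.prefix_cong[OF n])
  also have "\<dots> = ?l' \<cdot>\<^bsub>M\<^esub> (mult X' Y' \<unrhd>\<^bsub>M\<^esub> ?Z) \<cdot>\<^bsub>M\<^esub> \<tau> (X' \<star>\<^bsub>A\<^esub> Y') \<cdot>\<^bsub>M\<^esub> ?r' \<cdot>\<^bsub>M\<^esub> (?Z \<unlhd>\<^bsub>M\<^esub> f \<unlhd>\<^bsub>M\<^esub> g)"
    by (simp add: nr)
  also have "\<dots> = (?l' \<cdot>\<^bsub>M\<^esub> (mult X' Y' \<unrhd>\<^bsub>M\<^esub> ?Z) \<cdot>\<^bsub>M\<^esub> \<tau> (X' \<star>\<^bsub>A\<^esub> Y') \<cdot>\<^bsub>M\<^esub> ?r') \<cdot>\<^bsub>M\<^esub> (?Z \<unlhd>\<^bsub>M\<^esub> f \<unlhd>\<^bsub>M\<^esub> g)"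
    by simp
  also have "\<dots> = (Ident A (\<phi> X') \<unrhd>\<^bsub>M\<^esub> \<tau> Y') \<cdot>\<^bsub>M\<^esub> ?m' \<cdot>\<^bsub>M\<^esub> (\<tau> X' \<unlhd>\<^bsub>M\<^esub> Ident A Y') \<cdot>\<^bsub>M\<^esub> (?Z \<unlhd>\<^bsub>M\<^esub> f \<unlhd>\<^bsub>M\<^esub> g)"
    by (subst tau_mult) simp_all
  also have "\<dots> = (Ident A (\<phi> X') \<unrhd>\<^bsub>M\<^esub> \<tau> Y') \<cdot>\<^bsub>M\<^esub> (?f \<unrhd>\<^bsub>M\<^esub> (?Z \<unlhd>\<^bsub>M\<^esub> g)) \<cdot>\<^bsub>M\<^esub> ?m \<cdot>\<^bsub>M\<^esub> (\<tau> X \<unlhd>\<^bsub>M\<^esub> Ident A Y)"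
    by (simp add: e1 M.prefix_cong[OF nm])
  also have "\<dots> = (?f \<unrhd>\<^bsub>M\<^esub> ?g \<unrhd>\<^bsub>M\<^esub> ?Z) \<cdot>\<^bsub>M\<^esub> (Ident A (\<phi> X) \<unrhd>\<^bsub>M\<^esub> \<tau> Y) \<cdot>\<^bsub>M\<^esub> ?m \<cdot>\<^bsub>M\<^esub> (\<tau> X \<unlhd>\<^bsub>M\<^esub> Ident A Y)"
    by (simp add: M.prefix_cong[OF e2])
  also have "\<dots> = (?f \<unrhd>\<^bsub>M\<^esub> ?g \<unrhd>\<^bsub>M\<^esub> ?Z) \<cdot>\<^bsub>M\<^esub> ?l \<cdot>\<^bsub>M\<^esub> (mult X Y \<unrhd>\<^bsub>M\<^esub> ?Z) \<cdot>\<^bsub>M\<^esub> ?s"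
    by (simp add: tau_mult)
  also have "\<dots> = ?l' \<cdot>\<^bsub>M\<^esub> (((?f \<ast>\<^bsub>A\<^esub> ?g) \<cdot>\<^bsub>A\<^esub> mult X Y) \<unrhd>\<^bsub>M\<^esub> ?Z) \<cdot>\<^bsub>M\<^esub> ?s"
    by (simp add: left.whisker_right M.prefix_cong[OF nl])
  finally have "((mult X' Y' \<cdot>\<^bsub>A\<^esub> FA \<Phi> (f \<ast>\<^bsub>A\<^esub> g)) \<unrhd>\<^bsub>M\<^esub> ?Z) \<cdot>\<^bsub>M\<^esub> ?s = (((?f \<ast>\<^bsub>A\<^esub> ?g) \<cdot>\<^bsub>A\<^esub> mult X Y) \<unrhd>\<^bsub>M\<^esub> ?Z) \<cdot>\<^bsub>M\<^esub> ?s"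
    by (rule M.iso_left_cancel) auto
  then show "(mult X' Y' \<cdot>\<^bsub>A\<^esub> FA \<Phi> (f \<ast>\<^bsub>A\<^esub> g)) \<unrhd>\<^bsub>M\<^esub> ?Z = ((?f \<ast>\<^bsub>A\<^esub> ?g) \<cdot>\<^bsub>A\<^esub> mult X Y) \<unrhd>\<^bsub>M\<^esub> ?Z"
    by (rule M.iso_right_cancel) auto
qed (use assms in auto)

text \<open>Both sides, acted on \<open>Z\<close> and flanked by \<open>?s\<close> and
  \<open>?t\<close>, equal the arrow from
  \<open>((Z \<triangleleft> X) \<triangleleft> Y) \<triangleleft> W\<close> to \<open>\<phi> X
  \<triangleright> \<phi> Y \<triangleright> \<phi> W \<triangleright> Z\<close> that moves
  \<open>Z\<close> past \<open>X\<close>, \<open>Y\<close> and \<open>W\<close> one at a time. The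
  left side reaches it through the left and left middle pentagons, the right side through the right
  and right middle pentagons.\<close>

lemma mult_assoc:
  assumes X: "X \<in> Ob A" and Y: "Y \<in> Ob A" and W: "W \<in> Ob A"
  shows "Assoc A (\<phi> X) (\<phi> Y) (\<phi> W) \<cdot>\<^bsub>A\<^esub> (mult X Y \<ast>\<^bsub>A\<^esub> Ident A (\<phi> W)) \<cdot>\<^bsub>A\<^esub> mult (X \<star>\<^bsub>A\<^esub> Y) W
    = (Ident A (\<phi> X) \<ast>\<^bsub>A\<^esub> mult Y W) \<cdot>\<^bsub>A\<^esub> mult X (Y \<star>\<^bsub>A\<^esub> W) \<cdot>\<^bsub>A\<^esub> FA \<Phi> (Assoc A X Y W)"
proof (rule act_Z_faithful)
  note [simp] = assms
  let ?Z = "Ident M Z" and ?X = "Ident A (\<phi> X)" and ?Y = "Ident A (\<phi> Y)" and ?W = "Ident A W"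
  let ?a = "Assoc A (\<phi> X) (\<phi> Y) (\<phi> W)" and ?a' = "Assoc A X Y W"
  \<comment> \<open>\<open>?s\<close> and \<open>?t\<close> are the invertible flanks.
    \<open>?u\<close> is the common first stage of both computations: it moves \<open>Z\<close> past
    \<open>X\<close> while \<open>Y\<close> and \<open>W\<close> stay on the right, ending at
    \<open>\<phi> X \<triangleright> ((Z \<triangleleft> Y) \<triangleleft> W)\<close>.\<close>
  let ?s = "(?X \<unrhd>\<^bsub>M\<^esub> LAssoc M (\<phi> Y) (\<phi> W) Z) \<cdot>\<^bsub>M\<^esub> LAssoc M (\<phi> X) (\<phi> Y \<star>\<^bsub>A\<^esub> \<phi> W) Z"
  let ?t = "\<tau> ((X \<star>\<^bsub>A\<^esub> Y) \<star>\<^bsub>A\<^esub> W) \<cdot>\<^bsub>M\<^esub> RAssoc M Z (X \<star>\<^bsub>A\<^esub> Y) W \<cdot>\<^bsub>M\<^esub> (RAssoc M Z X Y \<unlhd>\<^bsub>M\<^esub> ?W)"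
  let ?u = "MAssoc M (\<phi> X) (Z \<triangleleft>\<^bsub>M\<^esub> Y) W \<cdot>\<^bsub>M\<^esub> (MAssoc M (\<phi> X) Z Y \<unlhd>\<^bsub>M\<^esub> ?W) \<cdot>\<^bsub>M\<^esub> (\<tau> X \<unlhd>\<^bsub>M\<^esub> Ident A Y \<unlhd>\<^bsub>M\<^esub> ?W)"
  note pent = left_pentagon[OF Phi.fun_ob[OF X] Phi.fun_ob[OF Y] Phi.fun_ob[OF W] Z_Ob]
    and rpent = right_pentagon[OF Z_Ob X Y W]
    and lmid = left_middle_pentagon[OF Phi.fun_ob[OF X] Phi.fun_ob[OF Y] Z_Ob W]
    and rmid = right_middle_pentagon[OF Phi.fun_ob[OF X] Z_Ob Y W]

  have l1: "LAssoc M (\<phi> X \<star>\<^bsub>A\<^esub> \<phi> Y) (\<phi> W) Z \<cdot>\<^bsub>M\<^esub> ((mult X Y \<ast>\<^bsub>A\<^esub> Ident A (\<phi> W)) \<unrhd>\<^bsub>M\<^esub> ?Z)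
      = (mult X Y \<unrhd>\<^bsub>M\<^esub> Ident M (\<phi> W \<triangleright>\<^bsub>M\<^esub> Z)) \<cdot>\<^bsub>M\<^esub> LAssoc M (\<phi> (X \<star>\<^bsub>A\<^esub> Y)) (\<phi> W) Z"
    by (subst lassoc_natural) auto
  have l2: "(mult X Y \<unrhd>\<^bsub>M\<^esub> Ident M (\<phi> W \<triangleright>\<^bsub>M\<^esub> Z)) \<cdot>\<^bsub>M\<^esub> (Ident A (\<phi> (X \<star>\<^bsub>A\<^esub> Y)) \<unrhd>\<^bsub>M\<^esub> \<tau> W)
      = (Ident A (\<phi> X \<star>\<^bsub>A\<^esub> \<phi> Y) \<unrhd>\<^bsub>M\<^esub> \<tau> W) \<cdot>\<^bsub>M\<^esub> (mult X Y \<unrhd>\<^bsub>M\<^esub> Ident M (Z \<triangleleft>\<^bsub>M\<^esub> W))"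
    by (rule left.interchange) auto
  have l3: "LAssoc M (\<phi> X) (\<phi> Y) (\<phi> W \<triangleright>\<^bsub>M\<^esub> Z) \<cdot>\<^bsub>M\<^esub> (Ident A (\<phi> X \<star>\<^bsub>A\<^esub> \<phi> Y) \<unrhd>\<^bsub>M\<^esub> \<tau> W)
      = (?X \<unrhd>\<^bsub>M\<^esub> ?Y \<unrhd>\<^bsub>M\<^esub> \<tau> W) \<cdot>\<^bsub>M\<^esub> LAssoc M (\<phi> X) (\<phi> Y) (Z \<triangleleft>\<^bsub>M\<^esub> W)"
    using lassoc_natural[of ?X ?Y "\<tau> W", OF _ _ _ refl refl refl refl refl refl] by simp
  have l4: "MAssoc M (\<phi> X \<star>\<^bsub>A\<^esub> \<phi> Y) Z W \<cdot>\<^bsub>M\<^esub> ((mult X Y \<unrhd>\<^bsub>M\<^esub> ?Z) \<unlhd>\<^bsub>M\<^esub> ?W)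
      = (mult X Y \<unrhd>\<^bsub>M\<^esub> Ident M (Z \<triangleleft>\<^bsub>M\<^esub> W)) \<cdot>\<^bsub>M\<^esub> MAssoc M (\<phi> (X \<star>\<^bsub>A\<^esub> Y)) Z W"
    by (subst massoc_natural) auto
  have l5: "MAssoc M (\<phi> X) (\<phi> Y \<triangleright>\<^bsub>M\<^esub> Z) W \<cdot>\<^bsub>M\<^esub> ((?X \<unrhd>\<^bsub>M\<^esub> \<tau> Y) \<unlhd>\<^bsub>M\<^esub> ?W)
      = (?X \<unrhd>\<^bsub>M\<^esub> (\<tau> Y \<unlhd>\<^bsub>M\<^esub> ?W)) \<cdot>\<^bsub>M\<^esub> MAssoc M (\<phi> X) (Z \<triangleleft>\<^bsub>M\<^esub> Y) W"
    by (subst massoc_natural) auto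
  \<comment> \<open>Multiplicativity at the pair \<open>X \<star> Y\<close>, \<open>W\<close> with a
    further arrow attached on the right. The bracketing is restored by hand to expose the
    four-factor prefix that \<open>tau_mult\<close> rewrites.\<close>
  have tmL: "LAssoc M (\<phi> (X \<star>\<^bsub>A\<^esub> Y)) (\<phi> W) Z \<cdot>\<^bsub>M\<^esub> (mult (X \<star>\<^bsub>A\<^esub> Y) W \<unrhd>\<^bsub>M\<^esub> ?Z) \<cdot>\<^bsub>M\<^esub> ?t
      = (Ident A (\<phi> (X \<star>\<^bsub>A\<^esub> Y)) \<unrhd>\<^bsub>M\<^esub> \<tau> W) \<cdot>\<^bsub>M\<^esub> MAssoc M (\<phi> (X \<star>\<^bsub>A\<^esub> Y)) Z W \<cdot>\<^bsub>M\<^esub> (\<tau> (X \<star>\<^bsub>A\<^esub> Y) \<unlhd>\<^bsub>M\<^esub> ?W) \<cdot>\<^bsub>M\<^esub> (RAssoc M Z X Y \<unlhd>\<^bsub>M\<^esub> ?W)"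
  proof -
    have "LAssoc M (\<phi> (X \<star>\<^bsub>A\<^esub> Y)) (\<phi> W) Z \<cdot>\<^bsub>M\<^esub> (mult (X \<star>\<^bsub>A\<^esub> Y) W \<unrhd>\<^bsub>M\<^esub> ?Z) \<cdot>\<^bsub>M\<^esub> ?t
      = (LAssoc M (\<phi> (X \<star>\<^bsub>A\<^esub> Y)) (\<phi> W) Z \<cdot>\<^bsub>M\<^esub> (mult (X \<star>\<^bsub>A\<^esub> Y) W \<unrhd>\<^bsub>M\<^esub> ?Z) \<cdot>\<^bsub>M\<^esub> \<tau> ((X \<star>\<^bsub>A\<^esub> Y) \<star>\<^bsub>A\<^esub> W)
          \<cdot>\<^bsub>M\<^esub> RAssoc M Z (X \<star>\<^bsub>A\<^esub> Y) W) \<cdot>\<^bsub>M\<^esub> (RAssoc M Z X Y \<unlhd>\<^bsub>M\<^esub> ?W)"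
      by simp
    then show ?thesis
      by (subst (asm) tau_mult) simp_all
  qed
  have tmXY: "(LAssoc M (\<phi> X) (\<phi> Y) Z \<unlhd>\<^bsub>M\<^esub> ?W) \<cdot>\<^bsub>M\<^esub> ((mult X Y \<unrhd>\<^bsub>M\<^esub> ?Z) \<unlhd>\<^bsub>M\<^esub> ?W) \<cdot>\<^bsub>M\<^esub> (\<tau> (X \<star>\<^bsub>A\<^esub> Y) \<unlhd>\<^bsub>M\<^esub> ?W) \<cdot>\<^bsub>M\<^esub> (RAssoc M Z X Y \<unlhd>\<^bsub>M\<^esub> ?W)
      = ((?X \<unrhd>\<^bsub>M\<^esub> \<tau> Y) \<unlhd>\<^bsub>M\<^esub> ?W) \<cdot>\<^bsub>M\<^esub> (MAssoc M (\<phi> X) Z Y \<unlhd>\<^bsub>M\<^esub> ?W) \<cdot>\<^bsub>M\<^esub> (\<tau> X \<unlhd>\<^bsub>M\<^esub> Ident A Y \<unlhd>\<^bsub>M\<^esub> ?W)"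
    using arg_cong[OF tau_mult[OF X Y], of "\<lambda>h. h \<unlhd>\<^bsub>M\<^esub> ?W"] by (simp add: right.whisker_right)

  have "?s \<cdot>\<^bsub>M\<^esub> ((?a \<cdot>\<^bsub>A\<^esub> (mult X Y \<ast>\<^bsub>A\<^esub> Ident A (\<phi> W)) \<cdot>\<^bsub>A\<^esub> mult (X \<star>\<^bsub>A\<^esub> Y) W) \<unrhd>\<^bsub>M\<^esub> ?Z) \<cdot>\<^bsub>M\<^esub> ?t
      = ?s \<cdot>\<^bsub>M\<^esub> (?a \<unrhd>\<^bsub>M\<^esub> ?Z) \<cdot>\<^bsub>M\<^esub> ((mult X Y \<ast>\<^bsub>A\<^esub> Ident A (\<phi> W)) \<unrhd>\<^bsub>M\<^esub> ?Z) \<cdot>\<^bsub>M\<^esub> (mult (X \<star>\<^bsub>A\<^esub> Y) W \<unrhd>\<^bsub>M\<^esub> ?Z) \<cdot>\<^bsub>M\<^esub> ?t"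
    by (simp add: left.whisker_right)
  also have "\<dots> = (?s \<cdot>\<^bsub>M\<^esub> (?a \<unrhd>\<^bsub>M\<^esub> ?Z)) \<cdot>\<^bsub>M\<^esub> ((mult X Y \<ast>\<^bsub>A\<^esub> Ident A (\<phi> W)) \<unrhd>\<^bsub>M\<^esub> ?Z) \<cdot>\<^bsub>M\<^esub> (mult (X \<star>\<^bsub>A\<^esub> Y) W \<unrhd>\<^bsub>M\<^esub> ?Z) \<cdot>\<^bsub>M\<^esub> ?t"
    by simp
  also have "?s \<cdot>\<^bsub>M\<^esub> (?a \<unrhd>\<^bsub>M\<^esub> ?Z) = LAssoc M (\<phi> X) (\<phi> Y) (\<phi> W \<triangleright>\<^bsub>M\<^esub> Z) \<cdot>\<^bsub>M\<^esub> LAssoc M (\<phi> X \<star>\<^bsub>A\<^esub> \<phi> Y) (\<phi> W) Z"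
    by (simp add: pent)
  also have "(LAssoc M (\<phi> X) (\<phi> Y) (\<phi> W \<triangleright>\<^bsub>M\<^esub> Z) \<cdot>\<^bsub>M\<^esub> LAssoc M (\<phi> X \<star>\<^bsub>A\<^esub> \<phi> Y) (\<phi> W) Z)
        \<cdot>\<^bsub>M\<^esub> ((mult X Y \<ast>\<^bsub>A\<^esub> Ident A (\<phi> W)) \<unrhd>\<^bsub>M\<^esub> ?Z) \<cdot>\<^bsub>M\<^esub> (mult (X \<star>\<^bsub>A\<^esub> Y) W \<unrhd>\<^bsub>M\<^esub> ?Z) \<cdot>\<^bsub>M\<^esub> ?t
      = LAssoc M (\<phi> X) (\<phi> Y) (\<phi> W \<triangleright>\<^bsub>M\<^esub> Z) \<cdot>\<^bsub>M\<^esub> (mult X Y \<unrhd>\<^bsub>M\<^esub> Ident M (\<phi> W \<triangleright>\<^bsub>M\<^esub> Z))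
        \<cdot>\<^bsub>M\<^esub> LAssoc M (\<phi> (X \<star>\<^bsub>A\<^esub> Y)) (\<phi> W) Z \<cdot>\<^bsub>M\<^esub> (mult (X \<star>\<^bsub>A\<^esub> Y) W \<unrhd>\<^bsub>M\<^esub> ?Z) \<cdot>\<^bsub>M\<^esub> ?t"
    by (simp add: M.prefix_cong[OF l1])
  also have "\<dots> = LAssoc M (\<phi> X) (\<phi> Y) (\<phi> W \<triangleright>\<^bsub>M\<^esub> Z) \<cdot>\<^bsub>M\<^esub> (mult X Y \<unrhd>\<^bsub>M\<^esub> Ident M (\<phi> W \<triangleright>\<^bsub>M\<^esub> Z))
      \<cdot>\<^bsub>M\<^esub> (Ident A (\<phi> (X \<star>\<^bsub>A\<^esub> Y)) \<unrhd>\<^bsub>M\<^esub> \<tau> W) \<cdot>\<^bsub>M\<^esub> MAssoc M (\<phi> (X \<star>\<^bsub>A\<^esub> Y)) Z W \<cdot>\<^bsub>M\<^esub> (\<tau> (X \<star>\<^bsub>A\<^esub> Y) \<unlhd>\<^bsub>M\<^esub> ?W) \<cdot>\<^bsub>M\<^esub> (RAssoc M Z X Y \<unlhd>\<^bsub>M\<^esub> ?W)"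
    by (simp only: tmL)
  also have "\<dots> = (?X \<unrhd>\<^bsub>M\<^esub> ?Y \<unrhd>\<^bsub>M\<^esub> \<tau> W) \<cdot>\<^bsub>M\<^esub> LAssoc M (\<phi> X) (\<phi> Y) (Z \<triangleleft>\<^bsub>M\<^esub> W) \<cdot>\<^bsub>M\<^esub> (mult X Y \<unrhd>\<^bsub>M\<^esub> Ident M (Z \<triangleleft>\<^bsub>M\<^esub> W))
      \<cdot>\<^bsub>M\<^esub> MAssoc M (\<phi> (X \<star>\<^bsub>A\<^esub> Y)) Z W \<cdot>\<^bsub>M\<^esub> (\<tau> (X \<star>\<^bsub>A\<^esub> Y) \<unlhd>\<^bsub>M\<^esub> ?W) \<cdot>\<^bsub>M\<^esub> (RAssoc M Z X Y \<unlhd>\<^bsub>M\<^esub> ?W)"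
    by (simp add: M.prefix_cong[OF l2] M.prefix_cong[OF l3] del: left.TA_Ident)
  also have "\<dots> = (?X \<unrhd>\<^bsub>M\<^esub> ?Y \<unrhd>\<^bsub>M\<^esub> \<tau> W) \<cdot>\<^bsub>M\<^esub> (LAssoc M (\<phi> X) (\<phi> Y) (Z \<triangleleft>\<^bsub>M\<^esub> W) \<cdot>\<^bsub>M\<^esub> MAssoc M (\<phi> X \<star>\<^bsub>A\<^esub> \<phi> Y) Z W)
      \<cdot>\<^bsub>M\<^esub> ((mult X Y \<unrhd>\<^bsub>M\<^esub> ?Z) \<unlhd>\<^bsub>M\<^esub> ?W) \<cdot>\<^bsub>M\<^esub> (\<tau> (X \<star>\<^bsub>A\<^esub> Y) \<unlhd>\<^bsub>M\<^esub> ?W) \<cdot>\<^bsub>M\<^esub> (RAssoc M Z X Y \<unlhd>\<^bsub>M\<^esub> ?W)"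
    by (simp add: M.prefix_cong[OF l4])
  also have "\<dots> = (?X \<unrhd>\<^bsub>M\<^esub> ?Y \<unrhd>\<^bsub>M\<^esub> \<tau> W) \<cdot>\<^bsub>M\<^esub> (?X \<unrhd>\<^bsub>M\<^esub> MAssoc M (\<phi> Y) Z W) \<cdot>\<^bsub>M\<^esub> MAssoc M (\<phi> X) (\<phi> Y \<triangleright>\<^bsub>M\<^esub> Z) W
      \<cdot>\<^bsub>M\<^esub> (LAssoc M (\<phi> X) (\<phi> Y) Z \<unlhd>\<^bsub>M\<^esub> ?W) \<cdot>\<^bsub>M\<^esub> ((mult X Y \<unrhd>\<^bsub>M\<^esub> ?Z) \<unlhd>\<^bsub>M\<^esub> ?W) \<cdot>\<^bsub>M\<^esub> (\<tau> (X \<star>\<^bsub>A\<^esub> Y) \<unlhd>\<^bsub>M\<^esub> ?W) \<cdot>\<^bsub>M\<^esub> (RAssoc M Z X Y \<unlhd>\<^bsub>M\<^esub> ?W)"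
    by (simp add: lmid)
  also have "\<dots> = (?X \<unrhd>\<^bsub>M\<^esub> ?Y \<unrhd>\<^bsub>M\<^esub> \<tau> W) \<cdot>\<^bsub>M\<^esub> (?X \<unrhd>\<^bsub>M\<^esub> MAssoc M (\<phi> Y) Z W) \<cdot>\<^bsub>M\<^esub> (?X \<unrhd>\<^bsub>M\<^esub> (\<tau> Y \<unlhd>\<^bsub>M\<^esub> ?W)) \<cdot>\<^bsub>M\<^esub> ?u"
    by (simp add: tmXY M.prefix_cong[OF l5])
  also have "\<dots> = (?X \<unrhd>\<^bsub>M\<^esub> ((?Y \<unrhd>\<^bsub>M\<^esub> \<tau> W) \<cdot>\<^bsub>M\<^esub> MAssoc M (\<phi> Y) Z W \<cdot>\<^bsub>M\<^esub> (\<tau> Y \<unlhd>\<^bsub>M\<^esub> ?W))) \<cdot>\<^bsub>M\<^esub> ?u"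
    by (simp add: left.whisker_left)
  finally have L: "?s \<cdot>\<^bsub>M\<^esub> ((?a \<cdot>\<^bsub>A\<^esub> (mult X Y \<ast>\<^bsub>A\<^esub> Ident A (\<phi> W)) \<cdot>\<^bsub>A\<^esub> mult (X \<star>\<^bsub>A\<^esub> Y) W) \<unrhd>\<^bsub>M\<^esub> ?Z) \<cdot>\<^bsub>M\<^esub> ?t
      = (?X \<unrhd>\<^bsub>M\<^esub> ((?Y \<unrhd>\<^bsub>M\<^esub> \<tau> W) \<cdot>\<^bsub>M\<^esub> MAssoc M (\<phi> Y) Z W \<cdot>\<^bsub>M\<^esub> (\<tau> Y \<unlhd>\<^bsub>M\<^esub> ?W))) \<cdot>\<^bsub>M\<^esub> ?u" .

  have r1: "\<tau> (X \<star>\<^bsub>A\<^esub> Y \<star>\<^bsub>A\<^esub> W) \<cdot>\<^bsub>M\<^esub> (?Z \<unlhd>\<^bsub>M\<^esub> ?a') = (FA \<Phi> ?a' \<unrhd>\<^bsub>M\<^esub> ?Z) \<cdot>\<^bsub>M\<^esub> \<tau> ((X \<star>\<^bsub>A\<^esub> Y) \<star>\<^bsub>A\<^esub> W)"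
    by (rule tau_natural) auto
  have r2: "LAssoc M (\<phi> X) (\<phi> Y \<star>\<^bsub>A\<^esub> \<phi> W) Z \<cdot>\<^bsub>M\<^esub> ((?X \<ast>\<^bsub>A\<^esub> mult Y W) \<unrhd>\<^bsub>M\<^esub> ?Z)
      = (?X \<unrhd>\<^bsub>M\<^esub> mult Y W \<unrhd>\<^bsub>M\<^esub> ?Z) \<cdot>\<^bsub>M\<^esub> LAssoc M (\<phi> X) (\<phi> (Y \<star>\<^bsub>A\<^esub> W)) Z"
    by (subst lassoc_natural) auto
  have r3: "RAssoc M (\<phi> X \<triangleright>\<^bsub>M\<^esub> Z) Y W \<cdot>\<^bsub>M\<^esub> (\<tau> X \<unlhd>\<^bsub>M\<^esub> Ident A Y \<unlhd>\<^bsub>M\<^esub> ?W)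
      = (\<tau> X \<unlhd>\<^bsub>M\<^esub> Ident A (Y \<star>\<^bsub>A\<^esub> W)) \<cdot>\<^bsub>M\<^esub> RAssoc M (Z \<triangleleft>\<^bsub>M\<^esub> X) Y W"
    by (subst rassoc_natural) auto
  have tmR: "LAssoc M (\<phi> X) (\<phi> (Y \<star>\<^bsub>A\<^esub> W)) Z \<cdot>\<^bsub>M\<^esub> (mult X (Y \<star>\<^bsub>A\<^esub> W) \<unrhd>\<^bsub>M\<^esub> ?Z) \<cdot>\<^bsub>M\<^esub> \<tau> (X \<star>\<^bsub>A\<^esub> Y \<star>\<^bsub>A\<^esub> W)
        \<cdot>\<^bsub>M\<^esub> RAssoc M Z X (Y \<star>\<^bsub>A\<^esub> W) \<cdot>\<^bsub>M\<^esub> RAssoc M (Z \<triangleleft>\<^bsub>M\<^esub> X) Y W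
      = (?X \<unrhd>\<^bsub>M\<^esub> \<tau> (Y \<star>\<^bsub>A\<^esub> W)) \<cdot>\<^bsub>M\<^esub> MAssoc M (\<phi> X) Z (Y \<star>\<^bsub>A\<^esub> W) \<cdot>\<^bsub>M\<^esub> (\<tau> X \<unlhd>\<^bsub>M\<^esub> Ident A (Y \<star>\<^bsub>A\<^esub> W)) \<cdot>\<^bsub>M\<^esub> RAssoc M (Z \<triangleleft>\<^bsub>M\<^esub> X) Y W"
  proof -
    have "LAssoc M (\<phi> X) (\<phi> (Y \<star>\<^bsub>A\<^esub> W)) Z \<cdot>\<^bsub>M\<^esub> (mult X (Y \<star>\<^bsub>A\<^esub> W) \<unrhd>\<^bsub>M\<^esub> ?Z) \<cdot>\<^bsub>M\<^esub> \<tau> (X \<star>\<^bsub>A\<^esub> Y \<star>\<^bsub>A\<^esub> W)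
        \<cdot>\<^bsub>M\<^esub> RAssoc M Z X (Y \<star>\<^bsub>A\<^esub> W) \<cdot>\<^bsub>M\<^esub> RAssoc M (Z \<triangleleft>\<^bsub>M\<^esub> X) Y W
      = (LAssoc M (\<phi> X) (\<phi> (Y \<star>\<^bsub>A\<^esub> W)) Z \<cdot>\<^bsub>M\<^esub> (mult X (Y \<star>\<^bsub>A\<^esub> W) \<unrhd>\<^bsub>M\<^esub> ?Z) \<cdot>\<^bsub>M\<^esub> \<tau> (X \<star>\<^bsub>A\<^esub> Y \<star>\<^bsub>A\<^esub> W)
        \<cdot>\<^bsub>M\<^esub> RAssoc M Z X (Y \<star>\<^bsub>A\<^esub> W)) \<cdot>\<^bsub>M\<^esub> RAssoc M (Z \<triangleleft>\<^bsub>M\<^esub> X) Y W"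
      by simp
    then show ?thesis
      by (subst (asm) tau_mult) simp_all
  qed

  have "?s \<cdot>\<^bsub>M\<^esub> (((?X \<ast>\<^bsub>A\<^esub> mult Y W) \<cdot>\<^bsub>A\<^esub> mult X (Y \<star>\<^bsub>A\<^esub> W) \<cdot>\<^bsub>A\<^esub> FA \<Phi> ?a') \<unrhd>\<^bsub>M\<^esub> ?Z) \<cdot>\<^bsub>M\<^esub> ?t
      = ?s \<cdot>\<^bsub>M\<^esub> ((?X \<ast>\<^bsub>A\<^esub> mult Y W) \<unrhd>\<^bsub>M\<^esub> ?Z) \<cdot>\<^bsub>M\<^esub> (mult X (Y \<star>\<^bsub>A\<^esub> W) \<unrhd>\<^bsub>M\<^esub> ?Z) \<cdot>\<^bsub>M\<^esub> (FA \<Phi> ?a' \<unrhd>\<^bsub>M\<^esub> ?Z) \<cdot>\<^bsub>M\<^esub> ?t"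
    by (simp add: left.whisker_right)
  also have "\<dots> = ?s \<cdot>\<^bsub>M\<^esub> ((?X \<ast>\<^bsub>A\<^esub> mult Y W) \<unrhd>\<^bsub>M\<^esub> ?Z) \<cdot>\<^bsub>M\<^esub> (mult X (Y \<star>\<^bsub>A\<^esub> W) \<unrhd>\<^bsub>M\<^esub> ?Z) \<cdot>\<^bsub>M\<^esub> \<tau> (X \<star>\<^bsub>A\<^esub> Y \<star>\<^bsub>A\<^esub> W)
      \<cdot>\<^bsub>M\<^esub> (?Z \<unlhd>\<^bsub>M\<^esub> ?a') \<cdot>\<^bsub>M\<^esub> RAssoc M Z (X \<star>\<^bsub>A\<^esub> Y) W \<cdot>\<^bsub>M\<^esub> (RAssoc M Z X Y \<unlhd>\<^bsub>M\<^esub> ?W)"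
    by (simp add: M.prefix_cong[OF r1])
  also have "\<dots> = (?X \<unrhd>\<^bsub>M\<^esub> LAssoc M (\<phi> Y) (\<phi> W) Z) \<cdot>\<^bsub>M\<^esub> (?X \<unrhd>\<^bsub>M\<^esub> mult Y W \<unrhd>\<^bsub>M\<^esub> ?Z)
      \<cdot>\<^bsub>M\<^esub> LAssoc M (\<phi> X) (\<phi> (Y \<star>\<^bsub>A\<^esub> W)) Z \<cdot>\<^bsub>M\<^esub> (mult X (Y \<star>\<^bsub>A\<^esub> W) \<unrhd>\<^bsub>M\<^esub> ?Z) \<cdot>\<^bsub>M\<^esub> \<tau> (X \<star>\<^bsub>A\<^esub> Y \<star>\<^bsub>A\<^esub> W)
      \<cdot>\<^bsub>M\<^esub> RAssoc M Z X (Y \<star>\<^bsub>A\<^esub> W) \<cdot>\<^bsub>M\<^esub> RAssoc M (Z \<triangleleft>\<^bsub>M\<^esub> X) Y W"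
    by (simp add: rpent M.prefix_cong[OF r2])
  also have "\<dots> = (?X \<unrhd>\<^bsub>M\<^esub> LAssoc M (\<phi> Y) (\<phi> W) Z) \<cdot>\<^bsub>M\<^esub> (?X \<unrhd>\<^bsub>M\<^esub> mult Y W \<unrhd>\<^bsub>M\<^esub> ?Z)
      \<cdot>\<^bsub>M\<^esub> (?X \<unrhd>\<^bsub>M\<^esub> \<tau> (Y \<star>\<^bsub>A\<^esub> W)) \<cdot>\<^bsub>M\<^esub> MAssoc M (\<phi> X) Z (Y \<star>\<^bsub>A\<^esub> W) \<cdot>\<^bsub>M\<^esub> (\<tau> X \<unlhd>\<^bsub>M\<^esub> Ident A (Y \<star>\<^bsub>A\<^esub> W)) \<cdot>\<^bsub>M\<^esub> RAssoc M (Z \<triangleleft>\<^bsub>M\<^esub> X) Y W"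
    by (simp only: tmR)
  also have "\<dots> = (?X \<unrhd>\<^bsub>M\<^esub> LAssoc M (\<phi> Y) (\<phi> W) Z) \<cdot>\<^bsub>M\<^esub> (?X \<unrhd>\<^bsub>M\<^esub> mult Y W \<unrhd>\<^bsub>M\<^esub> ?Z)
      \<cdot>\<^bsub>M\<^esub> (?X \<unrhd>\<^bsub>M\<^esub> \<tau> (Y \<star>\<^bsub>A\<^esub> W)) \<cdot>\<^bsub>M\<^esub> (MAssoc M (\<phi> X) Z (Y \<star>\<^bsub>A\<^esub> W) \<cdot>\<^bsub>M\<^esub> RAssoc M (\<phi> X \<triangleright>\<^bsub>M\<^esub> Z) Y W) \<cdot>\<^bsub>M\<^esub> (\<tau> X \<unlhd>\<^bsub>M\<^esub> Ident A Y \<unlhd>\<^bsub>M\<^esub> ?W)"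
    by (simp add: r3)
  also have "\<dots> = (?X \<unrhd>\<^bsub>M\<^esub> LAssoc M (\<phi> Y) (\<phi> W) Z) \<cdot>\<^bsub>M\<^esub> (?X \<unrhd>\<^bsub>M\<^esub> mult Y W \<unrhd>\<^bsub>M\<^esub> ?Z)
      \<cdot>\<^bsub>M\<^esub> (?X \<unrhd>\<^bsub>M\<^esub> \<tau> (Y \<star>\<^bsub>A\<^esub> W)) \<cdot>\<^bsub>M\<^esub> (?X \<unrhd>\<^bsub>M\<^esub> RAssoc M Z Y W) \<cdot>\<^bsub>M\<^esub> ?u"
    by (simp add: rmid)
  also have "\<dots> = (?X \<unrhd>\<^bsub>M\<^esub> (LAssoc M (\<phi> Y) (\<phi> W) Z \<cdot>\<^bsub>M\<^esub> (mult Y W \<unrhd>\<^bsub>M\<^esub> ?Z) \<cdot>\<^bsub>M\<^esub> \<tau> (Y \<star>\<^bsub>A\<^esub> W) \<cdot>\<^bsub>M\<^esub> RAssoc M Z Y W)) \<cdot>\<^bsub>M\<^esub> ?u"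
    by (simp add: left.whisker_left)
  also have "\<dots> = (?X \<unrhd>\<^bsub>M\<^esub> ((?Y \<unrhd>\<^bsub>M\<^esub> \<tau> W) \<cdot>\<^bsub>M\<^esub> MAssoc M (\<phi> Y) Z W \<cdot>\<^bsub>M\<^esub> (\<tau> Y \<unlhd>\<^bsub>M\<^esub> ?W))) \<cdot>\<^bsub>M\<^esub> ?u"
    by (subst tau_mult) simp_all
  finally have "?s \<cdot>\<^bsub>M\<^esub> ((?a \<cdot>\<^bsub>A\<^esub> (mult X Y \<ast>\<^bsub>A\<^esub> Ident A (\<phi> W)) \<cdot>\<^bsub>A\<^esub> mult (X \<star>\<^bsub>A\<^esub> Y) W) \<unrhd>\<^bsub>M\<^esub> ?Z) \<cdot>\<^bsub>M\<^esub> ?t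
      = ?s \<cdot>\<^bsub>M\<^esub> (((?X \<ast>\<^bsub>A\<^esub> mult Y W) \<cdot>\<^bsub>A\<^esub> mult X (Y \<star>\<^bsub>A\<^esub> W) \<cdot>\<^bsub>A\<^esub> FA \<Phi> ?a') \<unrhd>\<^bsub>M\<^esub> ?Z) \<cdot>\<^bsub>M\<^esub> ?t"
    using L by simp
  then have "((?a \<cdot>\<^bsub>A\<^esub> (mult X Y \<ast>\<^bsub>A\<^esub> Ident A (\<phi> W)) \<cdot>\<^bsub>A\<^esub> mult (X \<star>\<^bsub>A\<^esub> Y) W) \<unrhd>\<^bsub>M\<^esub> ?Z) \<cdot>\<^bsub>M\<^esub> ?t
      = (((?X \<ast>\<^bsub>A\<^esub> mult Y W) \<cdot>\<^bsub>A\<^esub> mult X (Y \<star>\<^bsub>A\<^esub> W) \<cdot>\<^bsub>A\<^esub> FA \<Phi> ?a') \<unrhd>\<^bsub>M\<^esub> ?Z) \<cdot>\<^bsub>M\<^esub> ?t"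
    by (rule M.iso_left_cancel) auto
  then show "(?a \<cdot>\<^bsub>A\<^esub> (mult X Y \<ast>\<^bsub>A\<^esub> Ident A (\<phi> W)) \<cdot>\<^bsub>A\<^esub> mult (X \<star>\<^bsub>A\<^esub> Y) W) \<unrhd>\<^bsub>M\<^esub> ?Z
      = ((?X \<ast>\<^bsub>A\<^esub> mult Y W) \<cdot>\<^bsub>A\<^esub> mult X (Y \<star>\<^bsub>A\<^esub> W) \<cdot>\<^bsub>A\<^esub> FA \<Phi> ?a') \<unrhd>\<^bsub>M\<^esub> ?Z"
    by (rule M.iso_right_cancel) auto
qed (use assms in auto)

text \<open>\<open>lactunit_lact\<close> turns \<open>LUnit\<close> acting on \<open>Z\<close> into
  the unit action, after which \<open>tau_mult\<close> removes \<open>mult\<close> and interchange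
  moves \<open>unit\<close> past \<open>\<tau> X\<close>. Then \<open>lactunit_ract\<close> brings
  it under the right action of \<open>X\<close>, where \<open>tau_unit\<close> and the right
  triangle leave only \<open>LUnit A X\<close>, and naturality of \<open>\<tau>\<close>
  finishes.\<close>

lemma mult_lunit:
  assumes X: "X \<in> Ob A"
  shows "LUnit A (\<phi> X) \<cdot>\<^bsub>A\<^esub> (unit \<ast>\<^bsub>A\<^esub> Ident A (\<phi> X)) \<cdot>\<^bsub>A\<^esub> mult (Unit A) X = FA \<Phi> (LUnit A X)"
proof (rule act_Z_faithful)
  note [simp] = assms
  let ?Z = "Ident M Z" and ?U = "Unit A" and ?I = "Ident A (Unit A)"
  let ?t = "\<tau> (?U \<star>\<^bsub>A\<^esub> X) \<cdot>\<^bsub>M\<^esub> RAssoc M Z ?U X"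
  have n1: "LAssoc M ?U (\<phi> X) Z \<cdot>\<^bsub>M\<^esub> ((unit \<ast>\<^bsub>A\<^esub> Ident A (\<phi> X)) \<unrhd>\<^bsub>M\<^esub> ?Z)
      = (unit \<unrhd>\<^bsub>M\<^esub> Ident M (\<phi> X \<triangleright>\<^bsub>M\<^esub> Z)) \<cdot>\<^bsub>M\<^esub> LAssoc M (\<phi> ?U) (\<phi> X) Z"
    by (subst lassoc_natural) auto
  have n2: "(unit \<unrhd>\<^bsub>M\<^esub> Ident M (\<phi> X \<triangleright>\<^bsub>M\<^esub> Z)) \<cdot>\<^bsub>M\<^esub> (Ident A (\<phi> ?U) \<unrhd>\<^bsub>M\<^esub> \<tau> X)
      = (?I \<unrhd>\<^bsub>M\<^esub> \<tau> X) \<cdot>\<^bsub>M\<^esub> (unit \<unrhd>\<^bsub>M\<^esub> Ident M (Z \<triangleleft>\<^bsub>M\<^esub> X))"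
    by (rule left.interchange) auto
  have n3: "LActUnit M (\<phi> X \<triangleright>\<^bsub>M\<^esub> Z) \<cdot>\<^bsub>M\<^esub> (?I \<unrhd>\<^bsub>M\<^esub> \<tau> X) = \<tau> X \<cdot>\<^bsub>M\<^esub> LActUnit M (Z \<triangleleft>\<^bsub>M\<^esub> X)"
    by (rule lactunit_natural) auto
  have n4: "MAssoc M ?U Z X \<cdot>\<^bsub>M\<^esub> ((unit \<unrhd>\<^bsub>M\<^esub> ?Z) \<unlhd>\<^bsub>M\<^esub> Ident A X)
      = (unit \<unrhd>\<^bsub>M\<^esub> Ident M (Z \<triangleleft>\<^bsub>M\<^esub> X)) \<cdot>\<^bsub>M\<^esub> MAssoc M (\<phi> ?U) Z X"
    by (subst massoc_natural) auto
  have n5: "\<tau> X \<cdot>\<^bsub>M\<^esub> (?Z \<unlhd>\<^bsub>M\<^esub> LUnit A X) = (FA \<Phi> (LUnit A X) \<unrhd>\<^bsub>M\<^esub> ?Z) \<cdot>\<^bsub>M\<^esub> \<tau> (?U \<star>\<^bsub>A\<^esub> X)"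
    by (rule tau_natural) auto
  note k = lactunit_lact[OF Phi.fun_ob[OF X] Z_Ob] and k' = lactunit_ract[OF Z_Ob X]
  have "((LUnit A (\<phi> X) \<cdot>\<^bsub>A\<^esub> (unit \<ast>\<^bsub>A\<^esub> Ident A (\<phi> X)) \<cdot>\<^bsub>A\<^esub> mult ?U X) \<unrhd>\<^bsub>M\<^esub> ?Z) \<cdot>\<^bsub>M\<^esub> ?t
      = (LUnit A (\<phi> X) \<unrhd>\<^bsub>M\<^esub> ?Z) \<cdot>\<^bsub>M\<^esub> ((unit \<ast>\<^bsub>A\<^esub> Ident A (\<phi> X)) \<unrhd>\<^bsub>M\<^esub> ?Z) \<cdot>\<^bsub>M\<^esub> (mult ?U X \<unrhd>\<^bsub>M\<^esub> ?Z) \<cdot>\<^bsub>M\<^esub> ?t"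
    by (simp add: left.whisker_right)
  also have "\<dots> = LActUnit M (\<phi> X \<triangleright>\<^bsub>M\<^esub> Z) \<cdot>\<^bsub>M\<^esub> LAssoc M ?U (\<phi> X) Z \<cdot>\<^bsub>M\<^esub> ((unit \<ast>\<^bsub>A\<^esub> Ident A (\<phi> X)) \<unrhd>\<^bsub>M\<^esub> ?Z)
      \<cdot>\<^bsub>M\<^esub> (mult ?U X \<unrhd>\<^bsub>M\<^esub> ?Z) \<cdot>\<^bsub>M\<^esub> ?t"
    by (simp flip: k)
  also have "\<dots> = LActUnit M (\<phi> X \<triangleright>\<^bsub>M\<^esub> Z) \<cdot>\<^bsub>M\<^esub> (unit \<unrhd>\<^bsub>M\<^esub> Ident M (\<phi> X \<triangleright>\<^bsub>M\<^esub> Z))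
      \<cdot>\<^bsub>M\<^esub> LAssoc M (\<phi> ?U) (\<phi> X) Z \<cdot>\<^bsub>M\<^esub> (mult ?U X \<unrhd>\<^bsub>M\<^esub> ?Z) \<cdot>\<^bsub>M\<^esub> ?t"
    by (simp add: M.prefix_cong[OF n1])
  also have "\<dots> = LActUnit M (\<phi> X \<triangleright>\<^bsub>M\<^esub> Z) \<cdot>\<^bsub>M\<^esub> (unit \<unrhd>\<^bsub>M\<^esub> Ident M (\<phi> X \<triangleright>\<^bsub>M\<^esub> Z))
      \<cdot>\<^bsub>M\<^esub> (Ident A (\<phi> ?U) \<unrhd>\<^bsub>M\<^esub> \<tau> X) \<cdot>\<^bsub>M\<^esub> MAssoc M (\<phi> ?U) Z X \<cdot>\<^bsub>M\<^esub> (\<tau> ?U \<unlhd>\<^bsub>M\<^esub> Ident A X)"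
    by (simp add: tau_mult)
  also have "\<dots> = \<tau> X \<cdot>\<^bsub>M\<^esub> LActUnit M (Z \<triangleleft>\<^bsub>M\<^esub> X) \<cdot>\<^bsub>M\<^esub> (unit \<unrhd>\<^bsub>M\<^esub> Ident M (Z \<triangleleft>\<^bsub>M\<^esub> X))
      \<cdot>\<^bsub>M\<^esub> MAssoc M (\<phi> ?U) Z X \<cdot>\<^bsub>M\<^esub> (\<tau> ?U \<unlhd>\<^bsub>M\<^esub> Ident A X)"
    by (simp add: M.prefix_cong[OF n2] M.prefix_cong[OF n3])
  also have "\<dots> = \<tau> X \<cdot>\<^bsub>M\<^esub> (LActUnit M (Z \<triangleleft>\<^bsub>M\<^esub> X) \<cdot>\<^bsub>M\<^esub> MAssoc M ?U Z X) \<cdot>\<^bsub>M\<^esub> ((unit \<unrhd>\<^bsub>M\<^esub> ?Z) \<unlhd>\<^bsub>M\<^esub> Ident A X)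
      \<cdot>\<^bsub>M\<^esub> (\<tau> ?U \<unlhd>\<^bsub>M\<^esub> Ident A X)"
    by (simp add: M.prefix_cong[OF n4])
  also have "\<dots> = \<tau> X \<cdot>\<^bsub>M\<^esub> ((LActUnit M Z \<cdot>\<^bsub>M\<^esub> (unit \<unrhd>\<^bsub>M\<^esub> ?Z) \<cdot>\<^bsub>M\<^esub> \<tau> ?U) \<unlhd>\<^bsub>M\<^esub> Ident A X)"
    by (subst k') (simp add: right.whisker_right)
  also have "\<dots> = \<tau> X \<cdot>\<^bsub>M\<^esub> (?Z \<unlhd>\<^bsub>M\<^esub> LUnit A X) \<cdot>\<^bsub>M\<^esub> RAssoc M Z ?U X"
    by (simp add: tau_unit right_triangle)
  also have "\<dots> = (FA \<Phi> (LUnit A X) \<unrhd>\<^bsub>M\<^esub> ?Z) \<cdot>\<^bsub>M\<^esub> ?t"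
    by (simp add: M.prefix_cong[OF n5])
  finally show "(LUnit A (\<phi> X) \<cdot>\<^bsub>A\<^esub> (unit \<ast>\<^bsub>A\<^esub> Ident A (\<phi> X)) \<cdot>\<^bsub>A\<^esub> mult ?U X) \<unrhd>\<^bsub>M\<^esub> ?Z = FA \<Phi> (LUnit A X) \<unrhd>\<^bsub>M\<^esub> ?Z"
    by (rule M.iso_right_cancel) auto
qed (use assms in auto)

text \<open>Here the left triangle already converts \<open>RUnit\<close>, and \<open>unit\<close>
  meets \<open>\<tau> (Unit A)\<close> inside the left action of \<open>\<phi> X\<close>. The
  derived coherences \<open>ractunit_lact\<close> and \<open>ractunit_ract\<close> carry the
  resulting right unit action across \<open>\<tau> X\<close>.\<close>

lemma mult_runit:
  assumes X: "X \<in> Ob A"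
  shows "RUnit A (\<phi> X) \<cdot>\<^bsub>A\<^esub> (Ident A (\<phi> X) \<ast>\<^bsub>A\<^esub> unit) \<cdot>\<^bsub>A\<^esub> mult X (Unit A) = FA \<Phi> (RUnit A X)"
proof (rule act_Z_faithful)
  note [simp] = assms
  let ?Z = "Ident M Z" and ?U = "Unit A" and ?I = "Ident A (Unit A)" and ?X = "Ident A (\<phi> X)"
  let ?t = "\<tau> (X \<star>\<^bsub>A\<^esub> ?U) \<cdot>\<^bsub>M\<^esub> RAssoc M Z X ?U"
  have n1: "LAssoc M (\<phi> X) ?U Z \<cdot>\<^bsub>M\<^esub> ((?X \<ast>\<^bsub>A\<^esub> unit) \<unrhd>\<^bsub>M\<^esub> ?Z)
      = (?X \<unrhd>\<^bsub>M\<^esub> unit \<unrhd>\<^bsub>M\<^esub> ?Z) \<cdot>\<^bsub>M\<^esub> LAssoc M (\<phi> X) (\<phi> ?U) Z"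
    by (subst lassoc_natural) auto
  have n2: "RActUnit M (\<phi> X \<triangleright>\<^bsub>M\<^esub> Z) \<cdot>\<^bsub>M\<^esub> (\<tau> X \<unlhd>\<^bsub>M\<^esub> ?I) = \<tau> X \<cdot>\<^bsub>M\<^esub> RActUnit M (Z \<triangleleft>\<^bsub>M\<^esub> X)"
    by (rule ractunit_natural) auto
  have n3: "\<tau> X \<cdot>\<^bsub>M\<^esub> (?Z \<unlhd>\<^bsub>M\<^esub> RUnit A X) = (FA \<Phi> (RUnit A X) \<unrhd>\<^bsub>M\<^esub> ?Z) \<cdot>\<^bsub>M\<^esub> \<tau> (X \<star>\<^bsub>A\<^esub> ?U)"
    by (rule tau_natural) auto
  note k = ractunit_lact[OF Phi.fun_ob[OF X] Z_Ob] and k' = ractunit_ract[OF Z_Ob X]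
  have "((RUnit A (\<phi> X) \<cdot>\<^bsub>A\<^esub> (?X \<ast>\<^bsub>A\<^esub> unit) \<cdot>\<^bsub>A\<^esub> mult X ?U) \<unrhd>\<^bsub>M\<^esub> ?Z) \<cdot>\<^bsub>M\<^esub> ?t
      = (RUnit A (\<phi> X) \<unrhd>\<^bsub>M\<^esub> ?Z) \<cdot>\<^bsub>M\<^esub> ((?X \<ast>\<^bsub>A\<^esub> unit) \<unrhd>\<^bsub>M\<^esub> ?Z) \<cdot>\<^bsub>M\<^esub> (mult X ?U \<unrhd>\<^bsub>M\<^esub> ?Z) \<cdot>\<^bsub>M\<^esub> ?t"
    by (simp add: left.whisker_right)
  also have "\<dots> = (?X \<unrhd>\<^bsub>M\<^esub> LActUnit M Z) \<cdot>\<^bsub>M\<^esub> LAssoc M (\<phi> X) ?U Z \<cdot>\<^bsub>M\<^esub> ((?X \<ast>\<^bsub>A\<^esub> unit) \<unrhd>\<^bsub>M\<^esub> ?Z) \<cdot>\<^bsub>M\<^esub> (mult X ?U \<unrhd>\<^bsub>M\<^esub> ?Z) \<cdot>\<^bsub>M\<^esub> ?t"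
    by (simp flip: left_triangle)
  also have "\<dots> = (?X \<unrhd>\<^bsub>M\<^esub> LActUnit M Z) \<cdot>\<^bsub>M\<^esub> (?X \<unrhd>\<^bsub>M\<^esub> unit \<unrhd>\<^bsub>M\<^esub> ?Z) \<cdot>\<^bsub>M\<^esub> LAssoc M (\<phi> X) (\<phi> ?U) Z \<cdot>\<^bsub>M\<^esub> (mult X ?U \<unrhd>\<^bsub>M\<^esub> ?Z) \<cdot>\<^bsub>M\<^esub> ?t"
    by (simp add: M.prefix_cong[OF n1])
  also have "\<dots> = (?X \<unrhd>\<^bsub>M\<^esub> (LActUnit M Z \<cdot>\<^bsub>M\<^esub> (unit \<unrhd>\<^bsub>M\<^esub> ?Z) \<cdot>\<^bsub>M\<^esub> \<tau> ?U)) \<cdot>\<^bsub>M\<^esub> MAssoc M (\<phi> X) Z ?U \<cdot>\<^bsub>M\<^esub> (\<tau> X \<unlhd>\<^bsub>M\<^esub> ?I)"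
    by (simp add: tau_mult left.whisker_left)
  also have "\<dots> = \<tau> X \<cdot>\<^bsub>M\<^esub> (?Z \<unlhd>\<^bsub>M\<^esub> RUnit A X) \<cdot>\<^bsub>M\<^esub> RAssoc M Z X ?U"
    by (simp add: tau_unit M.prefix_cong[OF k] n2 k')
  also have "\<dots> = (FA \<Phi> (RUnit A X) \<unrhd>\<^bsub>M\<^esub> ?Z) \<cdot>\<^bsub>M\<^esub> ?t"
    by (simp add: M.prefix_cong[OF n3])
  finally show "(RUnit A (\<phi> X) \<cdot>\<^bsub>A\<^esub> (?X \<ast>\<^bsub>A\<^esub> unit) \<cdot>\<^bsub>A\<^esub> mult X ?U) \<unrhd>\<^bsub>M\<^esub> ?Z = FA \<Phi> (RUnit A X) \<unrhd>\<^bsub>M\<^esub> ?Z"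
    by (rule M.iso_right_cancel) auto
qed (use assms in auto)

definition transported :: "('a, 'f, 'a, 'f) mon_fctr" where
  "transported = \<lparr>FO = FO \<Phi>, FA = FA \<Phi>, FMult = mult, FUnit = unit\<rparr>"

lemma transported_simps [simp]:
  "FO transported = FO \<Phi>" "FA transported = FA \<Phi>" "FMult transported = mult" "FUnit transported = unit"
  by (simp_all add: transported_def)

lemma monoidal_functor_transported: "monoidal_functor K A A transported"
proof unfold_locales
  show "iso_arr A (FO transported (Unit A)) (Unit A) (FUnit transported)"
    by (simp add: A.C.iso_arr_iff)
qed (auto simp: A.C.iso_arr_iff Phi.fun_arr Phi.fun_cmp Phi.fun_add Phi.fun_smult A.C.arr_iff
  mult_assoc mult_lunit mult_runit intro: mult_natural)

text \<open>The functor \<open>R_fun\<close> of the twisted category is \<open>R_fun M Z\<close>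
  composed with \<open>\<Phi>\<close>, so naturality is the locale assumption, and the remaining
  clause is \<open>tau_mult\<close>.\<close>

lemma tau_centralizes: "(Z, \<tau>) \<in> centralizer_objects A (twist transported M)"
  using tau_nat_iso by (auto simp: centralizer_objects_def twist_def tau_mult L_fun_def R_fun_def nat_iso_def
   fun_comp_def iso_arr_def)

end

section \<open>The homotopy category\<close>

context linear_category
begin

lemma add_simps [simp]:
  assumes "arrow C f" "arrow C g" "Dom C f = X" "Cod C f = Y" "Dom C g = X" "Cod C g = Y"
  shows "arrow C (f \<oplus>\<^bsub>Hom C X Y\<^esub> g)" "Dom C (f \<oplus>\<^bsub>Hom C X Y\<^esub> g) = X" "Cod C (f \<oplus>\<^bsub>Hom C X Y\<^esub> g) = Y"
proof -
  have XY: "X \<in> Ob C" "Y \<in> Ob C"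
    using assms by auto
  interpret module K "Hom C X Y" by (rule hom_module) fact+
  have "f \<oplus>\<^bsub>Hom C X Y\<^esub> g \<in> arr C X Y"
    using assms by (intro M.a_closed) (auto simp: arr_iff)
  from arrowI[OF XY this] show "arrow C (f \<oplus>\<^bsub>Hom C X Y\<^esub> g)" "Dom C (f \<oplus>\<^bsub>Hom C X Y\<^esub> g) = X" "Cod C (f \<oplus>\<^bsub>Hom C X Y\<^esub> g) = Y" .
qed

lemma smult_simps [simp]:
  assumes "a \<in> carrier K" "arrow C f" "Dom C f = X" "Cod C f = Y"
  shows "arrow C (a \<odot>\<^bsub>Hom C X Y\<^esub> f)" "Dom C (a \<odot>\<^bsub>Hom C X Y\<^esub> f) = X" "Cod C (a \<odot>\<^bsub>Hom C X Y\<^esub> f) = Y"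
proof -
  have XY: "X \<in> Ob C" "Y \<in> Ob C"
    using assms by auto
  interpret module K "Hom C X Y" by (rule hom_module) fact+
  have "a \<odot>\<^bsub>Hom C X Y\<^esub> f \<in> arr C X Y"
    using assms by (intro smult_closed) (auto simp: arr_iff)
  from arrowI[OF XY this] show "arrow C (a \<odot>\<^bsub>Hom C X Y\<^esub> f)" "Dom C (a \<odot>\<^bsub>Hom C X Y\<^esub> f) = X" "Cod C (a \<odot>\<^bsub>Hom C X Y\<^esub> f) = Y" .
qed

lemma zero_simps [simp]:
  assumes "X \<in> Ob C" "Y \<in> Ob C"
  shows "arrow C \<zero>\<^bsub>Hom C X Y\<^esub>" "Dom C \<zero>\<^bsub>Hom C X Y\<^esub> = X" "Cod C \<zero>\<^bsub>Hom C X Y\<^esub> = Y"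
proof -
  interpret module K "Hom C X Y" by (rule hom_module) fact+
  show "arrow C \<zero>\<^bsub>Hom C X Y\<^esub>" "Dom C \<zero>\<^bsub>Hom C X Y\<^esub> = X" "Cod C \<zero>\<^bsub>Hom C X Y\<^esub> = Y"
    using arrowI[OF assms M.zero_closed] .
qed

lemma add_zero [simp]:
  assumes "arrow C f" "Dom C f = X" "Cod C f = Y"
  shows "f \<oplus>\<^bsub>Hom C X Y\<^esub> \<zero>\<^bsub>Hom C X Y\<^esub> = f" "\<zero>\<^bsub>Hom C X Y\<^esub> \<oplus>\<^bsub>Hom C X Y\<^esub> f = f"
proof -
  have "X \<in> Ob C" "Y \<in> Ob C"
    using assms by auto
  then interpret module K "Hom C X Y" by (rule hom_module)
  have "f \<in> arr C X Y"
    using assms by (auto simp: arr_iff)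
  then show "f \<oplus>\<^bsub>Hom C X Y\<^esub> \<zero>\<^bsub>Hom C X Y\<^esub> = f" "\<zero>\<^bsub>Hom C X Y\<^esub> \<oplus>\<^bsub>Hom C X Y\<^esub> f = f"
    by simp_all
qed

text \<open>Commutativity, associativity and left commutativity together form a set for ordered
  rewriting of sums within one hom-module.\<close>

lemma add_ac:
  assumes "arrow C f" "arrow C g" "Dom C f = X" "Cod C f = Y" "Dom C g = X" "Cod C g = Y"
  shows "f \<oplus>\<^bsub>Hom C X Y\<^esub> g = g \<oplus>\<^bsub>Hom C X Y\<^esub> f"
    "arrow C h \<Longrightarrow> Dom C h = X \<Longrightarrow> Cod C h = Y \<Longrightarrow>
      (f \<oplus>\<^bsub>Hom C X Y\<^esub> g) \<oplus>\<^bsub>Hom C X Y\<^esub> h = f \<oplus>\<^bsub>Hom C X Y\<^esub> (g \<oplus>\<^bsub>Hom C X Y\<^esub> h)"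
    "arrow C h \<Longrightarrow> Dom C h = X \<Longrightarrow> Cod C h = Y \<Longrightarrow>
      f \<oplus>\<^bsub>Hom C X Y\<^esub> (g \<oplus>\<^bsub>Hom C X Y\<^esub> h) = g \<oplus>\<^bsub>Hom C X Y\<^esub> (f \<oplus>\<^bsub>Hom C X Y\<^esub> h)"
proof -
  have "X \<in> Ob C" "Y \<in> Ob C"
    using assms by auto
  then interpret module K "Hom C X Y" by (rule hom_module)
  have fg: "f \<in> arr C X Y" "g \<in> arr C X Y"
    using assms by (auto simp: arr_iff)
  show "f \<oplus>\<^bsub>Hom C X Y\<^esub> g = g \<oplus>\<^bsub>Hom C X Y\<^esub> f"
    using fg by (rule M.a_comm)
  assume "arrow C h" "Dom C h = X" "Cod C h = Y"
  then have h: "h \<in> arr C X Y"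
    by (auto simp: arr_iff)
  show "(f \<oplus>\<^bsub>Hom C X Y\<^esub> g) \<oplus>\<^bsub>Hom C X Y\<^esub> h = f \<oplus>\<^bsub>Hom C X Y\<^esub> (g \<oplus>\<^bsub>Hom C X Y\<^esub> h)"
    using fg h by (rule M.a_assoc)
  show "f \<oplus>\<^bsub>Hom C X Y\<^esub> (g \<oplus>\<^bsub>Hom C X Y\<^esub> h) = g \<oplus>\<^bsub>Hom C X Y\<^esub> (f \<oplus>\<^bsub>Hom C X Y\<^esub> h)"
    using fg h by (rule M.a_lcomm)
qed

lemma smult_distrib:
  assumes "a \<in> carrier K" "arrow C f" "Dom C f = X" "Cod C f = Y"
  shows "arrow C g \<Longrightarrow> Dom C g = X \<Longrightarrow> Cod C g = Y \<Longrightarrow>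
      a \<odot>\<^bsub>Hom C X Y\<^esub> (f \<oplus>\<^bsub>Hom C X Y\<^esub> g) = (a \<odot>\<^bsub>Hom C X Y\<^esub> f) \<oplus>\<^bsub>Hom C X Y\<^esub> (a \<odot>\<^bsub>Hom C X Y\<^esub> g)"
    "b \<in> carrier K \<Longrightarrow> (a \<oplus>\<^bsub>K\<^esub> b) \<odot>\<^bsub>Hom C X Y\<^esub> f = (a \<odot>\<^bsub>Hom C X Y\<^esub> f) \<oplus>\<^bsub>Hom C X Y\<^esub> (b \<odot>\<^bsub>Hom C X Y\<^esub> f)"
    "b \<in> carrier K \<Longrightarrow> (a \<otimes>\<^bsub>K\<^esub> b) \<odot>\<^bsub>Hom C X Y\<^esub> f = a \<odot>\<^bsub>Hom C X Y\<^esub> (b \<odot>\<^bsub>Hom C X Y\<^esub> f)"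
proof -
  have "X \<in> Ob C" "Y \<in> Ob C"
    using assms by auto
  then interpret module K "Hom C X Y" by (rule hom_module)
  have f: "f \<in> arr C X Y"
    using assms by (auto simp: arr_iff)
  show "(a \<oplus>\<^bsub>K\<^esub> b) \<odot>\<^bsub>Hom C X Y\<^esub> f = (a \<odot>\<^bsub>Hom C X Y\<^esub> f) \<oplus>\<^bsub>Hom C X Y\<^esub> (b \<odot>\<^bsub>Hom C X Y\<^esub> f)"
    "(a \<otimes>\<^bsub>K\<^esub> b) \<odot>\<^bsub>Hom C X Y\<^esub> f = a \<odot>\<^bsub>Hom C X Y\<^esub> (b \<odot>\<^bsub>Hom C X Y\<^esub> f)" if "b \<in> carrier K"
    using that assms f by (simp_all add: smult_l_distr smult_assoc1)
  assume "arrow C g" "Dom C g = X" "Cod C g = Y"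
  then show "a \<odot>\<^bsub>Hom C X Y\<^esub> (f \<oplus>\<^bsub>Hom C X Y\<^esub> g) = (a \<odot>\<^bsub>Hom C X Y\<^esub> f) \<oplus>\<^bsub>Hom C X Y\<^esub> (a \<odot>\<^bsub>Hom C X Y\<^esub> g)"
    using f assms(1) by (intro smult_r_distr) (auto simp: arr_iff)
qed

text \<open>The second equation expresses negation as the scalar minus one. Negatives of homotopies
  and of chain maps thereby become cases of the rules for scalar multiples.\<close>

lemma smult_one:
  assumes "arrow C f" "Dom C f = X" "Cod C f = Y"
  shows "\<one>\<^bsub>K\<^esub> \<odot>\<^bsub>Hom C X Y\<^esub> f = f"
    "f \<oplus>\<^bsub>Hom C X Y\<^esub> ((\<ominus>\<^bsub>K\<^esub> \<one>\<^bsub>K\<^esub>) \<odot>\<^bsub>Hom C X Y\<^esub> f) = \<zero>\<^bsub>Hom C X Y\<^esub>"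
proof -
  have "X \<in> Ob C" "Y \<in> Ob C"
    using assms by auto
  then interpret module K "Hom C X Y" by (rule hom_module)
  have f: "f \<in> arr C X Y"
    using assms by (auto simp: arr_iff)
  show "\<one>\<^bsub>K\<^esub> \<odot>\<^bsub>Hom C X Y\<^esub> f = f"
    using f by (rule smult_one)
  show "f \<oplus>\<^bsub>Hom C X Y\<^esub> ((\<ominus>\<^bsub>K\<^esub> \<one>\<^bsub>K\<^esub>) \<odot>\<^bsub>Hom C X Y\<^esub> f) = \<zero>\<^bsub>Hom C X Y\<^esub>"
    using f by (simp add: smult_l_minus M.r_neg)
qed

lemma minus_one: "\<ominus>\<^bsub>K\<^esub> \<one>\<^bsub>K\<^esub> \<in> carrier K"
  using base_ring by (simp add: cring_def ring.ring_simprules)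

lemma cmp_add:
  assumes "arrow C f" "arrow C g" "arrow C g'" "Dom C g = Y" "Dom C g' = Y" "Cod C g = Z" "Cod C g' = Z"
  shows "Cod C f = Y \<Longrightarrow> (g \<oplus>\<^bsub>Hom C Y Z\<^esub> g') \<cdot>\<^bsub>C\<^esub> f = (g \<cdot>\<^bsub>C\<^esub> f) \<oplus>\<^bsub>Hom C (Dom C f) Z\<^esub> (g' \<cdot>\<^bsub>C\<^esub> f)"
    "Dom C f = Z \<Longrightarrow> f \<cdot>\<^bsub>C\<^esub> (g \<oplus>\<^bsub>Hom C Y Z\<^esub> g') = (f \<cdot>\<^bsub>C\<^esub> g) \<oplus>\<^bsub>Hom C Y (Cod C f)\<^esub> (f \<cdot>\<^bsub>C\<^esub> g')"
  using assms cmp_add_left[of "Dom C f" Y Z f g g'] cmp_add_right[of Y Z "Cod C f" g g' f]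
  by (auto simp: arr_iff)

lemma cmp_smult:
  assumes "a \<in> carrier K" "arrow C f" "arrow C g" "Dom C g = Y" "Cod C g = Z"
  shows "Cod C f = Y \<Longrightarrow> (a \<odot>\<^bsub>Hom C Y Z\<^esub> g) \<cdot>\<^bsub>C\<^esub> f = a \<odot>\<^bsub>Hom C (Dom C f) Z\<^esub> (g \<cdot>\<^bsub>C\<^esub> f)"
    "Dom C f = Z \<Longrightarrow> f \<cdot>\<^bsub>C\<^esub> (a \<odot>\<^bsub>Hom C Y Z\<^esub> g) = a \<odot>\<^bsub>Hom C Y (Cod C f)\<^esub> (f \<cdot>\<^bsub>C\<^esub> g)"
  using assms cmp_smult_left[of "Dom C f" Y Z a f g] cmp_smult_right[of Y Z "Cod C f" a g f]
  by (auto simp: arr_iff)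

text \<open>Every additive map sends zero to an arrow that equals its own double; this identifies
  the image as zero, for composition with a fixed arrow and for linear functors alike.\<close>

lemma add_idem_zero:
  assumes "f \<oplus>\<^bsub>Hom C X Y\<^esub> f = f" "arrow C f" "Dom C f = X" "Cod C f = Y"
  shows "f = \<zero>\<^bsub>Hom C X Y\<^esub>"
proof -
  have "X \<in> Ob C" "Y \<in> Ob C"
    using assms by auto
  then interpret module K "Hom C X Y" by (rule hom_module)
  have "f \<in> arr C X Y"
    using assms by (auto simp: arr_iff)
  then show ?thesis
    using assms(1) by (metis M.add.l_cancel_one')
qed

lemma cmp_zero [simp]:
  assumes "arrow C f" "Y \<in> Ob C"
  shows "X = Cod C f \<Longrightarrow> \<zero>\<^bsub>Hom C X Y\<^esub> \<cdot>\<^bsub>C\<^esub> f = \<zero>\<^bsub>Hom C (Dom C f) Y\<^esub>"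
    "X = Dom C f \<Longrightarrow> f \<cdot>\<^bsub>C\<^esub> \<zero>\<^bsub>Hom C Y X\<^esub> = \<zero>\<^bsub>Hom C Y (Cod C f)\<^esub>"
  using assms cmp_add(1)[of f "\<zero>\<^bsub>Hom C (Cod C f) Y\<^esub>" "\<zero>\<^bsub>Hom C (Cod C f) Y\<^esub>" "Cod C f" Y]
    cmp_add(2)[of f "\<zero>\<^bsub>Hom C Y (Dom C f)\<^esub>" "\<zero>\<^bsub>Hom C Y (Dom C f)\<^esub>" Y "Dom C f"]
  by (auto intro!: add_idem_zero)

text \<open>If the identity is zero, any arrow into or out of the object equals its composite with
  zero. As an equation the property is preserved by linear functors, which is how boundedness
  survives an action.\<close>

lemma zero_object_iff:
  assumes "N \<in> Ob C"
  shows "zero_object C N \<longleftrightarrow> Ident C N = \<zero>\<^bsub>Hom C N N\<^esub>"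
proof
  assume "zero_object C N"
  then have "\<exists>!f. f \<in> arr C N N"
    using assms by (auto simp: zero_object_def)
  then show "Ident C N = \<zero>\<^bsub>Hom C N N\<^esub>"
    using assms by (metis Ident_simps zero_simps arr_iff)
next
  assume I: "Ident C N = \<zero>\<^bsub>Hom C N N\<^esub>"
  have 1: "f = \<zero>\<^bsub>Hom C N X\<^esub>" if "arrow C f" "Dom C f = N" "Cod C f = X" for f X
    using cmp_Ident(2)[of f N] that assms unfolding I by auto
  have 2: "f = \<zero>\<^bsub>Hom C X N\<^esub>" if "arrow C f" "Dom C f = X" "Cod C f = N" for f X
    using cmp_Ident(1)[of f N] that assms unfolding I by auto
  have "\<exists>!f. f \<in> arr C N X" if "X \<in> Ob C" for X
    by (rule ex1I[of _ "\<zero>\<^bsub>Hom C N X\<^esub>"]) (use that assms 1 in \<open>auto simp: arr_iff\<close>)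
  moreover have "\<exists>!f. f \<in> arr C X N" if "X \<in> Ob C" for X
    by (rule ex1I[of _ "\<zero>\<^bsub>Hom C X N\<^esub>"]) (use that assms 2 in \<open>auto simp: arr_iff\<close>)
  ultimately show "zero_object C N"
    using assms by (auto simp: zero_object_def)
qed

end

lemma (in linear_functor) FA_zero [simp]:
  assumes "X \<in> Ob C" "Y \<in> Ob C"
  shows "FA F \<zero>\<^bsub>Hom C X Y\<^esub> = \<zero>\<^bsub>Hom D (FO F X) (FO F Y)\<^esub>"
  using assms fun_add[of X Y "\<zero>\<^bsub>Hom C X Y\<^esub>" "\<zero>\<^bsub>Hom C X Y\<^esub>"]
  by (intro D.add_idem_zero) (auto simp: C.arr_iff)

lemma (in linear_functor) FO_zero_object:
  assumes "zero_object C N"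
  shows "zero_object D (FO F N)"
proof -
  have N: "N \<in> Ob C"
    using assms by (simp add: zero_object_def)
  then have "FA F (Ident C N) = FA F \<zero>\<^bsub>Hom C N N\<^esub>"
    using assms by (simp add: C.zero_object_iff)
  then show ?thesis
    using N by (simp add: D.zero_object_iff)
qed

section \<open>Chain maps and homotopies\<close>

context linear_category
begin

lemma complex_simps [simp]:
  assumes "X \<in> bounded_complexes C"
  shows "Term X i \<in> Ob C" "arrow C (Diff X i)" "Dom C (Diff X i) = Term X i"
    "Cod C (Diff X i) = Term X (i + 1)"
    "Diff X (i + 1) \<cdot>\<^bsub>C\<^esub> Diff X i = \<zero>\<^bsub>Hom C (Term X i) (Term X (i + 2))\<^esub>"
  using assms arrowI[of "Term X i" "Term X (i + 1)" "Diff X i"] by (auto simp: bounded_complexes_def)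

lemma chain_mapsD:
  assumes "f \<in> chain_maps C X Y" "X \<in> bounded_complexes C" "Y \<in> bounded_complexes C"
  shows "arrow C (f i)" "Dom C (f i) = Term X i" "Cod C (f i) = Term Y i"
    "f (i + 1) \<cdot>\<^bsub>C\<^esub> Diff X i = Diff Y i \<cdot>\<^bsub>C\<^esub> f i"
  using assms arrowI[of "Term X i" "Term Y i" "f i"] by (auto simp: chain_maps_def)

lemma chain_mapsI:
  assumes "X \<in> bounded_complexes C" "Y \<in> bounded_complexes C"
    "\<And>i. arrow C (f i)" "\<And>i. Dom C (f i) = Term X i" "\<And>i. Cod C (f i) = Term Y i"
    "\<And>i. f (i + 1) \<cdot>\<^bsub>C\<^esub> Diff X i = Diff Y i \<cdot>\<^bsub>C\<^esub> f i"
  shows "f \<in> chain_maps C X Y"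
  using assms by (auto simp: chain_maps_def arr_iff)

lemma chain_ident: "X \<in> bounded_complexes C \<Longrightarrow> (\<lambda>i. Ident C (Term X i)) \<in> chain_maps C X X"
  by (rule chain_mapsI) auto

lemma chain_cmp:
  assumes "X \<in> bounded_complexes C" "Y \<in> bounded_complexes C" "Z \<in> bounded_complexes C"
    "f \<in> chain_maps C X Y" "g \<in> chain_maps C Y Z"
  shows "(\<lambda>i. g i \<cdot>\<^bsub>C\<^esub> f i) \<in> chain_maps C X Z"
proof (rule chain_mapsI)
  note [simp] = assms(1-3) chain_mapsD(1-3)[OF assms(4,1,2)] chain_mapsD(1-3)[OF assms(5,2,3)]
  note f = chain_mapsD(4)[OF assms(4,1,2)] and g = chain_mapsD(4)[OF assms(5,2,3)]
  show "(g (i + 1) \<cdot>\<^bsub>C\<^esub> f (i + 1)) \<cdot>\<^bsub>C\<^esub> Diff X i = Diff Z i \<cdot>\<^bsub>C\<^esub> g i \<cdot>\<^bsub>C\<^esub> f i" for i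
    by (simp add: f prefix_cong[OF g])
qed (use assms chain_mapsD in auto)

lemma chain_zero:
  assumes "X \<in> bounded_complexes C" "Y \<in> bounded_complexes C"
  shows "(\<lambda>i. \<zero>\<^bsub>Hom C (Term X i) (Term Y i)\<^esub>) \<in> chain_maps C X Y"
  using assms by (intro chain_mapsI) auto

lemma chain_add:
  assumes "X \<in> bounded_complexes C" "Y \<in> bounded_complexes C" "f \<in> chain_maps C X Y" "g \<in> chain_maps C X Y"
  shows "(\<lambda>i. f i \<oplus>\<^bsub>Hom C (Term X i) (Term Y i)\<^esub> g i) \<in> chain_maps C X Y"
  using assms chain_mapsD[OF assms(3,1,2)] chain_mapsD[OF assms(4,1,2)]
  by (intro chain_mapsI) (auto simp: cmp_add)

lemma chain_smult:
  assumes "X \<in> bounded_complexes C" "Y \<in> bounded_complexes C" "f \<in> chain_maps C X Y" "a \<in> carrier K"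
  shows "(\<lambda>i. a \<odot>\<^bsub>Hom C (Term X i) (Term Y i)\<^esub> f i) \<in> chain_maps C X Y"
  using assms chain_mapsD[OF assms(3,1,2)]
  by (intro chain_mapsI) (auto simp: cmp_smult)

text \<open>The null-homotopic map \<open>d h + h d\<close>. It is linear in \<open>h\<close> and
  compatible with chain maps on either side, so closure properties of homotopy reduce to finding the
  right \<open>h\<close>.\<close>

definition boundary :: "('o, 'm) cpx \<Rightarrow> ('o, 'm) cpx \<Rightarrow> (int \<Rightarrow> 'm) \<Rightarrow> int \<Rightarrow> 'm" where
  "boundary X Y h i = (Diff Y (i - 1) \<cdot>\<^bsub>C\<^esub> h i) \<oplus>\<^bsub>Hom C (Term X i) (Term Y i)\<^esub> (h (i + 1) \<cdot>\<^bsub>C\<^esub> Diff X i)"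

lemma homotopicI:
  assumes "X \<in> bounded_complexes C" "Y \<in> bounded_complexes C"
    "\<And>i. arrow C (h i)" "\<And>i. Dom C (h i) = Term X i" "\<And>i. Cod C (h i) = Term Y (i - 1)"
    "\<And>i. f i = g i \<oplus>\<^bsub>Hom C (Term X i) (Term Y i)\<^esub> boundary X Y h i"
  shows "homotopic C X Y f g"
  using assms by (auto simp: homotopic_def boundary_def arr_iff intro!: exI[of _ h])

lemma homotopicE:
  assumes "homotopic C X Y f g" "X \<in> bounded_complexes C" "Y \<in> bounded_complexes C"
  obtains h where "\<And>i. arrow C (h i)" "\<And>i. Dom C (h i) = Term X i" "\<And>i. Cod C (h i) = Term Y (i - 1)"
    "\<And>i. f i = g i \<oplus>\<^bsub>Hom C (Term X i) (Term Y i)\<^esub> boundary X Y h i"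
  using assms by (auto simp: homotopic_def boundary_def arr_iff)

lemma boundary_simps:
  assumes "X \<in> bounded_complexes C" "Y \<in> bounded_complexes C"
    "\<And>i. arrow C (h i)" "\<And>i. Dom C (h i) = Term X i" "\<And>i. Cod C (h i) = Term Y (i - 1)"
  shows "arrow C (boundary X Y h i)" "Dom C (boundary X Y h i) = Term X i"
    "Cod C (boundary X Y h i) = Term Y i"
  using assms by (auto simp: boundary_def)

lemma boundary_zero:
  assumes "X \<in> bounded_complexes C" "Y \<in> bounded_complexes C"
  shows "boundary X Y (\<lambda>i. \<zero>\<^bsub>Hom C (Term X i) (Term Y (i - 1))\<^esub>) i = \<zero>\<^bsub>Hom C (Term X i) (Term Y i)\<^esub>"
  using assms by (auto simp: boundary_def)

lemma boundary_add:
  assumes "X \<in> bounded_complexes C" "Y \<in> bounded_complexes C"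
    "\<And>i. arrow C (h i)" "\<And>i. Dom C (h i) = Term X i" "\<And>i. Cod C (h i) = Term Y (i - 1)"
    "\<And>i. arrow C (k i)" "\<And>i. Dom C (k i) = Term X i" "\<And>i. Cod C (k i) = Term Y (i - 1)"
  shows "boundary X Y (\<lambda>i. h i \<oplus>\<^bsub>Hom C (Term X i) (Term Y (i - 1))\<^esub> k i) i
    = boundary X Y h i \<oplus>\<^bsub>Hom C (Term X i) (Term Y i)\<^esub> boundary X Y k i"
  using assms by (simp add: boundary_def cmp_add[where Z = "Term Y (i - 1)"] cmp_add add_ac)

lemma boundary_smult:
  assumes "X \<in> bounded_complexes C" "Y \<in> bounded_complexes C" "a \<in> carrier K"
    "\<And>i. arrow C (h i)" "\<And>i. Dom C (h i) = Term X i" "\<And>i. Cod C (h i) = Term Y (i - 1)"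
  shows "boundary X Y (\<lambda>i. a \<odot>\<^bsub>Hom C (Term X i) (Term Y (i - 1))\<^esub> h i) i
    = a \<odot>\<^bsub>Hom C (Term X i) (Term Y i)\<^esub> boundary X Y h i"
  using assms by (simp add: boundary_def cmp_smult smult_distrib)

lemma homotopic_refl:
  assumes "X \<in> bounded_complexes C" "Y \<in> bounded_complexes C" "f \<in> chain_maps C X Y"
  shows "homotopic C X Y f f"
  using assms chain_mapsD[OF assms(3,1,2)]
  by (intro homotopicI[where h = "\<lambda>i. \<zero>\<^bsub>Hom C (Term X i) (Term Y (i - 1))\<^esub>"]) (auto simp: boundary_zero)

lemma homotopic_trans:
  assumes XY: "X \<in> bounded_complexes C" "Y \<in> bounded_complexes C" and g: "g \<in> chain_maps C X Y"
    and "homotopic C X Y f f'" "homotopic C X Y f' g"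
  shows "homotopic C X Y f g"
proof -
  note [simp] = XY chain_mapsD(1-3)[OF g XY]
  obtain h where h [simp]: "\<And>i. arrow C (h i)" "\<And>i. Dom C (h i) = Term X i" "\<And>i. Cod C (h i) = Term Y (i - 1)"
    "\<And>i. f i = f' i \<oplus>\<^bsub>Hom C (Term X i) (Term Y i)\<^esub> boundary X Y h i"
    using assms by (elim homotopicE[where f = f]) auto
  obtain k where k [simp]: "\<And>i. arrow C (k i)" "\<And>i. Dom C (k i) = Term X i" "\<And>i. Cod C (k i) = Term Y (i - 1)"
    "\<And>i. f' i = g i \<oplus>\<^bsub>Hom C (Term X i) (Term Y i)\<^esub> boundary X Y k i"
    using assms by (elim homotopicE[where f = f']) auto
  show ?thesis
    by (rule homotopicI[where h = "\<lambda>i. h i \<oplus>\<^bsub>Hom C (Term X i) (Term Y (i - 1))\<^esub> k i"])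
      (auto simp: boundary_add boundary_simps add_ac)
qed

lemma homotopic_sym:
  assumes XY: "X \<in> bounded_complexes C" "Y \<in> bounded_complexes C" and g: "g \<in> chain_maps C X Y"
    and "homotopic C X Y f g"
  shows "homotopic C X Y g f"
proof -
  note [simp] = XY chain_mapsD(1-3)[OF g XY] minus_one
  obtain h where h [simp]: "\<And>i. arrow C (h i)" "\<And>i. Dom C (h i) = Term X i" "\<And>i. Cod C (h i) = Term Y (i - 1)"
    "\<And>i. f i = g i \<oplus>\<^bsub>Hom C (Term X i) (Term Y i)\<^esub> boundary X Y h i"
    using assms by (elim homotopicE[where f = f]) auto
  \<comment> \<open>The reverse homotopy is \<open>- h\<close>, written with the scalar minus one so
    that its boundary is a scalar multiple of the old one.\<close>
  show ?thesis
    by (rule homotopicI[where h = "\<lambda>i. (\<ominus>\<^bsub>K\<^esub> \<one>\<^bsub>K\<^esub>) \<odot>\<^bsub>Hom C (Term X i) (Term Y (i - 1))\<^esub> h i"])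
      (auto simp: boundary_smult boundary_simps add_ac(2) smult_one)
qed

lemma homotopic_add:
  assumes XY: "X \<in> bounded_complexes C" "Y \<in> bounded_complexes C"
    and g: "g \<in> chain_maps C X Y" and g': "g' \<in> chain_maps C X Y"
    and "homotopic C X Y f g" "homotopic C X Y f' g'"
  shows "homotopic C X Y (\<lambda>i. f i \<oplus>\<^bsub>Hom C (Term X i) (Term Y i)\<^esub> f' i) (\<lambda>i. g i \<oplus>\<^bsub>Hom C (Term X i) (Term Y i)\<^esub> g' i)"
proof -
  note [simp] = XY chain_mapsD(1-3)[OF g XY] chain_mapsD(1-3)[OF g' XY]
  obtain h where h [simp]: "\<And>i. arrow C (h i)" "\<And>i. Dom C (h i) = Term X i" "\<And>i. Cod C (h i) = Term Y (i - 1)"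
    "\<And>i. f i = g i \<oplus>\<^bsub>Hom C (Term X i) (Term Y i)\<^esub> boundary X Y h i"
    using assms by (elim homotopicE[where f = f]) auto
  obtain k where k [simp]: "\<And>i. arrow C (k i)" "\<And>i. Dom C (k i) = Term X i" "\<And>i. Cod C (k i) = Term Y (i - 1)"
    "\<And>i. f' i = g' i \<oplus>\<^bsub>Hom C (Term X i) (Term Y i)\<^esub> boundary X Y k i"
    using assms by (elim homotopicE[where f = f']) auto
  show ?thesis
    by (rule homotopicI[where h = "\<lambda>i. h i \<oplus>\<^bsub>Hom C (Term X i) (Term Y (i - 1))\<^esub> k i"])
      (auto simp: boundary_add boundary_simps add_ac)
qed

lemma homotopic_smult:
  assumes XY: "X \<in> bounded_complexes C" "Y \<in> bounded_complexes C"
    and g: "g \<in> chain_maps C X Y" and a: "a \<in> carrier K" and "homotopic C X Y f g"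
  shows "homotopic C X Y (\<lambda>i. a \<odot>\<^bsub>Hom C (Term X i) (Term Y i)\<^esub> f i) (\<lambda>i. a \<odot>\<^bsub>Hom C (Term X i) (Term Y i)\<^esub> g i)"
proof -
  note [simp] = XY chain_mapsD(1-3)[OF g XY] a
  obtain h where h [simp]: "\<And>i. arrow C (h i)" "\<And>i. Dom C (h i) = Term X i" "\<And>i. Cod C (h i) = Term Y (i - 1)"
    "\<And>i. f i = g i \<oplus>\<^bsub>Hom C (Term X i) (Term Y i)\<^esub> boundary X Y h i"
    using assms by (elim homotopicE[where f = f]) auto
  show ?thesis
    by (rule homotopicI[where h = "\<lambda>i. a \<odot>\<^bsub>Hom C (Term X i) (Term Y (i - 1))\<^esub> h i"])
      (auto simp: boundary_smult boundary_simps smult_distrib)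
qed

lemma homotopic_cmp_right:
  assumes XYZ: "X \<in> bounded_complexes C" "Y \<in> bounded_complexes C" "Z \<in> bounded_complexes C"
    and f: "f \<in> chain_maps C X Y" and g: "g \<in> chain_maps C Y Z" "homotopic C Y Z g' g"
  shows "homotopic C X Z (\<lambda>i. g' i \<cdot>\<^bsub>C\<^esub> f i) (\<lambda>i. g i \<cdot>\<^bsub>C\<^esub> f i)"
proof -
  note [simp] = XYZ chain_mapsD(1-3)[OF f XYZ(1,2)] chain_mapsD(1-3)[OF g(1) XYZ(2,3)]
  note f' = chain_mapsD(4)[OF f XYZ(1,2)]
  obtain h where h [simp]: "\<And>i. arrow C (h i)" "\<And>i. Dom C (h i) = Term Y i" "\<And>i. Cod C (h i) = Term Z (i - 1)"
    "\<And>i. g' i = g i \<oplus>\<^bsub>Hom C (Term Y i) (Term Z i)\<^esub> boundary Y Z h i"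
    using g by (elim homotopicE) auto
  \<comment> \<open>As \<open>f\<close> commutes with the differentials, the boundary of
    \<open>h\<close> followed by precomposition with \<open>f\<close> is again a boundary.\<close>
  have "boundary Y Z h i \<cdot>\<^bsub>C\<^esub> f i = boundary X Z (\<lambda>i. h i \<cdot>\<^bsub>C\<^esub> f i) i" for i
    by (simp add: boundary_def cmp_add f')
  then show ?thesis
    by (intro homotopicI[where h = "\<lambda>i. h i \<cdot>\<^bsub>C\<^esub> f i"]) (auto simp: boundary_simps cmp_add)
qed

lemma homotopic_cmp_left:
  assumes XYZ: "X \<in> bounded_complexes C" "Y \<in> bounded_complexes C" "Z \<in> bounded_complexes C"
    and f: "f \<in> chain_maps C X Y" "homotopic C X Y f' f" and g: "g \<in> chain_maps C Y Z"
  shows "homotopic C X Z (\<lambda>i. g i \<cdot>\<^bsub>C\<^esub> f' i) (\<lambda>i. g i \<cdot>\<^bsub>C\<^esub> f i)"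
proof -
  note [simp] = XYZ chain_mapsD(1-3)[OF f(1) XYZ(1,2)] chain_mapsD(1-3)[OF g XYZ(2,3)]
  \<comment> \<open>The chain map equation at index \<open>i - 1\<close>, with
    \<open>i - 1 + 1\<close> simplified to \<open>i\<close>.\<close>
  have g': "g i \<cdot>\<^bsub>C\<^esub> Diff Y (i - 1) = Diff Z (i - 1) \<cdot>\<^bsub>C\<^esub> g (i - 1)" for i
    using chain_mapsD(4)[OF g XYZ(2,3), of "i - 1"] by simp
  obtain h where h [simp]: "\<And>i. arrow C (h i)" "\<And>i. Dom C (h i) = Term X i" "\<And>i. Cod C (h i) = Term Y (i - 1)"
    "\<And>i. f' i = f i \<oplus>\<^bsub>Hom C (Term X i) (Term Y i)\<^esub> boundary X Y h i"
    using f by (elim homotopicE) auto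
  \<comment> \<open>The component \<open>h i\<close> lands in degree \<open>i - 1\<close>, hence the
    shifted index of \<open>g\<close> in the new homotopy.\<close>
  have "g i \<cdot>\<^bsub>C\<^esub> boundary X Y h i = boundary X Z (\<lambda>i. g (i - 1) \<cdot>\<^bsub>C\<^esub> h i) i" for i
    by (simp add: boundary_def cmp_add prefix_cong[OF g'])
  then show ?thesis
    by (intro homotopicI[where h = "\<lambda>i. g (i - 1) \<cdot>\<^bsub>C\<^esub> h i"]) (auto simp: boundary_simps cmp_add)
qed

text \<open>One factor is replaced at a time, through the intermediate composite of \<open>g\<close>
  with \<open>f'\<close>.\<close>

lemma homotopic_cmp:
  assumes "X \<in> bounded_complexes C" "Y \<in> bounded_complexes C" "Z \<in> bounded_complexes C"
    and "f \<in> chain_maps C X Y" "f' \<in> chain_maps C X Y" "homotopic C X Y f' f"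
    and "g \<in> chain_maps C Y Z" "g' \<in> chain_maps C Y Z" "homotopic C Y Z g' g"
  shows "homotopic C X Z (\<lambda>i. g' i \<cdot>\<^bsub>C\<^esub> f' i) (\<lambda>i. g i \<cdot>\<^bsub>C\<^esub> f i)"
  by (rule homotopic_trans[OF assms(1,3) _ homotopic_cmp_right homotopic_cmp_left])
    (use assms in \<open>auto intro: chain_cmp\<close>)

section \<open>Operations on homotopy classes, computed on representatives\<close>

lemma homotopy_class_eq:
  assumes "X \<in> bounded_complexes C" "Y \<in> bounded_complexes C" "f \<in> chain_maps C X Y" "g \<in> chain_maps C X Y"
    "homotopic C X Y f g"
  shows "homotopy_class C X Y f = homotopy_class C X Y g"
proof -
  have "homotopic C X Y f k \<longleftrightarrow> homotopic C X Y g k" if "k \<in> chain_maps C X Y" for k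
    using homotopic_trans[OF assms(1,2) that homotopic_sym[OF assms(1,2,4,5)]]
      homotopic_trans[OF assms(1,2) that assms(5)] by blast
  then show ?thesis
    by (auto simp: homotopy_class_def)
qed

text \<open>Compatibility with homotopy makes all classes in the union equal, and \<open>f\<close>
  itself, being a member of its class, contributes one; so the union is the class of
  \<open>op f\<close>. With its binary companion below, this reduces identities between classes to
  identities between chain maps.\<close>

lemma hmap_lift_hmap:
  assumes "X \<in> bounded_complexes C" "Y \<in> bounded_complexes C" "X' \<in> bounded_complexes C" "Y' \<in> bounded_complexes C"
    and f: "f \<in> chain_maps C X Y"
    and op: "\<And>g. g \<in> chain_maps C X Y \<Longrightarrow> op g \<in> chain_maps C X' Y'"
      "\<And>g. g \<in> chain_maps C X Y \<Longrightarrow> homotopic C X Y f g \<Longrightarrow> homotopic C X' Y' (op f) (op g)"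
  shows "hmap_lift C X' Y' op (hmap C X Y f) = hmap C X' Y' (op f)"
proof -
  have "homotopy_class C X' Y' (op g) = homotopy_class C X' Y' (op f)" if "g \<in> homotopy_class C X Y f" for g
    using that assms by (intro homotopy_class_eq[symmetric]) (auto simp: homotopy_class_def)
  moreover have "f \<in> homotopy_class C X Y f"
    using assms by (auto simp: homotopy_class_def homotopic_refl)
  ultimately have "(\<Union>g \<in> homotopy_class C X Y f. homotopy_class C X' Y' (op g)) = homotopy_class C X' Y' (op f)"
    by blast
  then show ?thesis
    by (simp add: hmap_lift_def hmap_def)
qed

lemma hmap_lift2_hmap:
  assumes "X \<in> bounded_complexes C" "Y \<in> bounded_complexes C" "X' \<in> bounded_complexes C" "Y' \<in> bounded_complexes C"
      "X'' \<in> bounded_complexes C" "Y'' \<in> bounded_complexes C"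
    and f: "f \<in> chain_maps C X Y" "f' \<in> chain_maps C X' Y'"
    and op: "\<And>g g'. g \<in> chain_maps C X Y \<Longrightarrow> g' \<in> chain_maps C X' Y' \<Longrightarrow> op g g' \<in> chain_maps C X'' Y''"
      "\<And>g g'. g \<in> chain_maps C X Y \<Longrightarrow> g' \<in> chain_maps C X' Y' \<Longrightarrow> homotopic C X Y f g \<Longrightarrow>
        homotopic C X' Y' f' g' \<Longrightarrow> homotopic C X'' Y'' (op f f') (op g g')"
  shows "hmap_lift2 C X'' Y'' op (hmap C X Y f) (hmap C X' Y' f') = hmap C X'' Y'' (op f f')"
proof -
  have "homotopy_class C X'' Y'' (op g g') = homotopy_class C X'' Y'' (op f f')"
    if "g \<in> homotopy_class C X Y f" "g' \<in> homotopy_class C X' Y' f'" for g g'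
    using that assms by (intro homotopy_class_eq[symmetric]) (auto simp: homotopy_class_def)
  moreover have "f \<in> homotopy_class C X Y f" "f' \<in> homotopy_class C X' Y' f'"
    using assms by (auto simp: homotopy_class_def homotopic_refl)
  ultimately have "(\<Union>g \<in> homotopy_class C X Y f. \<Union>g' \<in> homotopy_class C X' Y' f'.
      homotopy_class C X'' Y'' (op g g')) = homotopy_class C X'' Y'' (op f f')"
    by blast
  then show ?thesis
    by (simp add: hmap_lift2_def hmap_def)
qed

lemma hmap_add:
  assumes "X \<in> bounded_complexes C" "Y \<in> bounded_complexes C" "f \<in> chain_maps C X Y" "g \<in> chain_maps C X Y"
  shows "hmap C X Y f \<oplus>\<^bsub>hmap_module C X Y\<^esub> hmap C X Y g = hmap C X Y (\<lambda>i. f i \<oplus>\<^bsub>Hom C (Term X i) (Term Y i)\<^esub> g i)"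
  unfolding hmap_module_def ring_record_simps
  using assms by (subst hmap_lift2_hmap) (auto intro: chain_add homotopic_add)

lemma hmap_smult:
  assumes "X \<in> bounded_complexes C" "Y \<in> bounded_complexes C" "f \<in> chain_maps C X Y" "a \<in> carrier K"
  shows "a \<odot>\<^bsub>hmap_module C X Y\<^esub> hmap C X Y f = hmap C X Y (\<lambda>i. a \<odot>\<^bsub>Hom C (Term X i) (Term Y i)\<^esub> f i)"
  unfolding hmap_module_def module.simps
  using assms by (subst hmap_lift_hmap) (auto intro: chain_smult homotopic_smult)

lemma hmap_module_simps:
  "carrier (hmap_module C X Y) = hmap C X Y ` chain_maps C X Y"
  "\<zero>\<^bsub>hmap_module C X Y\<^esub> = hmap C X Y (\<lambda>i. \<zero>\<^bsub>Hom C (Term X i) (Term Y i)\<^esub>)"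
  by (simp_all add: hmap_module_def)

lemma hmap_module:
  assumes XY: "X \<in> bounded_complexes C" "Y \<in> bounded_complexes C"
  shows "module K (hmap_module C X Y)"
proof -
  note [simp] = XY hmap_module_simps hmap_add hmap_smult chain_add chain_smult chain_zero
    chain_mapsD(1-3)[OF _ XY]
  interpret K: cring K by (rule base_ring)
  show ?thesis
  proof (rule moduleI)
    show "cring K" by (rule base_ring)
    show "abelian_group (hmap_module C X Y)"
    proof (rule abelian_groupI)
      fix u assume "u \<in> carrier (hmap_module C X Y)"
      then obtain f where f: "f \<in> chain_maps C X Y" "u = hmap C X Y f"
        by auto
      \<comment> \<open>The witness is the class of the termwise scalar multiple of \<open>f\<close>
        by minus one.\<close>
      show "\<exists>v \<in> carrier (hmap_module C X Y). v \<oplus>\<^bsub>hmap_module C X Y\<^esub> u = \<zero>\<^bsub>hmap_module C X Y\<^esub>"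
        by (rule bexI[of _ "hmap C X Y (\<lambda>i. (\<ominus>\<^bsub>K\<^esub> \<one>\<^bsub>K\<^esub>) \<odot>\<^bsub>Hom C (Term X i) (Term Y i)\<^esub> f i)"])
          (use f in \<open>auto simp: add_ac(1)[of "_ \<odot>\<^bsub>Hom C (Term X _) (Term Y _)\<^esub> _"] smult_one\<close>)
    qed (auto simp: add_ac)
  qed (auto simp: smult_distrib smult_one)
qed

lemma hmap_cmp:
  assumes "X \<in> bounded_complexes C" "Y \<in> bounded_complexes C" "Z \<in> bounded_complexes C"
    "f \<in> chain_maps C X Y" "g \<in> chain_maps C Y Z"
  shows "hmap_lift2 C X Z (\<lambda>g f i. g i \<cdot>\<^bsub>C\<^esub> f i) (hmap C Y Z g) (hmap C X Y f) = hmap C X Z (\<lambda>i. g i \<cdot>\<^bsub>C\<^esub> f i)"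
  using assms by (subst hmap_lift2_hmap) (auto intro: chain_cmp homotopic_cmp)

text \<open>Compatibility of the inverses with the differentials follows from that of
  \<open>t\<close> by cancelling \<open>t (i + 1)\<close> and \<open>t i\<close>. This makes
  termwise structure isomorphisms invertible already as chain maps.\<close>

lemma chain_inverse:
  assumes XY: "X \<in> bounded_complexes C" "Y \<in> bounded_complexes C" and t: "t \<in> chain_maps C X Y"
    and iso [simp]: "\<And>i. invertible C (t i)"
  shows "(\<lambda>i. inverse_arrow C (t i)) \<in> chain_maps C Y X"
proof (rule chain_mapsI)
  note [simp] = XY chain_mapsD(1-3)[OF t XY]
  note n = chain_mapsD(4)[OF t XY]
  show "inverse_arrow C (t (i + 1)) \<cdot>\<^bsub>C\<^esub> Diff Y i = Diff X i \<cdot>\<^bsub>C\<^esub> inverse_arrow C (t i)" for i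
    by (rule iso_left_cancel[of "t (i + 1)"], rule iso_right_cancel[of _ "t i"])
      (auto simp: prefix_cong[OF n] n)
qed (use assms chain_mapsD[OF t XY] in auto)

end

section \<open>Termwise action on complexes\<close>

context bilinear_bifunctor
begin

text \<open>After exchanging the arguments a right action looks like a left one, so the statements
  about \<open>act\<close> serve both actions of a bimodule category.\<close>

lemma flip: "bilinear_bifunctor K D C E (\<lambda>Y X. TO X Y) (\<lambda>g f. TA f g)"
  by unfold_locales (auto simp: bi_arr bi_cmp bi_add_left bi_add_right bi_smult_left bi_smult_right)

lemma TA_add:
  assumes "arrow C f" "arrow D g" "arrow D g'" "Dom D g = Y" "Cod D g = Y'" "Dom D g' = Y" "Cod D g' = Y'"
  shows "TA f (g \<oplus>\<^bsub>Hom D Y Y'\<^esub> g') = TA f g \<oplus>\<^bsub>Hom E (TO (Dom C f) Y) (TO (Cod C f) Y')\<^esub> TA f g'"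
  using assms by (intro bi_add_right) (auto simp: C.arr_iff D.arr_iff)

text \<open>The common form of \<open>cpx_lact\<close> and \<open>cpx_ract\<close>, the latter after
  flipping.\<close>

definition act :: "'o \<Rightarrow> ('p, 'n) cpx \<Rightarrow> ('q, 'l) cpx" where
  "act P X = \<lparr>Term = (\<lambda>i. TO P (Term X i)), Diff = (\<lambda>i. TA (Ident C P) (Diff X i))\<rparr>"

lemma act_simps: "Term (act P X) i = TO P (Term X i)" "Diff (act P X) i = TA (Ident C P) (Diff X i)"
  by (simp_all add: act_def)

text \<open>Acting with a fixed object is a linear functor: it sends zero composites to zero and
  zero objects to zero objects, so the same bound works.\<close>

lemma act_bounded [simp]:
  assumes P: "P \<in> Ob C" and X: "X \<in> bounded_complexes D"
  shows "act P X \<in> bounded_complexes E"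
proof -
  interpret P: linear_functor K D E "\<lparr>FO = TO P, FA = TA (Ident C P)\<rparr>"
    by (rule linear_functor_left) fact
  obtain n where "\<forall>i. \<bar>i\<bar> > n \<longrightarrow> zero_object D (Term X i)"
    using X unfolding bounded_complexes_def by blast
  then have "\<exists>n. \<forall>i. \<bar>i\<bar> > n \<longrightarrow> zero_object E (TO P (Term X i))"
    using P.FO_zero_object by auto
  moreover have "TA (Ident C P) (Diff X (i + 1)) \<cdot>\<^bsub>E\<^esub> TA (Ident C P) (Diff X i)
      = \<zero>\<^bsub>Hom E (TO P (Term X i)) (TO P (Term X (i + 2)))\<^esub>" for i
    using P X P.FA_zero[of "Term X i" "Term X (i + 2)"] by (simp flip: whisker_left)
  moreover have "TO P (Term X i) \<in> Ob E"
    "TA (Ident C P) (Diff X i) \<in> arr E (TO P (Term X i)) (TO P (Term X (i + 1)))" for i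
    using P X by (auto simp: E.arr_iff)
  ultimately show ?thesis
    unfolding bounded_complexes_def mem_Collect_eq act_simps by blast
qed

lemma act_chain [simp]:
  assumes "arrow C u" "Dom C u = P" "Cod C u = Q" "X \<in> bounded_complexes D" "Y \<in> bounded_complexes D"
    "f \<in> chain_maps D X Y"
  shows "(\<lambda>i. TA u (f i)) \<in> chain_maps E (act P X) (act Q Y)"
proof (rule E.chain_mapsI)
  have [simp]: "P \<in> Ob C" "Q \<in> Ob C"
    using assms C.arrow_Ob by blast+
  note [simp] = assms(1-5) D.chain_mapsD(1-3)[OF assms(6,4,5)] act_simps
  show "TA u (f (i + 1)) \<cdot>\<^bsub>E\<^esub> Diff (act P X) i = Diff (act Q Y) i \<cdot>\<^bsub>E\<^esub> TA u (f i)" for i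
    by (simp flip: TA_cmp add: D.chain_mapsD(4)[OF assms(6,4,5)])
qed (use assms C.arrow_Ob D.chain_mapsD[OF assms(6,4,5)] in \<open>auto simp: act_simps\<close>)

text \<open>By bifunctoriality, \<open>u\<close> acting on \<open>d h\<close> is the differential of
  the target after \<open>u\<close> acting on \<open>h\<close>, and dually for \<open>h d\<close>.
  Thus \<open>u\<close> acting on \<open>h\<close> is a homotopy even though \<open>u\<close> may
  connect different objects \<open>P\<close> and \<open>Q\<close>.\<close>

lemma act_homotopic:
  assumes u: "arrow C u" "Dom C u = P" "Cod C u = Q"
    and XY: "X \<in> bounded_complexes D" "Y \<in> bounded_complexes D"
    and fg: "g \<in> chain_maps D X Y" "homotopic D X Y f g"
  shows "homotopic E (act P X) (act Q Y) (\<lambda>i. TA u (f i)) (\<lambda>i. TA u (g i))"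
proof -
  have [simp]: "P \<in> Ob C" "Q \<in> Ob C"
    using u C.arrow_Ob by blast+
  note [simp] = u XY D.chain_mapsD(1-3)[OF fg(1) XY]
  obtain h where h [simp]: "\<And>i. arrow D (h i)" "\<And>i. Dom D (h i) = Term X i" "\<And>i. Cod D (h i) = Term Y (i - 1)"
    "\<And>i. f i = g i \<oplus>\<^bsub>Hom D (Term X i) (Term Y i)\<^esub> D.boundary X Y h i"
    using fg by (elim D.homotopicE) auto
  have "TA u (D.boundary X Y h i) = E.boundary (act P X) (act Q Y) (\<lambda>i. TA u (h i)) i" for i
    by (simp flip: TA_cmp add: D.boundary_def E.boundary_def TA_add act_simps)
  then show ?thesis
    by (intro E.homotopicI[where h = "\<lambda>i. TA u (h i)"]) (auto simp: D.boundary_simps TA_add act_simps)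
qed

text \<open>The left side is what \<open>LActA\<close> and \<open>RActA\<close> of \<open>Kb\<close>
  become on unfolding: source and target are read off the tags of the argument, hence the
  abstraction over a triple.\<close>

lemma act_hmap:
  assumes "arrow C u" "X \<in> bounded_complexes D" "Y \<in> bounded_complexes D" "f \<in> chain_maps D X Y"
  shows "(\<lambda>(X, Y, F). (act (Dom C u) X, act (Cod C u) Y,
      \<Union>f \<in> F. homotopy_class E (act (Dom C u) X) (act (Cod C u) Y) (\<lambda>i. TA u (f i)))) (hmap D X Y f)
    = hmap E (act (Dom C u) X) (act (Cod C u) Y) (\<lambda>i. TA u (f i))"
proof -
  have "homotopy_class E (act (Dom C u) X) (act (Cod C u) Y) (\<lambda>i. TA u (g i))
      = homotopy_class E (act (Dom C u) X) (act (Cod C u) Y) (\<lambda>i. TA u (f i))"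
    if "g \<in> homotopy_class D X Y f" for g
    using that assms
    by (intro E.homotopy_class_eq[symmetric] act_chain act_homotopic) (auto simp: homotopy_class_def)
  moreover have "f \<in> homotopy_class D X Y f"
    using assms by (auto simp: homotopy_class_def D.homotopic_refl)
  ultimately have "(\<Union>g \<in> homotopy_class D X Y f. homotopy_class E (act (Dom C u) X) (act (Cod C u) Y) (\<lambda>i. TA u (g i)))
      = homotopy_class E (act (Dom C u) X) (act (Cod C u) Y) (\<lambda>i. TA u (f i))"
    by blast
  then show ?thesis
    by (simp add: hmap_def)
qed

end

section \<open>The homotopy category as a bimodule category\<close>

context bimodule_category
begin

sublocale right': bilinear_bifunctor K A M M "\<lambda>X N. N \<triangleleft>\<^bsub>M\<^esub> X" "\<lambda>f h. h \<unlhd>\<^bsub>M\<^esub> f"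
  by (rule right.flip)

abbreviation lact :: "'a \<Rightarrow> ('o, 'm) cpx \<Rightarrow> ('o, 'm) cpx" where "lact \<equiv> cpx_lact A M"
abbreviation ract :: "('o, 'm) cpx \<Rightarrow> 'a \<Rightarrow> ('o, 'm) cpx" where "ract \<equiv> cpx_ract A M"

lemma lact_eq: "lact P X = left.act P X" and ract_eq: "ract X P = right'.act P X"
  by (simp_all add: cpx_lact_def cpx_ract_def left.act_def right'.act_def)

lemma cpx_act_simps:
  "Term (lact P X) i = P \<triangleright>\<^bsub>M\<^esub> Term X i" "Diff (lact P X) i = Ident A P \<unrhd>\<^bsub>M\<^esub> Diff X i"
  "Term (ract X P) i = Term X i \<triangleleft>\<^bsub>M\<^esub> P" "Diff (ract X P) i = Diff X i \<unlhd>\<^bsub>M\<^esub> Ident A P"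
  by (simp_all add: cpx_lact_def cpx_ract_def)

lemma cpx_act_bounded [simp]:
  assumes "P \<in> Ob A" "X \<in> bounded_complexes M"
  shows "lact P X \<in> bounded_complexes M" "ract X P \<in> bounded_complexes M"
  using assms by (simp_all add: lact_eq ract_eq)

lemma cpx_act_chain [simp]:
  assumes "arrow A u" "Dom A u = P" "Cod A u = Q" "X \<in> bounded_complexes M" "Y \<in> bounded_complexes M"
    "f \<in> chain_maps M X Y"
  shows "(\<lambda>i. u \<unrhd>\<^bsub>M\<^esub> f i) \<in> chain_maps M (lact P X) (lact Q Y)"
    "(\<lambda>i. f i \<unlhd>\<^bsub>M\<^esub> u) \<in> chain_maps M (ract X P) (ract Y Q)"
  using left.act_chain[OF assms] right'.act_chain[OF assms] by (simp_all add: lact_eq ract_eq)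

lemma Kb_simps [simp]:
  "Ob (Kb A M) = bounded_complexes M" "Hom (Kb A M) = hmap_module M"
  "Ident (Kb A M) X = hmap M X X (\<lambda>i. Ident M (Term X i))"
  "LActO (Kb A M) = lact" "RActO (Kb A M) = ract"
  "LAssoc (Kb A M) P Q X = hmap M (lact (P \<star>\<^bsub>A\<^esub> Q) X) (lact P (lact Q X)) (\<lambda>i. LAssoc M P Q (Term X i))"
  "RAssoc (Kb A M) X P Q = hmap M (ract (ract X P) Q) (ract X (P \<star>\<^bsub>A\<^esub> Q)) (\<lambda>i. RAssoc M (Term X i) P Q)"
  "MAssoc (Kb A M) P X Q = hmap M (ract (lact P X) Q) (lact P (ract X Q)) (\<lambda>i. MAssoc M P (Term X i) Q)"
  "LActUnit (Kb A M) X = hmap M (lact (Unit A) X) X (\<lambda>i. LActUnit M (Term X i))"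
  "RActUnit (Kb A M) X = hmap M (ract X (Unit A)) X (\<lambda>i. RActUnit M (Term X i))"
  "Dom (Kb A M) (hmap M X Y f) = X" "Cod (Kb A M) (hmap M X Y f) = Y"
  by (simp_all add: Kb_def Let_def hmap_def)

lemma Kb_cmp:
  assumes "X \<in> bounded_complexes M" "Y \<in> bounded_complexes M" "Z \<in> bounded_complexes M"
    "f \<in> chain_maps M X Y" "g \<in> chain_maps M Y Z"
  shows "Cmp (Kb A M) (hmap M Y Z g) (hmap M X Y f) = hmap M X Z (\<lambda>i. g i \<cdot>\<^bsub>M\<^esub> f i)"
  using M.hmap_cmp[OF assms] by (simp add: Kb_def Let_def hmap_def)

lemma Kb_act [simp]:
  assumes "arrow A u" "X \<in> bounded_complexes M" "Y \<in> bounded_complexes M" "f \<in> chain_maps M X Y"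
  shows "LActA (Kb A M) u (hmap M X Y f) = hmap M (lact (Dom A u) X) (lact (Cod A u) Y) (\<lambda>i. u \<unrhd>\<^bsub>M\<^esub> f i)"
    "RActA (Kb A M) (hmap M X Y f) u = hmap M (ract X (Dom A u)) (ract Y (Cod A u)) (\<lambda>i. f i \<unlhd>\<^bsub>M\<^esub> u)"
  using left.act_hmap[OF assms] right'.act_hmap[OF assms]
  by (simp_all add: Kb_def Let_def hmap_def hmap_lift_def lact_eq ract_eq)

text \<open>Naturality of the associativity arrows, applied to identities and a differential, is
  precisely the chain map condition.\<close>

lemma structure_chain [simp]:
  assumes [simp]: "P \<in> Ob A" "Q \<in> Ob A" "X \<in> bounded_complexes M"
  shows "(\<lambda>i. LAssoc M P Q (Term X i)) \<in> chain_maps M (lact (P \<star>\<^bsub>A\<^esub> Q) X) (lact P (lact Q X))"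
    "(\<lambda>i. RAssoc M (Term X i) P Q) \<in> chain_maps M (ract (ract X P) Q) (ract X (P \<star>\<^bsub>A\<^esub> Q))"
    "(\<lambda>i. MAssoc M P (Term X i) Q) \<in> chain_maps M (ract (lact P X) Q) (lact P (ract X Q))"
proof -
  note refls = refl refl refl refl refl refl
  have "LAssoc M P Q (Term X (i + 1)) \<cdot>\<^bsub>M\<^esub> (Ident A (P \<star>\<^bsub>A\<^esub> Q) \<unrhd>\<^bsub>M\<^esub> Diff X i)
      = (Ident A P \<unrhd>\<^bsub>M\<^esub> Ident A Q \<unrhd>\<^bsub>M\<^esub> Diff X i) \<cdot>\<^bsub>M\<^esub> LAssoc M P Q (Term X i)" for i
    using lassoc_natural[of "Ident A P" "Ident A Q" "Diff X i", OF _ _ _ refls] by simp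
  then show "(\<lambda>i. LAssoc M P Q (Term X i)) \<in> chain_maps M (lact (P \<star>\<^bsub>A\<^esub> Q) X) (lact P (lact Q X))"
    by (intro M.chain_mapsI) (simp_all add: cpx_act_simps)
  have "RAssoc M (Term X (i + 1)) P Q \<cdot>\<^bsub>M\<^esub> (Diff X i \<unlhd>\<^bsub>M\<^esub> Ident A P \<unlhd>\<^bsub>M\<^esub> Ident A Q)
      = (Diff X i \<unlhd>\<^bsub>M\<^esub> Ident A (P \<star>\<^bsub>A\<^esub> Q)) \<cdot>\<^bsub>M\<^esub> RAssoc M (Term X i) P Q" for i
    using rassoc_natural[of "Diff X i" "Ident A P" "Ident A Q", OF _ _ _ refls] by simp
  then show "(\<lambda>i. RAssoc M (Term X i) P Q) \<in> chain_maps M (ract (ract X P) Q) (ract X (P \<star>\<^bsub>A\<^esub> Q))"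
    by (intro M.chain_mapsI) (simp_all add: cpx_act_simps)
  have "MAssoc M P (Term X (i + 1)) Q \<cdot>\<^bsub>M\<^esub> ((Ident A P \<unrhd>\<^bsub>M\<^esub> Diff X i) \<unlhd>\<^bsub>M\<^esub> Ident A Q)
      = (Ident A P \<unrhd>\<^bsub>M\<^esub> (Diff X i \<unlhd>\<^bsub>M\<^esub> Ident A Q)) \<cdot>\<^bsub>M\<^esub> MAssoc M P (Term X i) Q" for i
    using massoc_natural[of "Ident A P" "Diff X i" "Ident A Q", OF _ _ _ refls] by simp
  then show "(\<lambda>i. MAssoc M P (Term X i) Q) \<in> chain_maps M (ract (lact P X) Q) (lact P (ract X Q))"
    by (intro M.chain_mapsI) (simp_all add: cpx_act_simps)
qed

lemma unit_chain [simp]: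
  assumes "X \<in> bounded_complexes M"
  shows "(\<lambda>i. LActUnit M (Term X i)) \<in> chain_maps M (lact (Unit A) X) X"
    "(\<lambda>i. RActUnit M (Term X i)) \<in> chain_maps M (ract X (Unit A)) X"
  using assms by (auto intro!: M.chain_mapsI simp: cpx_act_simps lactunit_natural ractunit_natural)

text \<open>Each law holds in every degree for representatives, before passing to classes. Arrows
  are fixed one after another and replaced by representatives at once, so each axiom is shown as
  soon as its variables are available.\<close>

lemma linear_category_Kb: "linear_category K (Kb A M)"
proof (rule linear_category.intro)
  show "cring K" by (rule M.base_ring)
  fix W X Y Z
  assume WX: "W \<in> Ob (Kb A M)" "X \<in> Ob (Kb A M)"
  then have [simp]: "W \<in> bounded_complexes M" "X \<in> bounded_complexes M" by auto
  show "Ident (Kb A M) X \<in> arr (Kb A M) X X"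
    by (simp add: M.hmap_module_simps M.chain_ident)
  assume "Y \<in> Ob (Kb A M)"
  then have [simp]: "Y \<in> bounded_complexes M" by simp
  show "module K (Hom (Kb A M) X Y)"
    by (simp add: M.hmap_module)
  fix u' assume "u' \<in> arr (Kb A M) X Y"
  then obtain f' where f' [simp]: "f' \<in> chain_maps M X Y" "u' = hmap M X Y f'"
    by (auto simp: M.hmap_module_simps)
  fix u assume "u \<in> arr (Kb A M) X Y"
  then obtain f where f [simp]: "f \<in> chain_maps M X Y" "u = hmap M X Y f"
    by (auto simp: M.hmap_module_simps)
  note [simp] = M.chain_mapsD(1-3)[OF f(1)] M.chain_mapsD(1-3)[OF f'(1)] M.chain_ident Kb_cmp
    M.hmap_add M.hmap_smult M.chain_add M.chain_smult
  show "Dom (Kb A M) u = X \<and> Cod (Kb A M) u = Y"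
    "Cmp (Kb A M) (Ident (Kb A M) Y) u = u" "Cmp (Kb A M) u (Ident (Kb A M) X) = u"
    by simp_all
  assume "Z \<in> Ob (Kb A M)"
  then have [simp]: "Z \<in> bounded_complexes M" by simp
  fix v' assume "v' \<in> arr (Kb A M) Y Z"
  then obtain g' where g' [simp]: "g' \<in> chain_maps M Y Z" "v' = hmap M Y Z g'"
    by (auto simp: M.hmap_module_simps)
  fix v assume "v \<in> arr (Kb A M) Y Z"
  then obtain g where g [simp]: "g \<in> chain_maps M Y Z" "v = hmap M Y Z g"
    by (auto simp: M.hmap_module_simps)
  note [simp] = M.chain_mapsD(1-3)[OF g(1)] M.chain_mapsD(1-3)[OF g'(1)]
  have [simp]: "(\<lambda>i. g i \<cdot>\<^bsub>M\<^esub> f i) \<in> chain_maps M X Z" "(\<lambda>i. g i \<cdot>\<^bsub>M\<^esub> f' i) \<in> chain_maps M X Z"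
    "(\<lambda>i. g' i \<cdot>\<^bsub>M\<^esub> f i) \<in> chain_maps M X Z"
    by (rule M.chain_cmp[of X Y Z]; simp)+
  show "Cmp (Kb A M) v u \<in> arr (Kb A M) X Z"
    by (simp add: M.hmap_module_simps)
  show "Cmp (Kb A M) (v \<oplus>\<^bsub>Hom (Kb A M) Y Z\<^esub> v') u
      = Cmp (Kb A M) v u \<oplus>\<^bsub>Hom (Kb A M) X Z\<^esub> Cmp (Kb A M) v' u"
    "Cmp (Kb A M) v (u \<oplus>\<^bsub>Hom (Kb A M) X Y\<^esub> u')
      = Cmp (Kb A M) v u \<oplus>\<^bsub>Hom (Kb A M) X Z\<^esub> Cmp (Kb A M) v u'"
    by (simp_all add: M.cmp_add)
  { fix a assume [simp]: "a \<in> carrier K"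
    show "Cmp (Kb A M) (a \<odot>\<^bsub>Hom (Kb A M) Y Z\<^esub> v) u = a \<odot>\<^bsub>Hom (Kb A M) X Z\<^esub> Cmp (Kb A M) v u"
      "Cmp (Kb A M) v (a \<odot>\<^bsub>Hom (Kb A M) X Y\<^esub> u) = a \<odot>\<^bsub>Hom (Kb A M) X Z\<^esub> Cmp (Kb A M) v u"
      by (simp_all add: M.cmp_smult)
  }
  fix w assume "w \<in> arr (Kb A M) W X"
  then obtain h where h [simp]: "h \<in> chain_maps M W X" "w = hmap M W X h"
    by (auto simp: M.hmap_module_simps)
  note [simp] = M.chain_mapsD(1-3)[OF h(1)]
  have [simp]: "(\<lambda>i. f i \<cdot>\<^bsub>M\<^esub> h i) \<in> chain_maps M W Y"
    by (rule M.chain_cmp[of W X Y]; simp)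
  show "Cmp (Kb A M) (Cmp (Kb A M) v u) w = Cmp (Kb A M) v (Cmp (Kb A M) u w)"
    by simp
qed

lemma Kb_arr: "arr (Kb A M) X Y = hmap M X Y ` chain_maps M X Y"
  by (simp add: M.hmap_module_simps)

text \<open>On representatives every law is the corresponding law of the left action of
  \<open>A\<close> on \<open>M\<close> in each degree.\<close>

lemma bilinear_bifunctor_lact:
  "bilinear_bifunctor K A (Kb A M) (Kb A M) (LActO (Kb A M)) (LActA (Kb A M))"
proof (intro bilinear_bifunctor.intro bilinear_bifunctor_axioms.intro linear_category_Kb
    A.C.linear_category_axioms)
  fix P X
  assume PX [simp]: "P \<in> Ob A" "X \<in> Ob (Kb A M)"
  have [simp]: "X \<in> bounded_complexes M" using PX by simp
  show "LActO (Kb A M) P X \<in> Ob (Kb A M)"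
    by simp
  show "LActA (Kb A M) (Ident A P) (Ident (Kb A M) X) = Ident (Kb A M) (LActO (Kb A M) P X)"
    by (simp add: M.chain_ident cpx_act_simps)
  fix P' X' u w
  assume PX' [simp]: "P' \<in> Ob A" "X' \<in> Ob (Kb A M)" and u: "u \<in> arr A P P'" and w: "w \<in> arr (Kb A M) X X'"
  have [simp]: "X' \<in> bounded_complexes M" using PX' by simp
  have [simp]: "arrow A u" "Dom A u = P" "Cod A u = P'"
    using A.C.arrowI[OF PX(1) PX'(1) u] by auto
  obtain f where f [simp]: "f \<in> chain_maps M X X'" "w = hmap M X X' f"
    using w by (auto simp: M.hmap_module_simps)
  note [simp] = M.chain_mapsD(1-3)[OF f(1)] M.hmap_add M.hmap_smult M.chain_add M.chain_smult Kb_cmp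
  show "LActA (Kb A M) u w \<in> arr (Kb A M) (LActO (Kb A M) P X) (LActO (Kb A M) P' X')"
    by (auto simp: M.hmap_module_simps)
  { fix a assume [simp]: "a \<in> carrier K"
    show "LActA (Kb A M) (a \<odot>\<^bsub>Hom A P P'\<^esub> u) w
        = a \<odot>\<^bsub>Hom (Kb A M) (LActO (Kb A M) P X) (LActO (Kb A M) P' X')\<^esub> LActA (Kb A M) u w"
      "LActA (Kb A M) u (a \<odot>\<^bsub>Hom (Kb A M) X X'\<^esub> w)
        = a \<odot>\<^bsub>Hom (Kb A M) (LActO (Kb A M) P X) (LActO (Kb A M) P' X')\<^esub> LActA (Kb A M) u w"
      by (simp_all add: cpx_act_simps M.arr_iff u
        left.bi_smult_left[of P P' "Term X i" "Term X' i" for i]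
        left.bi_smult_right[of P P' "Term X i" "Term X' i" for i])
  }
  { fix u' assume u': "u' \<in> arr A P P'"
    have [simp]: "arrow A u'" "Dom A u' = P" "Cod A u' = P'"
      using A.C.arrowI[OF PX(1) PX'(1) u'] by auto
    show "LActA (Kb A M) (u \<oplus>\<^bsub>Hom A P P'\<^esub> u') w = LActA (Kb A M) u w
        \<oplus>\<^bsub>Hom (Kb A M) (LActO (Kb A M) P X) (LActO (Kb A M) P' X')\<^esub> LActA (Kb A M) u' w"
      by (simp add: cpx_act_simps M.arr_iff u u'
        left.bi_add_left[of P P' "Term X i" "Term X' i" for i])
  }
  { fix w' assume "w' \<in> arr (Kb A M) X X'"
    then obtain f' where f' [simp]: "f' \<in> chain_maps M X X'" "w' = hmap M X X' f'"
      by (auto simp: M.hmap_module_simps)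
    note [simp] = M.chain_mapsD(1-3)[OF f'(1)]
    show "LActA (Kb A M) u (w \<oplus>\<^bsub>Hom (Kb A M) X X'\<^esub> w') = LActA (Kb A M) u w
        \<oplus>\<^bsub>Hom (Kb A M) (LActO (Kb A M) P X) (LActO (Kb A M) P' X')\<^esub> LActA (Kb A M) u w'"
      by (simp add: cpx_act_simps left.TA_add)
  }
  fix P'' X'' u' w'
  assume PX'' [simp]: "P'' \<in> Ob A" "X'' \<in> Ob (Kb A M)" and u': "u' \<in> arr A P' P''"
    and w': "w' \<in> arr (Kb A M) X' X''"
  have [simp]: "X'' \<in> bounded_complexes M" using PX'' by simp
  have [simp]: "arrow A u'" "Dom A u' = P'" "Cod A u' = P''"
    using A.C.arrowI[OF PX'(1) PX''(1) u'] by auto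
  obtain f' where f' [simp]: "f' \<in> chain_maps M X' X''" "w' = hmap M X' X'' f'"
    using w' by (auto simp: M.hmap_module_simps)
  note [simp] = M.chain_mapsD(1-3)[OF f'(1)]
  have [simp]: "(\<lambda>i. f' i \<cdot>\<^bsub>M\<^esub> f i) \<in> chain_maps M X X''"
    by (rule M.chain_cmp[of X X' X'']; simp)
  show "LActA (Kb A M) (u' \<cdot>\<^bsub>A\<^esub> u) (Cmp (Kb A M) w' w)
      = Cmp (Kb A M) (LActA (Kb A M) u' w') (LActA (Kb A M) u w)"
    by (simp add: left.TA_cmp)
qed

lemma bilinear_bifunctor_ract:
  "bilinear_bifunctor K (Kb A M) A (Kb A M) (RActO (Kb A M)) (RActA (Kb A M))"
proof (intro bilinear_bifunctor.intro bilinear_bifunctor_axioms.intro linear_category_Kb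
    A.C.linear_category_axioms)
  fix P X
  assume PX [simp]: "X \<in> Ob (Kb A M)" "P \<in> Ob A"
  have [simp]: "X \<in> bounded_complexes M" using PX by simp
  show "RActO (Kb A M) X P \<in> Ob (Kb A M)"
    by simp
  show "RActA (Kb A M) (Ident (Kb A M) X) (Ident A P) = Ident (Kb A M) (RActO (Kb A M) X P)"
    by (simp add: M.chain_ident cpx_act_simps)
  fix P' X' u w
  assume PX' [simp]: "X' \<in> Ob (Kb A M)" "P' \<in> Ob A" and w: "w \<in> arr (Kb A M) X X'" and u: "u \<in> arr A P P'"
  have [simp]: "X' \<in> bounded_complexes M" using PX' by simp
  have [simp]: "arrow A u" "Dom A u = P" "Cod A u = P'"
    using A.C.arrowI[OF PX(2) PX'(2) u] by auto
  obtain f where f [simp]: "f \<in> chain_maps M X X'" "w = hmap M X X' f"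
    using w by (auto simp: M.hmap_module_simps)
  note [simp] = M.chain_mapsD(1-3)[OF f(1)] M.hmap_add M.hmap_smult M.chain_add M.chain_smult Kb_cmp
  show "RActA (Kb A M) w u \<in> arr (Kb A M) (RActO (Kb A M) X P) (RActO (Kb A M) X' P')"
    by (auto simp: M.hmap_module_simps)
  { fix a assume [simp]: "a \<in> carrier K"
    show "RActA (Kb A M) w (a \<odot>\<^bsub>Hom A P P'\<^esub> u)
        = a \<odot>\<^bsub>Hom (Kb A M) (RActO (Kb A M) X P) (RActO (Kb A M) X' P')\<^esub> RActA (Kb A M) w u"
      "RActA (Kb A M) (a \<odot>\<^bsub>Hom (Kb A M) X X'\<^esub> w) u
        = a \<odot>\<^bsub>Hom (Kb A M) (RActO (Kb A M) X P) (RActO (Kb A M) X' P')\<^esub> RActA (Kb A M) w u"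
      by (simp_all add: cpx_act_simps M.arr_iff u
        right.bi_smult_left[of "Term X i" "Term X' i" P P' for i]
        right.bi_smult_right[of "Term X i" "Term X' i" P P' for i])
  }
  { fix u' assume u': "u' \<in> arr A P P'"
    have [simp]: "arrow A u'" "Dom A u' = P" "Cod A u' = P'"
      using A.C.arrowI[OF PX(2) PX'(2) u'] by auto
    show "RActA (Kb A M) w (u \<oplus>\<^bsub>Hom A P P'\<^esub> u') = RActA (Kb A M) w u
        \<oplus>\<^bsub>Hom (Kb A M) (RActO (Kb A M) X P) (RActO (Kb A M) X' P')\<^esub> RActA (Kb A M) w u'"
      by (simp add: cpx_act_simps M.arr_iff u u'
        right.bi_add_right[of "Term X i" "Term X' i" P P' for i])
  }
  { fix w' assume "w' \<in> arr (Kb A M) X X'"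
    then obtain f' where f' [simp]: "f' \<in> chain_maps M X X'" "w' = hmap M X X' f'"
      by (auto simp: M.hmap_module_simps)
    note [simp] = M.chain_mapsD(1-3)[OF f'(1)]
    show "RActA (Kb A M) (w \<oplus>\<^bsub>Hom (Kb A M) X X'\<^esub> w') u = RActA (Kb A M) w u
        \<oplus>\<^bsub>Hom (Kb A M) (RActO (Kb A M) X P) (RActO (Kb A M) X' P')\<^esub> RActA (Kb A M) w' u"
      by (simp add: cpx_act_simps right'.TA_add)
  }
  fix P'' X'' u' w'
  assume PX'' [simp]: "X'' \<in> Ob (Kb A M)" "P'' \<in> Ob A" and w': "w' \<in> arr (Kb A M) X' X''"
    and u': "u' \<in> arr A P' P''"
  have [simp]: "X'' \<in> bounded_complexes M" using PX'' by simp
  have [simp]: "arrow A u'" "Dom A u' = P'" "Cod A u' = P''"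
    using A.C.arrowI[OF PX'(2) PX''(2) u'] by auto
  obtain f' where f' [simp]: "f' \<in> chain_maps M X' X''" "w' = hmap M X' X'' f'"
    using w' by (auto simp: M.hmap_module_simps)
  note [simp] = M.chain_mapsD(1-3)[OF f'(1)]
  have [simp]: "(\<lambda>i. f' i \<cdot>\<^bsub>M\<^esub> f i) \<in> chain_maps M X X''"
    by (rule M.chain_cmp[of X X' X'']; simp)
  show "RActA (Kb A M) (Cmp (Kb A M) w' w) (u' \<cdot>\<^bsub>A\<^esub> u)
      = Cmp (Kb A M) (RActA (Kb A M) w' u') (RActA (Kb A M) w u)"
    by (simp add: right.TA_cmp)
qed

text \<open>The termwise inverses form a chain map whose class is the inverse. Only this strict case
  is wanted, for the structure isomorphisms.\<close>

lemma Kb_iso: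
  assumes XY: "X \<in> bounded_complexes M" "Y \<in> bounded_complexes M" and t: "t \<in> chain_maps M X Y"
    and iso [simp]: "\<And>i. invertible M (t i)"
  shows "iso_arr (Kb A M) X Y (hmap M X Y t)"
proof -
  note [simp] = XY t M.chain_inverse[OF XY t iso] M.chain_mapsD(1-3)[OF t XY] Kb_cmp
  show ?thesis
    unfolding iso_arr_def Kb_arr
    by (intro conjI imageI t bexI[of _ "hmap M Y X (\<lambda>i. inverse_arrow M (t i))"]) simp_all
qed

text \<open>Together with the next two lemmas this covers the shapes of the coherence axioms: a
  degreewise identity between composites of chain maps gives the identity between composites of
  classes.\<close>

lemma Kb_square:
  assumes "X \<in> bounded_complexes M" "Y \<in> bounded_complexes M" "Y' \<in> bounded_complexes M" "Z \<in> bounded_complexes M"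
    and "f \<in> chain_maps M X Y" "g \<in> chain_maps M Y Z" "f' \<in> chain_maps M X Y'" "g' \<in> chain_maps M Y' Z"
    and "\<And>i. g i \<cdot>\<^bsub>M\<^esub> f i = g' i \<cdot>\<^bsub>M\<^esub> f' i"
  shows "Cmp (Kb A M) (hmap M Y Z g) (hmap M X Y f) = Cmp (Kb A M) (hmap M Y' Z g') (hmap M X Y' f')"
  using assms by (simp add: Kb_cmp)

lemma Kb_triangle:
  assumes "X \<in> bounded_complexes M" "Y \<in> bounded_complexes M" "Z \<in> bounded_complexes M"
    and "f \<in> chain_maps M X Y" "g \<in> chain_maps M Y Z"
    and "\<And>i. g i \<cdot>\<^bsub>M\<^esub> f i = h i"
  shows "Cmp (Kb A M) (hmap M Y Z g) (hmap M X Y f) = hmap M X Z h"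
  using assms by (simp add: Kb_cmp)

lemma Kb_pentagon:
  assumes "X \<in> bounded_complexes M" "Y \<in> bounded_complexes M" "Z \<in> bounded_complexes M"
    and "V \<in> bounded_complexes M" "W \<in> bounded_complexes M"
    and "f \<in> chain_maps M X Y" "g \<in> chain_maps M Y Z"
    and "h \<in> chain_maps M X V" "k \<in> chain_maps M V W" "l \<in> chain_maps M W Z"
    and "\<And>i. g i \<cdot>\<^bsub>M\<^esub> f i = l i \<cdot>\<^bsub>M\<^esub> k i \<cdot>\<^bsub>M\<^esub> h i"
  shows "Cmp (Kb A M) (hmap M Y Z g) (hmap M X Y f)
    = Cmp (Kb A M) (hmap M W Z l) (Cmp (Kb A M) (hmap M V W k) (hmap M X V h))"
  using assms M.chain_cmp[OF assms(1,4,5,8,9)] by (simp add: Kb_cmp)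

text \<open>This is what allows the transport argument to be applied with \<open>Kb A M\<close> in
  place of \<open>M\<close>. Every coherence axiom is the axiom of \<open>M\<close> in each
  degree.\<close>

lemma bimodule_category_Kb: "bimodule_category K A (Kb A M)"
proof (intro bimodule_category.intro bimodule_category_axioms.intro bilinear_bifunctor_lact
    bilinear_bifunctor_ract linear_category_Kb A.monoidal_category_axioms)
  note [simp] = M.chain_ident
  fix N
  assume "N \<in> Ob (Kb A M)"
  then have N [simp]: "N \<in> bounded_complexes M" by simp
  show "iso_arr (Kb A M) (LActO (Kb A M) (Unit A) N) N (LActUnit (Kb A M) N)"
    "iso_arr (Kb A M) (RActO (Kb A M) N (Unit A)) N (RActUnit (Kb A M) N)"
    by (auto intro!: Kb_iso)
  fix P
  assume [simp]: "P \<in> Ob A"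
  show "Cmp (Kb A M) (LActA (Kb A M) (Ident A P) (LActUnit (Kb A M) N)) (LAssoc (Kb A M) P (Unit A) N)
      = LActA (Kb A M) (RUnit A P) (Ident (Kb A M) N)"
    by (simp, rule Kb_triangle) (simp_all add: cpx_act_simps left_triangle)
  show "Cmp (Kb A M) (RActA (Kb A M) (Ident (Kb A M) N) (LUnit A P)) (RAssoc (Kb A M) N (Unit A) P)
      = RActA (Kb A M) (RActUnit (Kb A M) N) (Ident A P)"
    by (simp, rule Kb_triangle) (simp_all add: cpx_act_simps right_triangle)
  fix Q
  assume [simp]: "Q \<in> Ob A"
  show "iso_arr (Kb A M) (LActO (Kb A M) (P \<star>\<^bsub>A\<^esub> Q) N) (LActO (Kb A M) P (LActO (Kb A M) Q N)) (LAssoc (Kb A M) P Q N)"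
    "iso_arr (Kb A M) (RActO (Kb A M) (RActO (Kb A M) N P) Q) (RActO (Kb A M) N (P \<star>\<^bsub>A\<^esub> Q)) (RAssoc (Kb A M) N P Q)"
    "iso_arr (Kb A M) (RActO (Kb A M) (LActO (Kb A M) P N) Q) (LActO (Kb A M) P (RActO (Kb A M) N Q)) (MAssoc (Kb A M) P N Q)"
    by (auto intro!: Kb_iso)
  fix R assume [simp]: "R \<in> Ob A"
  show "Cmp (Kb A M) (LAssoc (Kb A M) P Q (LActO (Kb A M) R N)) (LAssoc (Kb A M) (P \<star>\<^bsub>A\<^esub> Q) R N)
    = Cmp (Kb A M) (LActA (Kb A M) (Ident A P) (LAssoc (Kb A M) Q R N))
       (Cmp (Kb A M) (LAssoc (Kb A M) P (Q \<star>\<^bsub>A\<^esub> R) N) (LActA (Kb A M) (Assoc A P Q R) (Ident (Kb A M) N)))"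
    by (simp, rule Kb_pentagon) (simp_all, simp add: cpx_act_simps left_pentagon)
  show "Cmp (Kb A M) (RAssoc (Kb A M) N P (Q \<star>\<^bsub>A\<^esub> R)) (RAssoc (Kb A M) (RActO (Kb A M) N P) Q R)
    = Cmp (Kb A M) (RActA (Kb A M) (Ident (Kb A M) N) (Assoc A P Q R))
       (Cmp (Kb A M) (RAssoc (Kb A M) N (P \<star>\<^bsub>A\<^esub> Q) R) (RActA (Kb A M) (RAssoc (Kb A M) N P Q) (Ident A R)))"
    by (simp, rule Kb_pentagon) (simp_all, simp add: cpx_act_simps right_pentagon)
  show "Cmp (Kb A M) (LAssoc (Kb A M) P Q (RActO (Kb A M) N R)) (MAssoc (Kb A M) (P \<star>\<^bsub>A\<^esub> Q) N R)
    = Cmp (Kb A M) (LActA (Kb A M) (Ident A P) (MAssoc (Kb A M) Q N R))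
       (Cmp (Kb A M) (MAssoc (Kb A M) P (LActO (Kb A M) Q N) R) (RActA (Kb A M) (LAssoc (Kb A M) P Q N) (Ident A R)))"
    by (simp, rule Kb_pentagon) (simp_all, simp add: cpx_act_simps left_middle_pentagon)
  show "Cmp (Kb A M) (MAssoc (Kb A M) P N (Q \<star>\<^bsub>A\<^esub> R)) (RAssoc (Kb A M) (LActO (Kb A M) P N) Q R)
    = Cmp (Kb A M) (LActA (Kb A M) (Ident A P) (RAssoc (Kb A M) N Q R))
       (Cmp (Kb A M) (MAssoc (Kb A M) P (RActO (Kb A M) N Q) R) (RActA (Kb A M) (MAssoc (Kb A M) P N Q) (Ident A R)))"
    by (simp, rule Kb_pentagon) (simp_all, simp add: cpx_act_simps right_middle_pentagon)
next
  fix N N' w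
  assume "N \<in> Ob (Kb A M)" "N' \<in> Ob (Kb A M)" and w: "w \<in> arr (Kb A M) N N'"
  then have N [simp]: "N \<in> bounded_complexes M" "N' \<in> bounded_complexes M" by simp_all
  obtain h where h [simp]: "h \<in> chain_maps M N N'" "w = hmap M N N' h"
    using w by (auto simp: M.hmap_module_simps)
  note [simp] = M.chain_mapsD(1-3)[OF h(1) N]
  show "Cmp (Kb A M) (LActUnit (Kb A M) N') (LActA (Kb A M) (Ident A (Unit A)) w)
      = Cmp (Kb A M) w (LActUnit (Kb A M) N)"
    by (simp, rule Kb_square) (simp_all add: cpx_act_simps lactunit_natural)
  show "Cmp (Kb A M) (RActUnit (Kb A M) N') (RActA (Kb A M) w (Ident A (Unit A)))
      = Cmp (Kb A M) w (RActUnit (Kb A M) N)"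
    by (simp, rule Kb_square) (simp_all add: cpx_act_simps ractunit_natural)
  fix P P' u
  assume P: "P \<in> Ob A" "P' \<in> Ob A" "u \<in> arr A P P'"
  note [simp] = P(1,2) A.C.arrowI[OF P]
  fix Q Q' v
  assume Q: "Q \<in> Ob A" "Q' \<in> Ob A" "v \<in> arr A Q Q'"
  note [simp] = Q(1,2) A.C.arrowI[OF Q]
  show "Cmp (Kb A M) (LAssoc (Kb A M) P' Q' N') (LActA (Kb A M) (u \<ast>\<^bsub>A\<^esub> v) w)
      = Cmp (Kb A M) (LActA (Kb A M) u (LActA (Kb A M) v w)) (LAssoc (Kb A M) P Q N)"
    by (simp, rule Kb_square) (simp_all add: cpx_act_simps lassoc_natural)
  show "Cmp (Kb A M) (RAssoc (Kb A M) N' P' Q') (RActA (Kb A M) (RActA (Kb A M) w u) v)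
      = Cmp (Kb A M) (RActA (Kb A M) w (u \<ast>\<^bsub>A\<^esub> v)) (RAssoc (Kb A M) N P Q)"
    by (simp, rule Kb_square) (simp_all add: cpx_act_simps rassoc_natural)
  show "Cmp (Kb A M) (MAssoc (Kb A M) P' N' Q') (RActA (Kb A M) (LActA (Kb A M) u w) v)
      = Cmp (Kb A M) (LActA (Kb A M) u (RActA (Kb A M) w v)) (MAssoc (Kb A M) P N Q)"
    by (simp, rule Kb_square) (simp_all add: cpx_act_simps massoc_natural)
qed

end

section \<open>Twisting and the homotopy category\<close>

lemma twist_lin_cat_simps [simp]:
  "Ob (twist \<Phi> M) = Ob M" "Dom (twist \<Phi> M) = Dom M" "Cod (twist \<Phi> M) = Cod M"
  "Hom (twist \<Phi> M) = Hom M" "Ident (twist \<Phi> M) = Ident M" "Cmp (twist \<Phi> M) = Cmp M"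
  by (simp_all add: twist_def)

lemma twist_act_simps [simp]:
  "LActO (twist \<Phi> M) = (\<lambda>X N. FO \<Phi> X \<triangleright>\<^bsub>M\<^esub> N)" "LActA (twist \<Phi> M) = (\<lambda>f h. FA \<Phi> f \<unrhd>\<^bsub>M\<^esub> h)"
  "RActO (twist \<Phi> M) = RActO M" "RActA (twist \<Phi> M) = RActA M"
  "LAssoc (twist \<Phi> M) = (\<lambda>X Y N. LAssoc M (FO \<Phi> X) (FO \<Phi> Y) N \<cdot>\<^bsub>M\<^esub> (FMult \<Phi> X Y \<unrhd>\<^bsub>M\<^esub> Ident M N))"
  "RAssoc (twist \<Phi> M) = RAssoc M" "MAssoc (twist \<Phi> M) = (\<lambda>X N Y. MAssoc M (FO \<Phi> X) N Y)"
  by (simp_all add: twist_def)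

text \<open>Twisting alters only the left action and its structure arrows. Complexes, chain maps,
  homotopies and the right action see none of these and are literally the same.\<close>

lemma homotopy_category_twist [simp]:
  fixes M :: "('k, 'a, 'f, 'o, 'm, 'y) bimod_cat_scheme"
  shows "bounded_complexes (twist \<Phi> M) = bounded_complexes M" "chain_maps (twist \<Phi> M) = chain_maps M"
    "hmap (twist \<Phi> M) = hmap M" "hmap_lift (twist \<Phi> M) = hmap_lift M"
    "hmap_lift2 (twist \<Phi> M) = hmap_lift2 M" "hmap_module (twist \<Phi> M) = hmap_module M"
    "cpx_ract A (twist \<Phi> M) = cpx_ract A M"
proof -
  have *: "homotopy_class (twist \<Phi> M) = homotopy_class M" "chain_maps (twist \<Phi> M) = chain_maps M"
    by (simp_all add: fun_eq_iff homotopy_class_def chain_maps_def homotopic_def)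
  show "bounded_complexes (twist \<Phi> M) = bounded_complexes M" "chain_maps (twist \<Phi> M) = chain_maps M"
    "cpx_ract A (twist \<Phi> M) = cpx_ract A M"
    by (simp_all add: fun_eq_iff bounded_complexes_def zero_object_def * cpx_ract_def)
  show **: "hmap (twist \<Phi> M) = hmap M" "hmap_lift (twist \<Phi> M) = hmap_lift M"
    "hmap_lift2 (twist \<Phi> M) = hmap_lift2 M"
    by (simp_all add: fun_eq_iff hmap_def hmap_lift_def hmap_lift2_def *)
  show "hmap_module (twist \<Phi> M) = hmap_module M"
    by (simp add: fun_eq_iff hmap_module_def * **)
qed

lemma Kb_twist_simps [simp]:
  "Ob (Kb A (twist \<Phi> M)) = Ob (Kb A M)" "Hom (Kb A (twist \<Phi> M)) = Hom (Kb A M)"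
  "Ident (Kb A (twist \<Phi> M)) = Ident (Kb A M)" "Cmp (Kb A (twist \<Phi> M)) = Cmp (Kb A M)"
  "RActO (Kb A (twist \<Phi> M)) = RActO (Kb A M)" "RActA (Kb A (twist \<Phi> M)) = RActA (Kb A M)"
  "RAssoc (Kb A (twist \<Phi> M)) = RAssoc (Kb A M)"
  by (simp_all add: Kb_def Let_def)

context bimodule_category
begin

text \<open>The differentials are acted on by \<open>FA \<Phi> (Ident A P)\<close>, which is known
  to be an identity only when \<open>P\<close> is an object; hence the premises.\<close>

lemma cpx_lact_twist:
  assumes "linear_functor K A A \<Phi>" "P \<in> Ob A"
  shows "cpx_lact A (twist \<Phi> M) P X = lact (FO \<Phi> P) X"
  using assms by (simp add: cpx_lact_def linear_functor.FA_Ident)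

lemma Kb_LActA_twist:
  assumes "linear_functor K A A \<Phi>" and u: "arrow A u"
  shows "LActA (Kb A (twist \<Phi> M)) u w = LActA (Kb A M) (FA \<Phi> u) w"
proof -
  interpret Phi: linear_functor K A A \<Phi> by fact
  show ?thesis
    using u by (cases w) (simp add: Kb_def Let_def cpx_lact_twist assms(1))
qed

lemma Kb_MAssoc_twist:
  assumes "linear_functor K A A \<Phi>" "P \<in> Ob A"
  shows "MAssoc (Kb A (twist \<Phi> M)) P X Q = MAssoc (Kb A M) (FO \<Phi> P) X Q"
  using assms by (simp add: Kb_def Let_def cpx_lact_twist)

text \<open>On the left the two factors are composed in each degree before passing to classes, on
  the right two classes are composed. \<open>Kb_cmp\<close> identifies the results, once
  \<open>FMult \<Phi> P Q\<close> is known to be an arrow of \<open>A\<close> and therefore acts by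
  a chain map.\<close>

lemma Kb_LAssoc_twist:
  assumes "monoidal_functor K A A \<Phi>" "P \<in> Ob A" "Q \<in> Ob A" "X \<in> Ob (Kb A M)"
  shows "LAssoc (Kb A (twist \<Phi> M)) P Q X = LAssoc (twist \<Phi> (Kb A M)) P Q X"
proof -
  interpret Phi: monoidal_functor K A A \<Phi> by fact
  have [simp]: "X \<in> bounded_complexes M" using assms by simp
  have m: "arrow A (FMult \<Phi> P Q)" "Dom A (FMult \<Phi> P Q) = FO \<Phi> (P \<star>\<^bsub>A\<^esub> Q)"
    "Cod A (FMult \<Phi> P Q) = FO \<Phi> P \<star>\<^bsub>A\<^esub> FO \<Phi> Q"
    using A.C.iso_arrD[OF _ _ Phi.fmult_iso[OF assms(2,3)]] assms by auto
  have "LAssoc (Kb A (twist \<Phi> M)) P Q X = hmap M (lact (FO \<Phi> (P \<star>\<^bsub>A\<^esub> Q)) X) (lact (FO \<Phi> P) (lact (FO \<Phi> Q) X))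
      (\<lambda>i. LAssoc M (FO \<Phi> P) (FO \<Phi> Q) (Term X i) \<cdot>\<^bsub>M\<^esub> (FMult \<Phi> P Q \<unrhd>\<^bsub>M\<^esub> Ident M (Term X i)))"
    using assms by (simp add: Kb_def Let_def cpx_lact_twist Phi.linear_functor_axioms)
  then show ?thesis
    using assms m by (simp add: M.chain_ident, subst Kb_cmp) (simp_all add: M.chain_ident)
qed

section \<open>The autoequivalence and the centralizer object\<close>

lemma linear_functor_L_fun: "Z \<in> Ob M \<Longrightarrow> linear_functor K A M (L_fun M Z)"
  unfolding L_fun_def by (rule right.linear_functor_left)

lemma linear_functor_R_fun: "Z \<in> Ob M \<Longrightarrow> linear_functor K A M (R_fun M Z)"
  unfolding R_fun_def by (rule left.linear_functor_right)

text \<open>The equality of essential images enters as two inclusions: one lifts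
  \<open>L_fun\<close> along \<open>R_fun\<close> and yields the functor together with
  \<open>\<tau>\<close>, the other lifts \<open>R_fun\<close> along \<open>L_fun\<close> and yields
  the quasi-inverse.\<close>

lemma ex_centralizing_autoequivalence:
  assumes Z: "Z \<in> Ob M" and L: "fully_faithful A M (L_fun M Z)" and R: "fully_faithful A M (R_fun M Z)"
    and img: "ess_image A M (L_fun M Z) = ess_image A M (R_fun M Z)"
  shows "\<exists>\<Phi> :: ('a, 'f, 'a, 'f) mon_fctr. monoidal_autoequivalence K A \<Phi> \<and>
    (\<exists>\<tau>. (Z, \<tau>) \<in> centralizer_objects A (twist \<Phi> M))"
proof -
  note LF = linear_functor_L_fun[OF Z] and RF = linear_functor_R_fun[OF Z]
  \<comment> \<open>Identities place each value of a functor in its own essential image;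
    \<open>img\<close> then moves it into the essential image of the other functor.\<close>
  have self: "FO F X \<in> ess_image A M F" if "linear_functor K A M F" "X \<in> Ob A"
    for F :: "('a, 'f, 'o, 'm) fctr" and X
  proof -
    interpret F: linear_functor K A M F by fact
    show ?thesis
      using that(2) by (auto simp: ess_image_def M.iso_arr_iff
        intro!: bexI[of _ X] exI[of _ "Ident M (FO F X)"])
  qed
  obtain H :: "('a, 'f, 'a, 'f) fctr" and \<tau> where
    H: "linear_functor K A A H" "nat_iso A M (L_fun M Z) (fun_comp (R_fun M Z) H) \<tau>"
    using lift_along_fully_faithful[OF LF RF R] self[OF LF] img by blast
  obtain H' :: "('a, 'f, 'a, 'f) fctr" and \<sigma> where
    H': "linear_functor K A A H'" "nat_iso A M (R_fun M Z) (fun_comp (L_fun M Z) H') \<sigma>"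
    using lift_along_fully_faithful[OF RF LF L] self[OF RF] img by blast
  interpret H: linear_functor K A A H by (rule H(1))
  interpret conjugation K A M H Z \<tau>
    by unfold_locales (fact Z R H(2))+
  have "equivalence K A A H"
    by (rule equivalence_of_lifts[OF LF L RF R H H'])
  \<comment> \<open>\<open>transported\<close> is a record of a larger type than \<open>H\<close>,
    but has the same \<open>FO\<close> and \<open>FA\<close>, and being an equivalence depends on
    these alone.\<close>
  then have "equivalence K A A transported"
    using monoidal_functor.axioms(3)[OF monoidal_functor_transported]
    by (simp add: equivalence_def fun_comp_def)
  then have "monoidal_autoequivalence K A transported"
    using monoidal_functor_transported by (simp add: monoidal_autoequivalence_def)
  then show ?thesis
    using tau_centralizes by blast
qed

text \<open>The defining clauses mention the left action and its structure arrows only at objects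
  and arrows of \<open>A\<close>, where the two records have been shown to agree.\<close>

lemma centralizer_Kb_twist:
  assumes \<Phi>: "monoidal_functor K A A \<Phi>" and "(Z, \<tau>) \<in> centralizer_objects A (twist \<Phi> (Kb A M))"
  shows "(Z, \<tau>) \<in> centralizer_objects A (Kb A (twist \<Phi> M))"
proof -
  interpret Phi: monoidal_functor K A A \<Phi> by fact
  note lin = Phi.linear_functor_axioms
  have [simp]: "LActO (Kb A (twist \<Phi> M)) X Z = LActO (Kb A M) (FO \<Phi> X) Z" if "X \<in> Ob A" for X
    using cpx_lact_twist[OF lin that] by (simp add: Kb_def Let_def)
  \<comment> \<open>The operations of \<open>Kb\<close> and the term
    \<open>FA \<Phi> (Ident A X)\<close> are kept folded, so that hypothesis and goal meet in the
    same syntactic form.\<close>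
  show ?thesis
    using assms(2)
    by (auto simp: centralizer_objects_def nat_iso_def iso_arr_def L_fun_def R_fun_def
      Kb_LActA_twist[OF lin] Kb_MAssoc_twist[OF lin] Kb_LAssoc_twist[OF \<Phi>] A.C.arr_iff
      simp del: Kb_simps Phi.FA_Ident)
qed

end

theorem theorem1p4:
  fixes K :: "('k, 'r) ring_scheme"
    and A :: "('k, 'a, 'f, 'z) mon_cat_scheme"
    and M :: "('k, 'a, 'f, 'o, 'm, 'y) bimod_cat_scheme"
    and Z :: "('o, 'm) cpx"
  assumes "monoidal_category K A"
    and "bimodule_category K A M"
    and "Z \<in> Ob (Kb A M)"
    and "fully_faithful A (Kb A M) (L_fun (Kb A M) Z)"
    and "fully_faithful A (Kb A M) (R_fun (Kb A M) Z)"
    and "ess_image A (Kb A M) (L_fun (Kb A M) Z) = ess_image A (Kb A M) (R_fun (Kb A M) Z)"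
  shows "\<exists>\<Phi> :: ('a, 'f, 'a, 'f) mon_fctr. monoidal_autoequivalence K A \<Phi> \<and>
    (\<exists>\<tau>. (Z, \<tau>) \<in> centralizer_objects A (Kb A (twist \<Phi> M)))"
proof -
  obtain \<Phi> :: "('a, 'f, 'a, 'f) mon_fctr" and \<tau> where
    \<Phi>: "monoidal_autoequivalence K A \<Phi>" "(Z, \<tau>) \<in> centralizer_objects A (twist \<Phi> (Kb A M))"
    using bimodule_category.ex_centralizing_autoequivalence[OF
        bimodule_category.bimodule_category_Kb[OF assms(2)] assms(3-6)]
    by blast
  then have "(Z, \<tau>) \<in> centralizer_objects A (Kb A (twist \<Phi> M))"
    by (intro bimodule_category.centralizer_Kb_twist[OF assms(2)])
      (simp_all add: monoidal_autoequivalence_def)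
  with \<Phi>(1) show ?thesis
    by blast
qed

end
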